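(* Let $(\alpha_k)_{k\in\mathbb N}$ be a sequence of positive real numbers such that $\sum_{k=0}^\infty\alpha_k<1$ and $\sum_{k=0}^\infty k\alpha_k<+\infty$. Let $(X_k)_{k\ge1}$ and $H_n=\sum_{k=1}^nX_k$ be the associated discrete Hawkes process, let $\lambda_t$ be its (piecewise constant) intensity, and set $$F^n:=\frac{H_n-\int_0^n\lambda_tdt}{\sqrt n},\quad n\ge1,\qquad |\alpha|:=\sum_{k\ge1}\alpha_k,\qquad\varsigma^2:=\frac{\alpha_0}{1-|\alpha|}.$$ Then there exists $C>0$ such that for all integers $n\ge1$, $$d_W(F^n,G)\le\frac{C}{\sqrt n},\qquad G\sim\mathcal N(0,\varsigma^2).$$
   Context: Discrete Hawkes process: with $\mathcal P(\beta)$ the Poisson law of mean $\beta>0$, $X_1\sim\mathcal P(\alpha_0)$ and, for each $k\ge1$, conditionally on $\sigma(X_i,\,i\le k-1)$, $X_k\sim\mathcal P(\lambda^{(d)}_k)$ where $\lambda^{(d)}_k:=\alpha_0+\sum_{i=1}^{k-1}\alpha_{k-i}X_i$ (so $\lambda^{(d)}_1=\alpha_0$). The intensity is $\lambda_t:=\alpha_0\mathbf 1_{[0,1)}(t)+\sum_{k=2}^\infty\lambda^{(d)}_k\mathbf 1_{[k-1,k)}(t)$, so that $\int_0^n\lambda_tdt=\sum_{k=1}^n\lambda^{(d)}_k$. Wasserstein distance: $d_W(F,G)=\sup_u|\mathbb E[u(F)]-\mathbb E[u(G)]|$ over $1$-Lipschitz $u:\mathbb R\to\mathbb R$. *)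

theory Defs
  imports "HOL-Probability.Probability"
begin

text \<open>The process is indexed by \<open>k \<ge> 1\<close>; the value \<open>X 0\<close> is never used.\<close>

definition hawkes_rate :: "(nat \<Rightarrow> real) \<Rightarrow> (nat \<Rightarrow> 'a \<Rightarrow> nat) \<Rightarrow> nat \<Rightarrow> 'a \<Rightarrow> real" where
  "hawkes_rate \<alpha> X k \<omega> = \<alpha> 0 + (\<Sum>i = 1..<k. \<alpha> (k - i) * real (X i \<omega>))"

text \<open>
  The \<open>\<sigma>\<close>-algebra generated by \<open>X i\<close>, \<open>1 \<le> i \<le> k - 1\<close>, on the space of \<open>M\<close>. It is written with
  \<open>sigma\<close> rather than as a supremum of \<open>vimage_algebra\<close>s so that for \<open>k = 1\<close> it is the trivial
  \<open>\<sigma>\<close>-algebra on \<open>space M\<close>, and not the measure with empty space.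
\<close>

definition hawkes_past :: "'a measure \<Rightarrow> (nat \<Rightarrow> 'a \<Rightarrow> nat) \<Rightarrow> nat \<Rightarrow> 'a measure" where
  "hawkes_past M X k = sigma (space M) (\<Union>i\<in>{1..<k}. {X i -` A \<inter> space M | A. True})"

text \<open>
  The last conjunct says that the conditional law of \<open>X k\<close> given the past is Poisson with the
  (random) mean \<open>hawkes_rate \<alpha> X k\<close>. The library's \<open>poisson_pmf\<close> is specified only for positive
  means; here the mean is at least \<open>\<alpha> 0\<close> whenever all \<open>\<alpha> k\<close> are nonnegative.
\<close>

definition discrete_hawkes :: "'a measure \<Rightarrow> (nat \<Rightarrow> real) \<Rightarrow> (nat \<Rightarrow> 'a \<Rightarrow> nat) \<Rightarrow> bool" where
  "discrete_hawkes M \<alpha> X \<longleftrightarrow>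
     prob_space M \<and>
     (\<forall>k\<ge>1. X k \<in> M \<rightarrow>\<^sub>M count_space UNIV) \<and>
     distr M (count_space UNIV) (X 1) = measure_pmf (poisson_pmf (\<alpha> 0)) \<and>
     (\<forall>k\<ge>1. \<forall>A. AE \<omega> in M.
        real_cond_exp M (hawkes_past M X k) (\<lambda>\<omega>. indicator A (X k \<omega>)) \<omega>
          = measure_pmf.prob (poisson_pmf (hawkes_rate \<alpha> X k \<omega>)) A)"

definition hawkes_count :: "(nat \<Rightarrow> 'a \<Rightarrow> nat) \<Rightarrow> nat \<Rightarrow> 'a \<Rightarrow> nat" where
  "hawkes_count X n \<omega> = (\<Sum>k = 1..n. X k \<omega>)"

text \<open>The sum over \<open>k \<ge> 2\<close> is shifted to start at \<open>0\<close>; for each \<open>t\<close> at most one term is nonzero.\<close>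

definition hawkes_intensity :: "(nat \<Rightarrow> real) \<Rightarrow> (nat \<Rightarrow> 'a \<Rightarrow> nat) \<Rightarrow> real \<Rightarrow> 'a \<Rightarrow> real" where
  "hawkes_intensity \<alpha> X t \<omega> =
     \<alpha> 0 * indicator {0..<1} t
     + (\<Sum>k. hawkes_rate \<alpha> X (k + 2) \<omega> * indicator {real k + 1..<real k + 2} t)"

definition hawkes_F :: "(nat \<Rightarrow> real) \<Rightarrow> (nat \<Rightarrow> 'a \<Rightarrow> nat) \<Rightarrow> nat \<Rightarrow> 'a \<Rightarrow> real" where
  "hawkes_F \<alpha> X n \<omega> =
     (real (hawkes_count X n \<omega>) - (LINT t:{0..real n}|lborel. hawkes_intensity \<alpha> X t \<omega>)) / sqrt (real n)"

text \<open>
  Wasserstein distance of two laws on the real line; if \<open>F\<close> has law \<open>\<mu>\<close>, then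
  \<open>\<integral>x. u x \<partial>\<mu>\<close> is the expectation of \<open>u(F)\<close>. The Bochner integral of a non-integrable function
  is \<open>0\<close>, so the value is set to \<open>\<infinity>\<close> unless both laws have a finite first moment; under that
  condition every Lipschitz function is integrable.
\<close>

definition wasserstein_dist :: "real measure \<Rightarrow> real measure \<Rightarrow> ennreal" where
  "wasserstein_dist \<mu> \<nu> =
     (if integrable \<mu> (\<lambda>x. x) \<and> integrable \<nu> (\<lambda>x. x)
      then SUP u\<in>{u :: real \<Rightarrow> real. 1-lipschitz_on UNIV u}.
             ennreal \<bar>(\<integral>x. u x \<partial>\<mu>) - (\<integral>x. u x \<partial>\<nu>)\<bar>
      else \<infinity>)"

end

theory Submission
  imports Defs
begin

text \<open>
  Put \<open>\<xi>\<^sub>k = X\<^sub>k - \<lambda>\<^sub>k\<close>, so that \<open>F\<^sup>n = M\<^sub>n / \<surd>n\<close> for the martingale \<open>M\<^sub>n = \<xi>\<^sub>1 + \<dots> + \<xi>\<^sub>n\<close>; it is enough to bound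
  the distance \<open>\<delta>\<^sub>n\<close> of \<open>M\<^sub>n\<close> from \<open>N(0, n\<sigma>\<^sup>2)\<close> by a constant. A 1-Lipschitz \<open>u\<close> is smoothed by a Gaussian of
  variance \<open>T\<^sub>k = \<epsilon> + (n - k)\<sigma>\<^sup>2\<close>, giving \<open>f\<^sub>k\<close>, and the \<open>k\<close>-th increment is exchanged for a Gaussian one. The error is
  \<open>E[f\<^sub>k''(M\<^sub>k\<^sub>-\<^sub>1) (\<lambda>\<^sub>k - \<sigma>\<^sup>2)]/2 + E[f\<^sub>k'''(M\<^sub>k\<^sub>-\<^sub>1) \<lambda>\<^sub>k]/6\<close> up to \<open>O(T\<^sub>k\<^sup>-\<^sup>3\<^sup>/\<^sup>2)\<close>, which is summable.

  Since \<open>\<lambda>\<^sub>i - \<sigma>\<^sup>2\<close> is a convolution of \<open>\<alpha>\<close> with \<open>(\<lambda>\<^sub>l - \<sigma>\<^sup>2) + \<xi>\<^sub>l\<close>, up to a summable term, and \<open>f\<^sub>k''(M\<^sub>i\<^sub>-\<^sub>1)\<close> may be expanded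
  around \<open>M\<^sub>l\<^sub>-\<^sub>1\<close>, the first term satisfies a renewal inequality with kernel of mass \<open>|\<alpha>| < 1\<close> and source
  \<open>E[f\<^sub>k'''(M\<^sub>l\<^sub>-\<^sub>1) \<lambda>\<^sub>l]\<close>. The bound \<open>|f\<^sub>k'''| \<le> C/T\<^sub>k\<close> alone would leave a factor \<open>log n\<close>; but replacing \<open>M\<^sub>l\<close> by a Gaussian
  smooths \<open>f\<^sub>k'''\<close> further, down to \<open>C/(T\<^sub>k + l\<sigma>\<^sup>2)\<close>, at the price of \<open>\<delta>\<^sub>l T\<^sub>k\<^sup>-\<^sup>3\<^sup>/\<^sup>2\<close>. In total
  \<open>\<delta>\<^sub>n \<le> C(\<epsilon>) + C \<epsilon>\<^sup>-\<^sup>1\<^sup>/\<^sup>2 max\<^sub>l\<^sub>\<le>\<^sub>n \<delta>\<^sub>l\<close>, and a large fixed \<open>\<epsilon>\<close> closes the estimate.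
\<close>

section \<open>Gaussian smoothing\<close>

text \<open>Two obstacles shape the argument. The Poisson increments have third central moment
  \<open>rate\<close>, not 0, so an exchange that matches two moments leaves a term in
  \<open>f3\<close> which must be made small by averaging and not by cancellation. And the renewal
  inequality runs over times i at a fixed scale k, while the errors are needed at i = k. Its kernel
  depends on i - l only, so shifting k together with i keeps it closed: sums over the diagonals i =
  k - s bound one another, and only diagonal sums of the sources are needed. The first moment of
  \<open>\<alpha>\<close> pays for moving a test function from time i back to time l, at a cost
  proportional to i - l, and for the kernel mass that reaches before time 1. Only a second moment of
  \<open>rate\<close>, bounded uniformly in time, enters the remainders, because the fourth central
  moment of a Poisson law is quadratic in its mean. The last step bounds a supremum by a constant
  plus half of itself, so that supremum must be known to be finite; it runs over all 1-Lipschitz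
  functions, because the exchange produces test functions other than the given one.\<close>

lemma has_real_derivative_quadratic_bound:
  fixes f :: "real \<Rightarrow> real"
  assumes "\<And>h. \<bar>h\<bar> \<le> 1 \<Longrightarrow> \<bar>f (x + h) - f x - h * D\<bar> \<le> C * h\<^sup>2"
  shows "(f has_real_derivative D) (at x)"
proof -
  have "((\<lambda>h. (f (x + h) - f x) / h - D) \<longlongrightarrow> 0) (at 0)"
  proof (rule Lim_null_comparison)
    show "((\<lambda>h. C * \<bar>h\<bar>) \<longlongrightarrow> 0) (at 0)"
      by (auto intro!: tendsto_eq_intros)
    have "\<forall>\<^sub>F h in at (0::real). \<bar>h\<bar> \<le> 1 \<and> h \<noteq> 0"
      unfolding eventually_at by (rule exI[of _ 1]) auto
    then show "\<forall>\<^sub>F h in at 0. norm ((f (x + h) - f x) / h - D) \<le> C * \<bar>h\<bar>"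
    proof (rule eventually_mono)
      fix h :: real assume h: "\<bar>h\<bar> \<le> 1 \<and> h \<noteq> 0"
      have "h * ((f (x + h) - f x) / h - D) = f (x + h) - f x - h * D"
        using h by (simp add: field_simps)
      then have "\<bar>h\<bar> * \<bar>(f (x + h) - f x) / h - D\<bar> = \<bar>f (x + h) - f x - h * D\<bar>"
        by (metis abs_mult)
      also have "\<dots> \<le> C * h\<^sup>2" using assms h by blast
      also have "\<dots> = \<bar>h\<bar> * (C * \<bar>h\<bar>)" by (simp add: power2_eq_square)
      finally show "norm ((f (x + h) - f x) / h - D) \<le> C * \<bar>h\<bar>"
        using h by (simp add: mult_le_cancel_left_pos)
    qed
  qed
  then have "((\<lambda>h. (f (x + h) - f x) / h) \<longlongrightarrow> D) (at 0)"
    by (rule LIM_zero_cancel)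
  then show ?thesis by (simp add: DERIV_def)
qed

section \<open>Lipschitz functions and Taylor remainders\<close>

lemma lipschitz_abs_le:
  fixes f :: "real \<Rightarrow> real"
  assumes "L-lipschitz_on UNIV f"
  shows "\<bar>f y - f x\<bar> \<le> L * \<bar>y - x\<bar>"
  using lipschitz_onD[OF assms, of y x] by (simp add: dist_real_def)

lemma lipschitzI_abs:
  fixes f :: "real \<Rightarrow> real"
  assumes "\<And>x y. \<bar>f y - f x\<bar> \<le> L * \<bar>y - x\<bar>" "0 \<le> L"
  shows "L-lipschitz_on UNIV f"
  using assms by (intro lipschitz_onI) (auto simp: dist_real_def)

lemma lipschitz_borel:
  fixes f :: "real \<Rightarrow> real"
  assumes "L-lipschitz_on UNIV f"
  shows "f \<in> borel_measurable borel"
  using lipschitz_on_continuous_on[OF assms] by (rule borel_measurable_continuous_onI)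

lemma lipschitz_derivative_bound:
  fixes f :: "real \<Rightarrow> real"
  assumes "L-lipschitz_on UNIV f" and "(f has_real_derivative D) (at x)"
  shows "\<bar>D\<bar> \<le> L"
proof -
  have "((\<lambda>h. (f (x + h) - f x) / h) \<longlongrightarrow> D) (at 0)"
    using assms(2) by (simp add: DERIV_def)
  then have "((\<lambda>h. \<bar>(f (x + h) - f x) / h\<bar>) \<longlongrightarrow> \<bar>D\<bar>) (at 0)"
    by (rule tendsto_rabs)
  moreover have "\<forall>\<^sub>F h in at (0::real). \<bar>(f (x + h) - f x) / h\<bar> \<le> L"
    unfolding eventually_at
  proof (intro exI[of _ 1] conjI ballI impI)
    fix h :: real assume "h \<noteq> 0 \<and> dist h 0 < 1"
    then show "\<bar>(f (x + h) - f x) / h\<bar> \<le> L"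
      using lipschitz_abs_le[OF assms(1), of "x + h" x] by (simp add: abs_divide pos_divide_le_eq)
  qed auto
  ultimately show ?thesis by (rule tendsto_upperbound) simp
qed

lemma derivative_bound_lipschitz:
  fixes f :: "real \<Rightarrow> real"
  assumes D: "\<And>x. (f has_real_derivative f' x) (at x)" and B: "\<And>x. \<bar>f' x\<bar> \<le> B"
  shows "B-lipschitz_on UNIV f"
proof (rule lipschitzI_abs)
  show "0 \<le> B" using B[of 0] by linarith
  fix x y
  show "\<bar>f y - f x\<bar> \<le> B * \<bar>y - x\<bar>"
    using field_differentiable_bound[of UNIV f f' B y x] D B by auto
qed

text \<open>The mean value theorem gives \<open>f'\<close> at a point between x and y, and the
  Lipschitz bound moves that point to x. Taylor's formula would halve the constant but asks for a
  second derivative, which is not at hand for the last of the smoothed functions.\<close>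

lemma first_order_expansion:
  fixes f :: "real \<Rightarrow> real"
  assumes D: "\<And>x. (f has_real_derivative f' x) (at x)" and L: "B-lipschitz_on UNIV f'"
  shows "\<bar>f y - f x - f' x * (y - x)\<bar> \<le> B * (y - x)\<^sup>2"
proof (cases "y = x")
  case False
  have "\<exists>\<xi>. \<bar>\<xi> - x\<bar> \<le> \<bar>y - x\<bar> \<and> f y - f x = (y - x) * f' \<xi>"
  proof (cases "x < y")
    case True
    from MVT2[OF True, of f f'] D obtain z where "x < z" "z < y" "f y - f x = (y - x) * f' z" by auto
    then show ?thesis by (intro exI[of _ z]) auto
  next
    case F: False
    with False have "y < x" by simp
    from MVT2[OF this, of f f'] D obtain z where z: "y < z" "z < x" "f x - f y = (x - y) * f' z" by auto
    then show ?thesis by (intro exI[of _ z]) (auto simp: algebra_simps)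
  qed
  then obtain z where z: "\<bar>z - x\<bar> \<le> \<bar>y - x\<bar>" "f y - f x = (y - x) * f' z" by blast
  have "\<bar>f y - f x - f' x * (y - x)\<bar> = \<bar>y - x\<bar> * \<bar>f' z - f' x\<bar>"
    unfolding z(2) by (simp flip: abs_mult add: algebra_simps)
  also have "\<dots> \<le> \<bar>y - x\<bar> * (B * \<bar>z - x\<bar>)"
    by (intro mult_left_mono lipschitz_abs_le L) auto
  also have "\<dots> \<le> \<bar>y - x\<bar> * (B * \<bar>y - x\<bar>)"
    using z lipschitz_on_nonneg[OF L] by (intro mult_left_mono) auto
  finally show ?thesis by (simp add: power2_eq_square ac_simps flip: abs_mult)
qed simp

text \<open>Taylor's formula is stopped with the third derivative at an intermediate point t, and
  the Lipschitz bound replaces \<open>f3 t\<close> by \<open>f3 x\<close>. The error is of order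
  \<open>d ^ 4\<close> without a fourth derivative; 1/6 in place of 1/24 is the price.\<close>

lemma third_order_expansion:
  fixes f :: "real \<Rightarrow> real"
  assumes D1: "\<And>x. (f has_real_derivative f1 x) (at x)"
    and D2: "\<And>x. (f1 has_real_derivative f2 x) (at x)"
    and D3: "\<And>x. (f2 has_real_derivative f3 x) (at x)"
    and L: "B-lipschitz_on UNIV f3"
  shows "\<bar>f (x + d) - f x - f1 x * d - f2 x * d ^ 2 / 2 - f3 x * d ^ 3 / 6\<bar> \<le> B * d ^ 4 / 6"
proof (cases "d = 0")
  case False
  define df where "df = (\<lambda>m::nat. if m = 0 then f else if m = 1 then f1 else if m = 2 then f2 else f3)"
  have DD: "DERIV (df m) t :> df (Suc m) t" if m: "m < 3" for m t
  proof -
    consider "m = 0" | "m = 1" | "m = 2" using m by linarith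
    then show ?thesis using D1 D2 D3 by cases (auto simp: df_def)
  qed
  have *: "(\<Sum>m<3. df m x / fact m * d ^ m) = f x + f1 x * d + f2 x * d ^ 2 / 2"
    by (simp add: numeral_3_eq_3 df_def power2_eq_square)
  have "\<exists>t. \<bar>t - x\<bar> \<le> \<bar>d\<bar> \<and> f (x + d) = (\<Sum>m<3. df m x / fact m * d ^ m) + f3 t / fact 3 * d ^ 3"
  proof (cases "d > 0")
    case True
    from Taylor_up[of 3 df f x "x + d" x] DD True obtain t where
      "x < t" "t < x + d" "f (x + d) = (\<Sum>m<3. df m x / fact m * (x + d - x) ^ m) + df 3 t / fact 3 * (x + d - x) ^ 3"
      by (auto simp: df_def)
    then show ?thesis by (intro exI[of _ t]) (auto simp: df_def)
  next
    case F: False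
    with False have "d < 0" by simp
    with Taylor_down[of 3 df f "x + d" x x] DD obtain t where
      "x + d < t" "t < x" "f (x + d) = (\<Sum>m<3. df m x / fact m * (x + d - x) ^ m) + df 3 t / fact 3 * (x + d - x) ^ 3"
      by (auto simp: df_def)
    then show ?thesis by (intro exI[of _ t]) (auto simp: df_def)
  qed
  then obtain t where t: "\<bar>t - x\<bar> \<le> \<bar>d\<bar>" and e: "f (x + d) = f x + f1 x * d + f2 x * d ^ 2 / 2 + f3 t / 6 * d ^ 3"
    unfolding * by (auto simp: fact_numeral)
  have "f (x + d) - f x - f1 x * d - f2 x * d ^ 2 / 2 - f3 x * d ^ 3 / 6 = (f3 t - f3 x) * (d ^ 3 / 6)"
    unfolding e by (simp add: field_simps)
  from arg_cong[OF this, of abs]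
  have "\<bar>f (x + d) - f x - f1 x * d - f2 x * d ^ 2 / 2 - f3 x * d ^ 3 / 6\<bar> = \<bar>f3 t - f3 x\<bar> * (\<bar>d\<bar> ^ 3 / 6)"
    by (simp only: abs_mult abs_divide power_abs abs_numeral)
  also have "\<dots> \<le> (B * \<bar>d\<bar>) * (\<bar>d\<bar> ^ 3 / 6)"
  proof (rule mult_right_mono)
    have "\<bar>f3 t - f3 x\<bar> \<le> B * \<bar>t - x\<bar>" by (rule lipschitz_abs_le[OF L])
    also have "\<dots> \<le> B * \<bar>d\<bar>" using t lipschitz_on_nonneg[OF L] by (rule mult_left_mono)
    finally show "\<bar>f3 t - f3 x\<bar> \<le> B * \<bar>d\<bar>" .
  qed simp
  also have "\<dots> = B * d ^ 4 / 6"
    by (simp add: power_abs eval_nat_numeral abs_mult)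
  finally show ?thesis .
qed simp

text \<open>Convolution with the normal law of variance t, that is, the heat semigroup at time t/2.
  Scaling the argument and keeping the standard normal density makes t = 0 the identity and turns
  all differences into integrals against one density.\<close>

definition gauss_smooth :: "real \<Rightarrow> (real \<Rightarrow> real) \<Rightarrow> real \<Rightarrow> real" where
  "gauss_smooth t f x = (\<integral>z. std_normal_density z * f (x + sqrt t * z) \<partial>lborel)"

lemma integrable_std_normal_mult:
  assumes [measurable]: "g \<in> borel_measurable borel"
    and "\<And>z. \<bar>g z\<bar> \<le> A + B * \<bar>z\<bar> + C * \<bar>z\<bar> ^ 2"
  shows "integrable lborel (\<lambda>z. std_normal_density z * g z)"
proof (rule Bochner_Integration.integrable_bound)
  show "integrable lborel (\<lambda>z. A * (std_normal_density z * \<bar>z\<bar> ^ 0) + B * (std_normal_density z * \<bar>z\<bar> ^ 1)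
      + C * (std_normal_density z * \<bar>z\<bar> ^ 2))"
    by (intro Bochner_Integration.integrable_add integrable_mult_right integrable_std_normal_moment_abs)
  show "AE z in lborel. norm (std_normal_density z * g z) \<le>
    norm (A * (std_normal_density z * \<bar>z\<bar> ^ 0) + B * (std_normal_density z * \<bar>z\<bar> ^ 1) + C * (std_normal_density z * \<bar>z\<bar> ^ 2))"
  proof (intro AE_I2)
    fix z
    have "norm (std_normal_density z * g z) \<le> std_normal_density z * (A + B * \<bar>z\<bar> + C * \<bar>z\<bar> ^ 2)"
      using assms(2)[of z] by (auto simp: abs_mult intro!: mult_left_mono)
    also have "\<dots> = A * (std_normal_density z * \<bar>z\<bar> ^ 0) + B * (std_normal_density z * \<bar>z\<bar> ^ 1) + C * (std_normal_density z * \<bar>z\<bar> ^ 2)"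
      by (simp add: algebra_simps)
    finally show "norm (std_normal_density z * g z) \<le>
      norm (A * (std_normal_density z * \<bar>z\<bar> ^ 0) + B * (std_normal_density z * \<bar>z\<bar> ^ 1) + C * (std_normal_density z * \<bar>z\<bar> ^ 2))"
      by (metis abs_ge_self order_trans real_norm_def)
  qed
qed simp

lemma lipschitz_affine_bound:
  fixes f :: "real \<Rightarrow> real"
  assumes "L-lipschitz_on UNIV f"
  shows "\<bar>f (x + c * z)\<bar> \<le> \<bar>f x\<bar> + L * \<bar>c\<bar> * \<bar>z\<bar>"
  using lipschitz_abs_le[OF assms, of "x + c * z" x] by (simp add: abs_mult mult.assoc)

lemma integrable_std_normal_lipschitz:
  assumes L: "L-lipschitz_on UNIV f"
  shows "integrable lborel (\<lambda>z. std_normal_density z * f (x + c * z))"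
    and "integrable lborel (\<lambda>z. std_normal_density z * (z * f (x + c * z)))"
proof -
  note [measurable] = lipschitz_borel[OF L]
  show "integrable lborel (\<lambda>z. std_normal_density z * f (x + c * z))"
    by (rule integrable_std_normal_mult[of _ "\<bar>f x\<bar>" "L * \<bar>c\<bar>" 0]) (use lipschitz_affine_bound[OF L] in auto)
  have "\<bar>z * f (x + c * z)\<bar> \<le> 0 + \<bar>f x\<bar> * \<bar>z\<bar> + (L * \<bar>c\<bar>) * \<bar>z\<bar> ^ 2" for z
    using mult_left_mono[OF lipschitz_affine_bound[OF L, of x c z], of "\<bar>z\<bar>"]
    by (simp add: abs_mult algebra_simps power2_eq_square)
  from integrable_std_normal_mult[OF _ this] show "integrable lborel (\<lambda>z. std_normal_density z * (z * f (x + c * z)))"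
    by simp
qed

lemma std_normal_mult_abs_le:
  "\<bar>a\<bar> \<le> b \<Longrightarrow> \<bar>std_normal_density z * a\<bar> \<le> std_normal_density z * b"
  by (simp add: abs_mult mult_left_mono)

lemma std_normal_integral_abs_le_1: "(\<integral>z. std_normal_density z * \<bar>z\<bar> \<partial>lborel) \<le> 1"
proof -
  have "(\<integral>z. std_normal_density z * \<bar>z\<bar> \<partial>lborel) = sqrt (2 / pi)"
    using integral_std_normal_moment_abs_odd[of 0] by simp
  also have "\<dots> \<le> 1" using pi_gt3 by simp
  finally show ?thesis .
qed

lemma gauss_smooth_lipschitz:
  assumes L: "L-lipschitz_on UNIV f"
  shows "L-lipschitz_on UNIV (gauss_smooth t f)"
proof (rule lipschitzI_abs)
  show "0 \<le> L" by (rule lipschitz_on_nonneg[OF L])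
  fix x y
  note i = integrable_std_normal_lipschitz(1)[OF L]
  have "\<bar>gauss_smooth t f y - gauss_smooth t f x\<bar>
    = \<bar>\<integral>z. std_normal_density z * f (y + sqrt t * z) - std_normal_density z * f (x + sqrt t * z) \<partial>lborel\<bar>"
    unfolding gauss_smooth_def by (simp add: i)
  also have "\<dots> \<le> (\<integral>z. std_normal_density z * (L * \<bar>y - x\<bar>) \<partial>lborel)"
  proof (rule integral_abs_bound_integral)
    fix z
    have "\<bar>f (y + sqrt t * z) - f (x + sqrt t * z)\<bar> \<le> L * \<bar>y - x\<bar>"
      using lipschitz_abs_le[OF L, of "y + sqrt t * z" "x + sqrt t * z"] by simp
    then show "\<bar>std_normal_density z * f (y + sqrt t * z) - std_normal_density z * f (x + sqrt t * z)\<bar>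
      \<le> std_normal_density z * (L * \<bar>y - x\<bar>)"
      by (simp flip: right_diff_distrib add: abs_mult mult_left_mono)
  qed (auto intro!: i)
  finally show "\<bar>gauss_smooth t f y - gauss_smooth t f x\<bar> \<le> L * \<bar>y - x\<bar>" by simp
qed

lemma gauss_smooth_dist:
  assumes L: "L-lipschitz_on UNIV f" and "t \<ge> 0"
  shows "\<bar>gauss_smooth t f x - f x\<bar> \<le> L * sqrt t"
proof -
  note i = integrable_std_normal_lipschitz(1)[OF L]
  have "\<bar>gauss_smooth t f x - f x\<bar> = \<bar>\<integral>z. std_normal_density z * f (x + sqrt t * z) - std_normal_density z * f x \<partial>lborel\<bar>"
    unfolding gauss_smooth_def by (simp add: i)
  also have "\<dots> \<le> (\<integral>z. (L * sqrt t) * (std_normal_density z * \<bar>z\<bar>) \<partial>lborel)"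
  proof (rule integral_abs_bound_integral)
    fix z
    have "\<bar>f (x + sqrt t * z) - f x\<bar> \<le> L * sqrt t * \<bar>z\<bar>"
      using lipschitz_abs_le[OF L, of "x + sqrt t * z" x] assms(2) by (simp add: abs_mult ac_simps)
    from std_normal_mult_abs_le[OF this, of z]
    show "\<bar>std_normal_density z * f (x + sqrt t * z) - std_normal_density z * f x\<bar> \<le> L * sqrt t * (std_normal_density z * \<bar>z\<bar>)"
      by (simp add: algebra_simps)
  qed (use integrable_std_normal_moment_abs[of 1] in \<open>auto intro!: i\<close>)
  also have "\<dots> \<le> (L * sqrt t) * 1"
    unfolding integral_mult_right_zero
    using std_normal_integral_abs_le_1 lipschitz_on_nonneg[OF L] assms(2) by (intro mult_left_mono) auto
  finally show ?thesis by simp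
qed

text \<open>The first-order remainder of \<open>f\<close> is at most K h^2 at every point, hence
  also after averaging. Such a quadratic bound identifies the derivative directly, in place of a
  theorem on differentiation under the integral.\<close>

lemma gauss_smooth_derivative_commute:
  assumes D: "\<And>x. (f has_real_derivative f' x) (at x)"
    and L: "L-lipschitz_on UNIV f" and L': "K-lipschitz_on UNIV f'"
  shows "(gauss_smooth t f has_real_derivative gauss_smooth t f' x) (at x)"
proof (rule has_real_derivative_quadratic_bound)
  fix h :: real
  note i = integrable_std_normal_lipschitz(1)[OF L] and i' = integrable_std_normal_lipschitz(1)[OF L']
  have "\<bar>gauss_smooth t f (x + h) - gauss_smooth t f x - h * gauss_smooth t f' x\<bar>
     = \<bar>\<integral>z. std_normal_density z * f (x + h + sqrt t * z) - std_normal_density z * f (x + sqrt t * z)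
          - h * (std_normal_density z * f' (x + sqrt t * z)) \<partial>lborel\<bar>"
    unfolding gauss_smooth_def by (simp add: i i')
  also have "\<dots> \<le> (\<integral>z. std_normal_density z * (K * h\<^sup>2) \<partial>lborel)"
  proof (rule integral_abs_bound_integral)
    fix z
    have "\<bar>f (x + h + sqrt t * z) - f (x + sqrt t * z) - h * f' (x + sqrt t * z)\<bar> \<le> K * h\<^sup>2"
      using first_order_expansion[OF D L', of "x + h + sqrt t * z" "x + sqrt t * z"] by (simp add: ac_simps)
    from std_normal_mult_abs_le[OF this, of z]
    show "\<bar>std_normal_density z * f (x + h + sqrt t * z) - std_normal_density z * f (x + sqrt t * z)
          - h * (std_normal_density z * f' (x + sqrt t * z))\<bar> \<le> std_normal_density z * (K * h\<^sup>2)"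
      by (simp add: algebra_simps)
  qed (auto intro!: i i')
  finally show "\<bar>gauss_smooth t f (x + h) - gauss_smooth t f x - h * gauss_smooth t f' x\<bar> \<le> K * h\<^sup>2" by simp
qed

text \<open>Under the average the odd powers of z drop out, z^2 contributes the term in
  \<open>f2\<close>, and the fourth moment 3 turns B/6 into B/2. This is the Gaussian half of the
  exchange of an increment; unlike the Poisson half it has no third-order term.\<close>

lemma gauss_smooth_heat:
  assumes D1: "\<And>x. (f has_real_derivative f1 x) (at x)"
    and D2: "\<And>x. (f1 has_real_derivative f2 x) (at x)"
    and D3: "\<And>x. (f2 has_real_derivative f3 x) (at x)"
    and L: "L-lipschitz_on UNIV f" and L3: "B-lipschitz_on UNIV f3" and "t \<ge> 0"
  shows "\<bar>gauss_smooth t f x - f x - t / 2 * f2 x\<bar> \<le> B * t\<^sup>2 / 2"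
proof -
  note i = integrable_std_normal_lipschitz(1)[OF L]
  note m = integrable_std_normal_moment
  have I2: "(\<integral>z. std_normal_density z * z ^ 2 \<partial>lborel) = 1"
    using integral_std_normal_moment_even[of 1] by (simp add: eval_nat_numeral)
  have I3: "(\<integral>z. std_normal_density z * z ^ 3 \<partial>lborel) = 0"
    using integral_std_normal_moment_odd[of 1] by (simp add: eval_nat_numeral)
  have I1: "(\<integral>z. std_normal_density z * z \<partial>lborel) = 0"
    using integral_std_normal_moment_odd[of 0] by simp
  have I4: "(\<integral>z. std_normal_density z * z ^ 4 \<partial>lborel) = 3"
    using integral_std_normal_moment_even[of 2] by (simp add: fact_numeral)
  have m1: "integrable lborel (\<lambda>z. std_normal_density z * z)" using m[of 1] by simp
  let ?s = "sqrt t"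
  have "\<bar>gauss_smooth t f x - f x - f2 x * t / 2\<bar> =
     \<bar>\<integral>z. std_normal_density z * f (x + ?s * z) - std_normal_density z * f x - (f1 x * ?s) * (std_normal_density z * z)
        - (f2 x * ?s ^ 2 / 2) * (std_normal_density z * z ^ 2) - (f3 x * ?s ^ 3 / 6) * (std_normal_density z * z ^ 3) \<partial>lborel\<bar>"
    unfolding gauss_smooth_def using \<open>t \<ge> 0\<close> by (simp add: i m m1 I1 I2 I3)
  also have "\<dots> \<le> (\<integral>z. (B * ?s ^ 4 / 6) * (std_normal_density z * z ^ 4) \<partial>lborel)"
  proof (rule integral_abs_bound_integral)
    fix z
    from std_normal_mult_abs_le[OF third_order_expansion[OF D1 D2 D3 L3, of x "?s * z"], of z]
    show "\<bar>std_normal_density z * f (x + ?s * z) - std_normal_density z * f x - (f1 x * ?s) * (std_normal_density z * z)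
        - (f2 x * ?s ^ 2 / 2) * (std_normal_density z * z ^ 2) - (f3 x * ?s ^ 3 / 6) * (std_normal_density z * z ^ 3)\<bar>
        \<le> (B * ?s ^ 4 / 6) * (std_normal_density z * z ^ 4)"
      by (simp add: algebra_simps power_mult_distrib)
  qed (intro Bochner_Integration.integrable_diff integrable_mult_right i m m1 integrable_normal_density integrable_mult_left, simp, intro integrable_mult_right m)
  also have "\<dots> = B * t\<^sup>2 / 2"
  proof -
    have "sqrt t ^ 4 = (sqrt t ^ 2) ^ 2" by (simp flip: power_mult)
    then show ?thesis using I4 \<open>t \<ge> 0\<close> by simp
  qed
  finally show ?thesis by (simp add: mult.commute)
qed

text \<open>The Taylor remainder in h must be integrable against functions of linear growth. The
  second derivative of the density sits at an unknown point within distance 1 of w; it is dominated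
  by a multiple of the wider normal density with standard deviation 2.\<close>

lemma normal_shift_expansion:
  assumes "\<bar>h\<bar> \<le> 1"
  shows "\<bar>std_normal_density (w - h) - std_normal_density w - h * (w * std_normal_density w)\<bar>
    \<le> 16 * normal_density 0 2 w * h\<^sup>2"
proof (cases "h = 0")
  case False
  let ?p = "std_normal_density"
  have D1: "(?p has_real_derivative - (x * ?p x)) (at x)" for x
  proof -
    have "((\<lambda>x. c * exp (- x\<^sup>2 / 2)) has_real_derivative - (x * (c * exp (- x\<^sup>2 / 2)))) (at x)" for c :: real
      by (auto intro!: derivative_eq_intros)
    from this[of "1 / sqrt (2 * pi)"] show ?thesis unfolding std_normal_density_def .
  qed
  have D2: "((\<lambda>x. - (x * ?p x)) has_real_derivative (x\<^sup>2 - 1) * ?p x) (at x)" for x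
    by (auto intro!: derivative_eq_intros D1 simp: algebra_simps power2_eq_square)
  define df where "df = (\<lambda>m::nat. if m = 0 then ?p else if m = 1 then (\<lambda>x. - (x * ?p x)) else (\<lambda>x. (x\<^sup>2 - 1) * ?p x))"
  have DD: "DERIV (df m) t :> df (Suc m) t" if "m < 2" for m t
    using that D1 D2 by (cases m) (auto simp: df_def)
  have *: "(\<Sum>m<2. df m w / fact m * d ^ m) = ?p w - w * ?p w * d" for d
    by (simp add: numeral_2_eq_2 df_def)
  have "\<exists>t. \<bar>t - w\<bar> \<le> \<bar>h\<bar> \<and> ?p (w - h) = (\<Sum>m<2. df m w / fact m * (- h) ^ m) + df 2 t / fact 2 * (- h) ^ 2"
  proof (cases "h < 0")
    case True
    from Taylor_up[of 2 df ?p w "w - h" w] DD True obtain t where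
      "w < t" "t < w - h" "?p (w - h) = (\<Sum>m<2. df m w / fact m * (w - h - w) ^ m) + df 2 t / fact 2 * (w - h - w) ^ 2"
      by (auto simp: df_def)
    then show ?thesis by (intro exI[of _ t]) (auto simp: df_def)
  next
    case F: False
    with False have "h > 0" by simp
    with Taylor_down[of 2 df ?p "w - h" w w] DD obtain t where
      "w - h < t" "t < w" "?p (w - h) = (\<Sum>m<2. df m w / fact m * (w - h - w) ^ m) + df 2 t / fact 2 * (w - h - w) ^ 2"
      by (auto simp: df_def)
    then show ?thesis by (intro exI[of _ t]) (auto simp: df_def)
  qed
  then obtain t where t: "\<bar>t - w\<bar> \<le> \<bar>h\<bar>" and e: "?p (w - h) = ?p w + w * ?p w * h + (t\<^sup>2 - 1) * ?p t / 2 * h ^ 2"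
    unfolding * by (auto simp: df_def)
  \<comment> \<open>This is w^2 <= 2 t^2 + 2 (t - w)^2 with |t - w| <= 1; it converts decay in t
    into decay in w.\<close>
  have t1: "w\<^sup>2 / 2 - 1 \<le> t\<^sup>2"
  proof -
    have "(t - w)\<^sup>2 \<le> 1\<^sup>2" using t assms by (intro power2_le_iff_abs_le[THEN iffD2]) auto
    moreover have "0 \<le> (2 * t - w)\<^sup>2" by simp
    ultimately show ?thesis by (simp add: power2_eq_square algebra_simps)
  qed
  \<comment> \<open>The polynomial factor is absorbed by half of the exponent. What remains,
    exp(-t^2/4), becomes exp(-w^2/8) up to the factor exp(1/4), and that is the shape of a normal
    density of standard deviation 2.\<close>
  have "\<bar>t\<^sup>2 - 1\<bar> \<le> 4 * exp (t\<^sup>2 / 4)"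
    using exp_ge_add_one_self[of "t\<^sup>2 / 4"] zero_le_power2[of t] by linarith
  then have "\<bar>t\<^sup>2 - 1\<bar> * ?p t \<le> 4 * exp (t\<^sup>2 / 4) * ?p t"
    by (intro mult_right_mono) auto
  also have "\<dots> = 4 / sqrt (2 * pi) * exp (- t\<^sup>2 / 4)"
    by (simp add: std_normal_density_def flip: exp_add)
  also have "\<dots> \<le> 4 / sqrt (2 * pi) * exp (1 / 4 + - w\<^sup>2 / 8)"
    using t1 by (intro mult_left_mono) auto
  also have "\<dots> = 4 * exp (1 / 4) * 2 * normal_density 0 2 w"
  proof -
    have "sqrt 8 = 2 * sqrt 2" using real_sqrt_mult[of 4 2] by simp
    then show ?thesis unfolding exp_add normal_density_def by (simp add: real_sqrt_mult)
  qed
  also have "\<dots> \<le> 4 * 4 * 2 * normal_density 0 2 w"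
  proof -
    have "exp (1 / 4 :: real) \<le> 1 / (1 - 1/4)"
      using exp_ge_add_one_self[of "- 1 / 4 :: real"] by (simp add: exp_minus field_simps)
    then have "exp (1 / 4 :: real) \<le> 4" by simp
    then show ?thesis by (intro mult_right_mono mult_left_mono) auto
  qed
  finally have *: "\<bar>t\<^sup>2 - 1\<bar> * ?p t \<le> 32 * normal_density 0 2 w" by simp
  have "\<bar>?p (w - h) - ?p w - h * (w * ?p w)\<bar> = \<bar>t\<^sup>2 - 1\<bar> * ?p t / 2 * h\<^sup>2"
    unfolding e by (simp add: abs_mult)
  also have "\<dots> \<le> 32 * normal_density 0 2 w / 2 * h\<^sup>2"
    by (intro mult_right_mono divide_right_mono *) auto
  finally show ?thesis by simp
qed simp

text \<open>The shift is moved from the argument of \<open>f\<close> to the density, which is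
  smooth, so a Lipschitz \<open>f\<close> suffices. The derivative E[Z f(x + Z)] is the one that
  Gaussian integration by parts predicts.\<close>

lemma gauss_smooth_1_derivative:
  assumes L: "L-lipschitz_on UNIV f"
  shows "((\<lambda>x. \<integral>z. std_normal_density z * f (x + z) \<partial>lborel) has_real_derivative
          (\<integral>z. std_normal_density z * (z * f (x + z)) \<partial>lborel)) (at x)"
proof (rule has_real_derivative_quadratic_bound)
  fix h :: real assume h: "\<bar>h\<bar> \<le> 1"
  note [measurable] = lipschitz_borel[OF L]
  let ?p = "std_normal_density" and ?q = "normal_density 0 2"
  have i: "integrable lborel (\<lambda>z. ?p z * f (y + z))" and i': "integrable lborel (\<lambda>z. ?p z * (z * f (y + z)))" for y
    using integrable_std_normal_lipschitz[OF L, of y 1] by simp_all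
  have shift: "(\<integral>z. ?p z * f (x + h + z) \<partial>lborel) = (\<integral>z. ?p (z - h) * f (x + z) \<partial>lborel)"
    by (subst lborel_integral_real_affine[where c = 1 and t = "- h"]) (simp_all add: ac_simps)
  have i2: "integrable lborel (\<lambda>z. ?p (z - h) * f (x + z))"
    using lborel_integrable_real_affine[OF i[of "x + h"], of 1 "- h"] by (simp add: ac_simps)
  have q: "integrable lborel (\<lambda>w. ?q w * (\<bar>f x\<bar> + L * \<bar>w\<bar>))"
  proof -
    have "integrable lborel (\<lambda>w. ?q w * \<bar>f x\<bar> + L * (?q w * \<bar>w\<bar>))"
      using integrable_normal_moment_abs[of 2 0 1] by (intro Bochner_Integration.integrable_add) auto
    then show ?thesis by (simp add: algebra_simps)
  qed
  have "\<bar>(\<integral>z. ?p z * f (x + h + z) \<partial>lborel) - (\<integral>z. ?p z * f (x + z) \<partial>lborel) - h * (\<integral>z. ?p z * (z * f (x + z)) \<partial>lborel)\<bar>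
    = \<bar>\<integral>z. ?p (z - h) * f (x + z) - ?p z * f (x + z) - h * (?p z * (z * f (x + z))) \<partial>lborel\<bar>"
    unfolding shift using i i2 i' by simp
  also have "\<dots> \<le> (\<integral>w. (16 * h\<^sup>2) * (?q w * (\<bar>f x\<bar> + L * \<bar>w\<bar>)) \<partial>lborel)"
  proof (rule integral_abs_bound_integral)
    fix z
    have "?p (z - h) * f (x + z) - ?p z * f (x + z) - h * (?p z * (z * f (x + z)))
      = (?p (z - h) - ?p z - h * (z * ?p z)) * f (x + z)"
      by (simp add: algebra_simps)
    then have "\<bar>?p (z - h) * f (x + z) - ?p z * f (x + z) - h * (?p z * (z * f (x + z)))\<bar>
      = \<bar>?p (z - h) - ?p z - h * (z * ?p z)\<bar> * \<bar>f (x + z)\<bar>"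
      by (simp add: abs_mult)
    also have "\<dots> \<le> (16 * ?q z * h\<^sup>2) * (\<bar>f x\<bar> + L * \<bar>z\<bar>)"
      using lipschitz_affine_bound[OF L, of x 1 z] by (intro mult_mono normal_shift_expansion h) auto
    finally show "\<bar>?p (z - h) * f (x + z) - ?p z * f (x + z) - h * (?p z * (z * f (x + z)))\<bar>
      \<le> (16 * h\<^sup>2) * (?q z * (\<bar>f x\<bar> + L * \<bar>z\<bar>))" by (simp add: ac_simps)
  qed (use i i2 i' q in auto)
  also have "\<dots> = (16 * (\<integral>w. ?q w * (\<bar>f x\<bar> + L * \<bar>w\<bar>) \<partial>lborel)) * h\<^sup>2"
    unfolding integral_mult_right_zero by simp
  finally show "\<bar>(\<integral>z. ?p z * f (x + h + z) \<partial>lborel) - (\<integral>z. ?p z * f (x + z) \<partial>lborel) - h * (\<integral>z. ?p z * (z * f (x + z)) \<partial>lborel)\<bar>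
    \<le> (16 * (\<integral>w. ?q w * (\<bar>f x\<bar> + L * \<bar>w\<bar>) \<partial>lborel)) * h\<^sup>2" .
qed

text \<open>One smoothing buys one derivative for a factor \<open>1 / sqrt t\<close>. Rescaling by s
  = sqrt t reduces this to variance 1: \<open>k\<close> has Lipschitz constant L s, so has the
  derivative \<open>d\<close> because E|Z| <= 1, and undoing the rescaling divides by s
  twice.\<close>

lemma gauss_smooth_smoothing:
  assumes L: "L-lipschitz_on UNIV f" and t: "t > 0"
  obtains g where "\<And>x. (gauss_smooth t f has_real_derivative g x) (at x)"
    "(L / sqrt t)-lipschitz_on UNIV g"
proof -
  let ?p = "std_normal_density"
  have L0: "0 \<le> L" by (rule lipschitz_on_nonneg[OF L])
  define s where "s = sqrt t"
  have s: "s > 0" using t by (simp add: s_def)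
  define k where "k = (\<lambda>y. f (s * y))"
  have k: "(L * s)-lipschitz_on UNIV k"
    using lipschitz_abs_le[OF L] L0 s
    by (intro lipschitzI_abs) (auto simp: k_def mult.assoc simp flip: right_diff_distrib abs_mult
        intro!: order_trans[OF lipschitz_abs_le[OF L]] simp: abs_mult)
  define d where "d = (\<lambda>x. \<integral>z. ?p z * (z * k (x + z)) \<partial>lborel)"
  have dk: "(L * s)-lipschitz_on UNIV d"
  proof (rule lipschitzI_abs)
    show "0 \<le> L * s" using L0 s by simp
    fix x y
    have i': "integrable lborel (\<lambda>z. ?p z * (z * k (y + z)))" for y
      using integrable_std_normal_lipschitz[OF k, of y 1] by simp
    have "\<bar>d y - d x\<bar> = \<bar>\<integral>z. ?p z * (z * k (y + z)) - ?p z * (z * k (x + z)) \<partial>lborel\<bar>"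
      unfolding d_def by (simp add: i')
    also have "\<dots> \<le> (\<integral>z. (L * s * \<bar>y - x\<bar>) * (?p z * \<bar>z\<bar>) \<partial>lborel)"
    proof (rule integral_abs_bound_integral)
      fix z
      have "\<bar>z * (k (y + z) - k (x + z))\<bar> \<le> \<bar>z\<bar> * (L * s * \<bar>y - x\<bar>)"
        unfolding abs_mult using lipschitz_abs_le[OF k, of "y + z" "x + z"] by (intro mult_left_mono) auto
      from std_normal_mult_abs_le[OF this, of z]
      show "\<bar>?p z * (z * k (y + z)) - ?p z * (z * k (x + z))\<bar> \<le> (L * s * \<bar>y - x\<bar>) * (?p z * \<bar>z\<bar>)"
        by (simp add: algebra_simps)
    qed (use i' integrable_std_normal_moment_abs[of 1] in auto)
    also have "\<dots> \<le> (L * s * \<bar>y - x\<bar>) * 1"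
      unfolding integral_mult_right_zero using std_normal_integral_abs_le_1 L0 s by (intro mult_left_mono) auto
    finally show "\<bar>d y - d x\<bar> \<le> L * s * \<bar>y - x\<bar>" by simp
  qed
  have eq: "gauss_smooth t f x = (\<integral>z. ?p z * k (x / s + z) \<partial>lborel)" for x
    unfolding gauss_smooth_def k_def s_def[symmetric] using s by (simp add: distrib_left mult.commute)
  show ?thesis
  proof
    fix x
    have "((\<lambda>x. \<integral>z. ?p z * k (x / s + z) \<partial>lborel) has_real_derivative d (x / s) * (1 / s)) (at x)"
      by (rule DERIV_chain2[where f = "\<lambda>x. \<integral>z. ?p z * k (x + z) \<partial>lborel" and g = "\<lambda>x. x / s"])
         (use s gauss_smooth_1_derivative[OF k] in \<open>auto simp: d_def intro!: derivative_eq_intros\<close>)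
    then show "(gauss_smooth t f has_real_derivative d (x / s) / s) (at x)"
      by (simp add: eq[abs_def])
  next
    show "(L / sqrt t)-lipschitz_on UNIV (\<lambda>x. d (x / s) / s)"
    proof (rule lipschitzI_abs)
      show "0 \<le> L / sqrt t" using L0 t by simp
      fix x y
      have "\<bar>d (y / s) / s - d (x / s) / s\<bar> = \<bar>d (y / s) - d (x / s)\<bar> / s"
        using s by (simp flip: diff_divide_distrib)
      also have "\<dots> \<le> (L * s * \<bar>y / s - x / s\<bar>) / s"
        using s by (intro divide_right_mono lipschitz_abs_le[OF dk]) auto
      also have "\<dots> = L / s * \<bar>y - x\<bar>"
        using s by (simp flip: diff_divide_distrib)
      finally show "\<bar>d (y / s) / s - d (x / s) / s\<bar> \<le> L / sqrt t * \<bar>y - x\<bar>" by (simp add: s_def)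
    qed
  qed
qed

lemma gauss_smooth_normal:
  assumes [measurable]: "f \<in> borel_measurable borel" and t: "t > 0"
  shows "gauss_smooth t f x = (\<integral>y. f (x + y) \<partial>density lborel (normal_density 0 (sqrt t)))"
proof -
  have "(\<integral>y. f (x + y) \<partial>density lborel (normal_density 0 (sqrt t)))
      = (\<integral>y. normal_density 0 (sqrt t) y * f (x + y) \<partial>lborel)"
    by (subst integral_density) auto
  also have "\<dots> = \<bar>sqrt t\<bar> *\<^sub>R (\<integral>z. normal_density 0 (sqrt t) (0 + sqrt t * z) * f (x + (0 + sqrt t * z)) \<partial>lborel)"
    using t by (intro lborel_integral_real_affine) auto
  also have "\<dots> = (\<integral>z. sqrt t * (normal_density 0 (sqrt t) (sqrt t * z) * f (x + sqrt t * z)) \<partial>lborel)"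
    using t by simp
  also have "\<dots> = gauss_smooth t f x"
    unfolding gauss_smooth_def
  proof (intro Bochner_Integration.integral_cong refl)
    fix z
    have "sqrt t * normal_density 0 (sqrt t) (sqrt t * z) = std_normal_density z"
      using t by (simp add: normal_density_def power_mult_distrib real_sqrt_mult field_simps)
    then show "sqrt t * (normal_density 0 (sqrt t) (sqrt t * z) * f (x + sqrt t * z)) = std_normal_density z * f (x + sqrt t * z)"
      by simp
  qed
  finally show ?thesis by simp
qed

lemma gauss_smooth_0 [simp]: "gauss_smooth 0 f = f"
  by (rule ext) (simp add: gauss_smooth_def)

lemma integrable_normal_lipschitz:
  fixes f :: "real \<Rightarrow> real"
  assumes L: "L-lipschitz_on UNIV f" and t: "\<sigma> > 0"
  shows "integrable (density lborel (normal_density 0 \<sigma>)) (\<lambda>y. f (x + c * y))"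
proof -
  note [measurable] = lipschitz_borel[OF L]
  have "integrable lborel (\<lambda>y. normal_density 0 \<sigma> y * f (x + c * y))"
  proof (rule Bochner_Integration.integrable_bound)
    have "integrable lborel (\<lambda>w. normal_density 0 \<sigma> w * \<bar>f x\<bar> + (L * \<bar>c\<bar>) * (normal_density 0 \<sigma> w * \<bar>w\<bar>))"
      using integrable_normal_moment_abs[of \<sigma> 0 1] t by (intro Bochner_Integration.integrable_add) auto
    then show "integrable lborel (\<lambda>w. normal_density 0 \<sigma> w * (\<bar>f x\<bar> + L * \<bar>c\<bar> * \<bar>w\<bar>))" by (simp add: algebra_simps)
    show "AE y in lborel. norm (normal_density 0 \<sigma> y * f (x + c * y)) \<le> norm (normal_density 0 \<sigma> y * (\<bar>f x\<bar> + L * \<bar>c\<bar> * \<bar>y\<bar>))"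
      using lipschitz_affine_bound[OF L, of x c] by (auto simp: abs_mult intro!: mult_left_mono order_trans[OF _ abs_ge_self])
  qed simp
  then show ?thesis by (subst integrable_density) auto
qed

text \<open>Centred normal laws convolve by adding variances, and Fubini turns the integral over the
  convolution into an iterated smoothing. Linear growth of \<open>f\<close> and finite first
  absolute moments supply the integrability for Fubini.\<close>

lemma gauss_smooth_semigroup:
  assumes L: "L-lipschitz_on UNIV f" and s: "s \<ge> 0" and t: "t \<ge> 0"
  shows "gauss_smooth s (gauss_smooth t f) = gauss_smooth (s + t) f"
proof (cases "s = 0 \<or> t = 0")
  case False
  with s t have s: "s > 0" and t: "t > 0" by auto
  note [measurable] = lipschitz_borel[OF L] lipschitz_borel[OF gauss_smooth_lipschitz[OF L]]
  let ?N = "\<lambda>s. density lborel (normal_density 0 (sqrt s))"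
  interpret S: prob_space "?N s" using s by (intro prob_space_normal_density) simp
  interpret T: prob_space "?N t" using t by (intro prob_space_normal_density) simp
  interpret P: pair_prob_space "?N s" "?N t" ..
  have conv: "?N (s + t) = convolution (?N s) (?N t)"
    using convolution_density[of "\<lambda>x. ennreal (normal_density 0 (sqrt s) x)" "\<lambda>x. ennreal (normal_density 0 (sqrt t) x)"]
      S.finite_measure_axioms T.finite_measure_axioms conv_normal_density_zero_mean[of "sqrt s" "sqrt t"] s t
    by (simp add: ennreal_mult)
  show ?thesis
  proof
    fix x
    have int: "integrable (?N s \<Otimes>\<^sub>M ?N t) (\<lambda>(y, z). f (x + (y + z)))"
    proof (rule Bochner_Integration.integrable_bound)
      have "integrable (?N s) (\<lambda>y. \<bar>0 + 1 * y\<bar>)" if "s > 0" for s :: real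
        using that by (intro integrable_normal_lipschitz[where L = 1] lipschitzI_abs) auto
      then have a: "integrable (?N s) (\<lambda>y. \<bar>y\<bar>)" "integrable (?N t) (\<lambda>y. \<bar>y\<bar>)" using s t by auto
      have "integrable (?N s \<Otimes>\<^sub>M ?N t) (\<lambda>p. \<bar>fst p\<bar>)" "integrable (?N s \<Otimes>\<^sub>M ?N t) (\<lambda>p. \<bar>snd p\<bar>)"
        using a by (auto intro!: P.Fubini_integrable)
      then show "integrable (?N s \<Otimes>\<^sub>M ?N t) (\<lambda>p. \<bar>f x\<bar> + L * (\<bar>fst p\<bar> + \<bar>snd p\<bar>))"
        by auto
      show "AE p in ?N s \<Otimes>\<^sub>M ?N t. norm (case p of (y, z) \<Rightarrow> f (x + (y + z))) \<le> norm (\<bar>f x\<bar> + L * (\<bar>fst p\<bar> + \<bar>snd p\<bar>))"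
      proof (intro AE_I2, clarify)
        fix y z
        have "\<bar>f (x + (y + z))\<bar> \<le> \<bar>f x\<bar> + L * \<bar>y + z\<bar>"
          using lipschitz_affine_bound[OF L, of x 1 "y + z"] by simp
        also have "\<dots> \<le> \<bar>f x\<bar> + L * (\<bar>y\<bar> + \<bar>z\<bar>)"
          using lipschitz_on_nonneg[OF L] by (intro add_left_mono mult_left_mono) auto
        finally show "norm (f (x + (y + z))) \<le> norm (\<bar>f x\<bar> + L * (\<bar>fst (y, z)\<bar> + \<bar>snd (y, z)\<bar>))" by simp
      qed
    qed measurable
    have "gauss_smooth (s + t) f x = (\<integral>y. f (x + y) \<partial>(convolution (?N s) (?N t)))"
      using s t by (simp add: gauss_smooth_normal conv)
    also have "\<dots> = (\<integral>(y, z). f (x + (y + z)) \<partial>(?N s \<Otimes>\<^sub>M ?N t))"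
      unfolding convolution_def by (subst integral_distr) (auto simp: case_prod_unfold)
    also have "\<dots> = (\<integral>y. \<integral>z. f (x + (y + z)) \<partial>?N t \<partial>?N s)"
      using P.integral_fst[OF int] by simp
    also have "\<dots> = gauss_smooth s (gauss_smooth t f) x"
      using s t by (simp add: gauss_smooth_normal add.assoc)
    finally show "gauss_smooth s (gauss_smooth t f) x = gauss_smooth (s + t) f x" by simp
  qed
qed auto

text \<open>The variance is split into three equal parts. Each buys one derivative for a factor
  \<open>1 / sqrt (t / 3)\<close>, and the later smoothings commute with the derivatives already
  taken. The last constant is (t/3)^(-3/2) in disguise.\<close>

lemma gauss_smooth_three_derivatives:
  assumes L: "1-lipschitz_on UNIV f" and t: "t > 0"
  obtains f1 f2 f3 where
    "\<And>x. (gauss_smooth t f has_real_derivative f1 x) (at x)"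
    "\<And>x. (f1 has_real_derivative f2 x) (at x)"
    "\<And>x. (f2 has_real_derivative f3 x) (at x)"
    "\<And>x. \<bar>f1 x\<bar> \<le> 1" "\<And>x. \<bar>f2 x\<bar> \<le> 1 / sqrt (t / 3)" "\<And>x. \<bar>f3 x\<bar> \<le> 3 / t"
    "(3 / (t * sqrt (t / 3)))-lipschitz_on UNIV f3"
proof -
  define s where "s = t / 3"
  have s: "s > 0" using t by (simp add: s_def)
  let ?G = "gauss_smooth s"
  obtain a where a: "\<And>x. (?G f has_real_derivative a x) (at x)" "(1 / sqrt s)-lipschitz_on UNIV a"
    using gauss_smooth_smoothing[OF L s] by auto
  obtain b where b: "\<And>x. (?G a has_real_derivative b x) (at x)" "(1 / sqrt s / sqrt s)-lipschitz_on UNIV b"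
    using gauss_smooth_smoothing[OF a(2) s] by auto
  obtain c where c: "\<And>x. (?G b has_real_derivative c x) (at x)" "(1 / sqrt s / sqrt s / sqrt s)-lipschitz_on UNIV c"
    using gauss_smooth_smoothing[OF b(2) s] by auto
  note Lip = gauss_smooth_lipschitz
  have G: "gauss_smooth t f = ?G (?G (?G f))"
    using s by (simp add: gauss_smooth_semigroup[OF L] gauss_smooth_semigroup[OF Lip[OF L]] s_def)
  have d1: "(?G (?G (?G f)) has_real_derivative ?G (?G a) x) (at x)" for x
    by (rule gauss_smooth_derivative_commute[OF gauss_smooth_derivative_commute[OF a(1) Lip[OF L] a(2)] Lip[OF Lip[OF L]] Lip[OF a(2)]])
  have d2: "(?G (?G a) has_real_derivative ?G b x) (at x)" for x
    by (rule gauss_smooth_derivative_commute[OF b(1) Lip[OF a(2)] b(2)])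
  have e: "sqrt s * sqrt s = s" using s by simp
  show ?thesis
  proof (rule that[of "?G (?G a)" "?G b" c])
    show "(gauss_smooth t f has_real_derivative ?G (?G a) x) (at x)" for x using d1 by (simp add: G)
    show "(?G (?G a) has_real_derivative ?G b x) (at x)" for x by (rule d2)
    show "(?G b has_real_derivative c x) (at x)" for x by (rule c(1))
    show "\<bar>?G (?G a) x\<bar> \<le> 1" for x
      by (rule lipschitz_derivative_bound[OF _ d1]) (intro Lip L)
    show "\<bar>?G b x\<bar> \<le> 1 / sqrt (t / 3)" for x
      unfolding s_def[symmetric] by (rule lipschitz_derivative_bound[OF _ d2]) (intro Lip a(2))
    have "\<bar>c x\<bar> \<le> 1 / sqrt s / sqrt s" for x
      by (rule lipschitz_derivative_bound[OF _ c(1)]) (intro Lip b(2))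
    then show "\<bar>c x\<bar> \<le> 3 / t" for x
      using e by (simp add: s_def)
    have "1 / sqrt s / sqrt s / sqrt s = 3 / (t * sqrt (t / 3))"
      using e t by (simp add: s_def)
    then show "(3 / (t * sqrt (t / 3)))-lipschitz_on UNIV c"
      using c(2) by simp
  qed
qed

text \<open>The smoothing commutes with the three derivatives, so by the semigroup property
  \<open>gauss_smooth s f3\<close> is a third derivative at the larger scale \<open>t + s\<close>.\<close>

lemma gauss_smooth_third_derivative_bound:
  assumes L: "1-lipschitz_on UNIV f" and t: "t > 0" and s: "s \<ge> 0"
    and D1: "\<And>x. (gauss_smooth t f has_real_derivative f1 x) (at x)"
    and D2: "\<And>x. (f1 has_real_derivative f2 x) (at x)"
    and D3: "\<And>x. (f2 has_real_derivative f3 x) (at x)"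
    and B2: "\<And>x. \<bar>f2 x\<bar> \<le> B2" and B3: "\<And>x. \<bar>f3 x\<bar> \<le> B3"
    and L3: "B4-lipschitz_on UNIV f3"
  shows "\<bar>gauss_smooth s f3 x\<bar> \<le> 3 / (t + s)"
proof -
  have L2: "B3-lipschitz_on UNIV f2" by (rule derivative_bound_lipschitz[OF D3 B3])
  have L1: "B2-lipschitz_on UNIV f1" by (rule derivative_bound_lipschitz[OF D2 B2])
  have ts: "t + s > 0" using t s by simp
  obtain g1 g2 g3 where g:
    "\<And>x. (gauss_smooth (t + s) f has_real_derivative g1 x) (at x)"
    "\<And>x. (g1 has_real_derivative g2 x) (at x)"
    "\<And>x. (g2 has_real_derivative g3 x) (at x)"
    "\<And>x. \<bar>g3 x\<bar> \<le> 3 / (t + s)"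
    using gauss_smooth_three_derivatives[OF L ts] by metis
  have sg: "gauss_smooth s (gauss_smooth t f) = gauss_smooth (t + s) f"
    using gauss_smooth_semigroup[OF L s, of t] t by (simp add: add.commute)
  \<comment> \<open>Both functions are derivatives of the same function, and derivatives are unique;
    the argument is repeated for the next two orders.\<close>
  have 1: "gauss_smooth s f1 = g1"
    using gauss_smooth_derivative_commute[OF D1 gauss_smooth_lipschitz[OF L] L1, of s] g(1)
    unfolding sg by (intro ext) (blast intro: DERIV_unique)
  have 2: "gauss_smooth s f2 = g2"
    using gauss_smooth_derivative_commute[OF D2 L1 L2, of s] g(2)
    unfolding 1 by (intro ext) (blast intro: DERIV_unique)
  have 3: "gauss_smooth s f3 = g3"
    using gauss_smooth_derivative_commute[OF D3 L2 L3, of s] g(3)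
    unfolding 2 by (intro ext) (blast intro: DERIV_unique)
  show ?thesis using g(4) by (simp add: 3)
qed

section \<open>Conditional moments of the process\<close>

text \<open>Poisson weights as explicit terms of a series: the summation identities then hold for
  every real r, and agreement with \<open>poisson_pmf\<close> is needed only at the positive values
  of \<open>rate\<close>.\<close>

definition pois :: "real \<Rightarrow> nat \<Rightarrow> real" where
  "pois r m = r ^ m / fact m * exp (- r)"

lemma pois_nonneg: "0 \<le> r \<Longrightarrow> 0 \<le> pois r m"
  by (simp add: pois_def)

lemma pois_sums: "pois r sums 1"
proof -
  have "(\<lambda>m. r ^ m / fact m) sums exp r"
    using exp_converges[of r] by (simp add: field_simps)
  from sums_mult2[OF this, of "exp (- r)"] show ?thesis
    by (simp add: pois_def[abs_def] flip: exp_add)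
qed

text \<open>The factor m cancels one factor of the factorial. This is the Chen-Stein identity
  E[N f(N)] = r E[f(N + 1)] for a Poisson variable N; each use raises the degree of a moment by
  one.\<close>

lemma pois_sums_shift:
  assumes "(\<lambda>m. f (Suc m) * pois r m) sums S"
  shows "(\<lambda>m. real m * f m * pois r m) sums (r * S)"
proof -
  have "real (Suc m) * f (Suc m) * pois r (Suc m) = r * (f (Suc m) * pois r m)" for m
    by (simp add: pois_def divide_simps del: of_nat_Suc)
  then have "(\<lambda>m. real (Suc m) * f (Suc m) * pois r (Suc m)) sums (r * S)"
    using sums_mult[OF assms, of r] by (simp only:)
  then show ?thesis by (subst (asm) sums_Suc_iff) simp
qed

lemma pois_moments:
  shows "(\<lambda>m. real m * pois r m) sums r"
    and "(\<lambda>m. real m ^ 2 * pois r m) sums (r ^ 2 + r)"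
    and "(\<lambda>m. real m ^ 3 * pois r m) sums (r ^ 3 + 3 * r ^ 2 + r)"
    and "(\<lambda>m. real m ^ 4 * pois r m) sums (r ^ 4 + 6 * r ^ 3 + 7 * r ^ 2 + r)"
proof -
  have 0: "(\<lambda>m. 1 * pois r m) sums 1" using pois_sums by simp
  show 1: "(\<lambda>m. real m * pois r m) sums r"
    using pois_sums_shift[of "\<lambda>_. 1" r 1] 0 by simp
  have "(\<lambda>m. real (Suc m) * pois r m) sums (r + 1)"
    using sums_add[OF 1 0] by (simp add: algebra_simps)
  from pois_sums_shift[of real, OF this] show 2: "(\<lambda>m. real m ^ 2 * pois r m) sums (r ^ 2 + r)"
    by (simp add: power2_eq_square algebra_simps)
  have "(\<lambda>m. real (Suc m) ^ 2 * pois r m) sums (r ^ 2 + r + 2 * r + 1)"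
    using sums_add[OF sums_add[OF 2 sums_mult[OF 1, of 2]] 0] by (simp add: power2_eq_square algebra_simps)
  from pois_sums_shift[of "\<lambda>m. real m ^ 2", OF this]
  show 3: "(\<lambda>m. real m ^ 3 * pois r m) sums (r ^ 3 + 3 * r ^ 2 + r)"
    by (simp add: power2_eq_square power3_eq_cube algebra_simps)
  have "(\<lambda>m. real (Suc m) ^ 3 * pois r m) sums ((r ^ 3 + 3 * r ^ 2 + r) + 3 * (r ^ 2 + r) + 3 * r + 1)"
    using sums_add[OF sums_add[OF sums_add[OF 3 sums_mult[OF 2, of 3]] sums_mult[OF 1, of 3]] 0]
    by (simp add: power2_eq_square power3_eq_cube algebra_simps)
  from pois_sums_shift[of "\<lambda>m. real m ^ 3", OF this]
  show "(\<lambda>m. real m ^ 4 * pois r m) sums (r ^ 4 + 6 * r ^ 3 + 7 * r ^ 2 + r)"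
    by (simp add: eval_nat_numeral algebra_simps)
qed

text \<open>The constant must not depend on r, since r will be the random rate. Induction through (1
  + m)^(d+1) = (1 + m)^d + m (1 + m)^d: the second summand is shifted by the Chen-Stein identity,
  and 2 + m <= 2 (1 + m) brings it back to degree d.\<close>

lemma pois_moment_bound:
  "\<exists>c\<ge>0. \<forall>r\<ge>0. \<exists>S. (\<lambda>m. (1 + real m) ^ d * pois r m) sums S \<and> S \<le> c * (1 + r) ^ d"
proof (induction d)
  case 0
  show ?case using pois_sums by (intro exI[of _ 1]) auto
next
  case (Suc d)
  then obtain c where c: "c \<ge> 0" "\<And>r. r \<ge> 0 \<Longrightarrow> \<exists>S. (\<lambda>m. (1 + real m) ^ d * pois r m) sums S \<and> S \<le> c * (1 + r) ^ d"
    by blast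
  show ?case
  proof (rule exI[of _ "2 ^ d * c"], intro conjI allI impI)
    fix r :: real assume r: "r \<ge> 0"
    obtain S where S: "(\<lambda>m. (1 + real m) ^ d * pois r m) sums S" "S \<le> c * (1 + r) ^ d"
      using c(2)[OF r] by blast
    have le: "(1 + real (Suc m)) ^ d * pois r m \<le> 2 ^ d * ((1 + real m) ^ d * pois r m)" for m
    proof -
      have "(1 + real (Suc m)) ^ d \<le> (2 * (1 + real m)) ^ d" by (intro power_mono) auto
      then have "(1 + real (Suc m)) ^ d * pois r m \<le> (2 * (1 + real m)) ^ d * pois r m"
        using pois_nonneg[OF r] by (rule mult_right_mono)
      then show ?thesis by (simp only: power_mult_distrib mult.assoc)
    qed
    have S2: "(\<lambda>m. 2 ^ d * ((1 + real m) ^ d * pois r m)) sums (2 ^ d * S)"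
      by (rule sums_mult[OF S(1)])
    have "summable (\<lambda>m. (1 + real (Suc m)) ^ d * pois r m)"
      by (rule summable_comparison_test[OF _ sums_summable[OF S2]])
         (use le pois_nonneg[OF r] in auto)
    then obtain U where U: "(\<lambda>m. (1 + real (Suc m)) ^ d * pois r m) sums U" by (blast dest: summable_sums)
    have US: "U \<le> 2 ^ d * S" using sums_le[OF le U S2] .
    from sums_add[OF S(1) pois_sums_shift[of "\<lambda>m. (1 + real m) ^ d", OF U]]
    have "(\<lambda>m. (1 + real m) ^ Suc d * pois r m) sums (S + r * U)"
      by (simp add: algebra_simps)
    moreover have "S + r * U \<le> 2 ^ d * c * (1 + r) ^ Suc d"
    proof -
      have S0: "0 \<le> S" by (rule sums_le[OF _ sums_zero S(1)]) (simp add: pois_nonneg[OF r])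
      have "S + r * U \<le> 2 ^ d * S + r * (2 ^ d * S)"
        using US r S0 mult_right_mono[OF one_le_power[of "2::real" d], of S] by (intro add_mono mult_left_mono) auto
      also have "\<dots> = 2 ^ d * (1 + r) * S" by (simp add: algebra_simps)
      also have "\<dots> \<le> 2 ^ d * (1 + r) * (c * (1 + r) ^ d)" using S(2) r by (intro mult_left_mono) auto
      finally show ?thesis by (simp add: ac_simps)
    qed
    ultimately show "\<exists>S. (\<lambda>m. (1 + real m) ^ Suc d * pois r m) sums S \<and> S \<le> 2 ^ d * c * (1 + r) ^ Suc d"
      by blast
  qed (use c in auto)
qed

section \<open>Filtration of the process and integrability of polynomial quantities\<close>

locale hawkes = prob_space M for M :: "'a measure" +
  fixes \<alpha> :: "nat \<Rightarrow> real" and X :: "nat \<Rightarrow> 'a \<Rightarrow> nat"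
  assumes \<alpha>_pos: "\<And>k. \<alpha> k > 0"
    and \<alpha>_summable: "summable \<alpha>" and \<alpha>_less_1: "(\<Sum>k. \<alpha> k) < 1"
    and \<alpha>_moment: "summable (\<lambda>k. real k * \<alpha> k)"
    and process: "discrete_hawkes M \<alpha> X"
begin

abbreviation rate :: "nat \<Rightarrow> 'a \<Rightarrow> real" where
  "rate \<equiv> hawkes_rate \<alpha> X"

abbreviation past :: "nat \<Rightarrow> 'a measure" where
  "past \<equiv> hawkes_past M X"

definition incr :: "nat \<Rightarrow> 'a \<Rightarrow> real" where
  "incr k \<omega> = real (X k \<omega>) - rate k \<omega>"

definition mart :: "nat \<Rightarrow> 'a \<Rightarrow> real" where
  "mart k \<omega> = (\<Sum>j = 1..k. incr j \<omega>)"

text \<open>One dominating variable for everything up to time n. The summand 1 makes its powers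
  increase with the exponent; since every coefficient is at most 1, it also dominates
  \<open>rate\<close> up to time n + 1.\<close>

definition total :: "nat \<Rightarrow> 'a \<Rightarrow> real" where
  "total n \<omega> = 1 + (\<Sum>k = 1..n. real (X k \<omega>))"

lemma X_measurable: "k \<ge> 1 \<Longrightarrow> X k \<in> M \<rightarrow>\<^sub>M count_space UNIV"
  using process by (simp add: discrete_hawkes_def)

lemma past_gen_subset: "(\<Union>i\<in>{1..<k}. {X i -` A \<inter> space M | A. True}) \<subseteq> Pow (space M)"
  by auto

lemma space_past [simp]: "space (past k) = space M"
  unfolding hawkes_past_def by (simp add: space_measure_of_conv)

lemma subalgebra_past: "subalgebra M (past k)"
  unfolding subalgebra_def
proof
  show "sets (past k) \<subseteq> sets M"
    unfolding hawkes_past_def sets_measure_of[OF past_gen_subset]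
    by (rule sets.sigma_sets_subset) (auto intro!: measurable_sets[OF X_measurable])
qed simp

lemma measurable_past_M: "f \<in> borel_measurable (past k) \<Longrightarrow> f \<in> borel_measurable M"
  by (rule measurable_from_subalg[OF subalgebra_past])

lemma measurable_past_mono:
  assumes "f \<in> borel_measurable (past k)" "k \<le> l"
  shows "f \<in> borel_measurable (past l)"
proof -
  have "sets (past k) \<subseteq> sets (past l)"
    unfolding hawkes_past_def sets_measure_of[OF past_gen_subset]
    by (rule sigma_sets_mono') (use assms(2) in fastforce)
  with assms(1) show ?thesis by (auto simp: measurable_def)
qed

lemma X_measurable_past:
  assumes "1 \<le> i" "i < k"
  shows "(\<lambda>\<omega>. real (X i \<omega>)) \<in> borel_measurable (past k)"
proof -
  have "X i \<in> past k \<rightarrow>\<^sub>M count_space UNIV"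
  proof (rule measurableI)
    fix A
    have "X i -` A \<inter> space M \<in> (\<Union>i\<in>{1..<k}. {X i -` A \<inter> space M | A. True})"
      by (rule UN_I[of i]) (use assms in auto)
    then show "X i -` A \<inter> space (past k) \<in> sets (past k)"
      unfolding space_past unfolding hawkes_past_def sets_measure_of[OF past_gen_subset] by (rule sigma_sets.Basic)
  qed auto
  from measurable_compose[OF this, of real borel] show ?thesis by simp
qed

lemma rate_measurable_past: "k \<le> l \<Longrightarrow> rate k \<in> borel_measurable (past l)"
  unfolding hawkes_rate_def[abs_def]
  by (intro borel_measurable_add borel_measurable_sum borel_measurable_times borel_measurable_const X_measurable_past) auto

lemma incr_measurable_past: "1 \<le> k \<Longrightarrow> k < l \<Longrightarrow> incr k \<in> borel_measurable (past l)"
  unfolding incr_def[abs_def]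
  by (intro borel_measurable_diff X_measurable_past rate_measurable_past) auto

lemma mart_measurable_past: "k < l \<Longrightarrow> mart k \<in> borel_measurable (past l)"
  unfolding mart_def[abs_def]
  by (intro borel_measurable_sum incr_measurable_past) auto

lemma \<alpha>_le_1: "\<alpha> k \<le> 1"
proof -
  have "sum \<alpha> {k} \<le> suminf \<alpha>"
    by (rule sum_le_suminf[OF \<alpha>_summable]) (auto intro: less_imp_le \<alpha>_pos)
  then show ?thesis using \<alpha>_less_1 by simp
qed

lemma rate_ge: "\<alpha> 0 \<le> rate k \<omega>"
  unfolding hawkes_rate_def by (simp add: sum_nonneg less_imp_le[OF \<alpha>_pos])

lemma rate_pos: "0 < rate k \<omega>"
  using rate_ge[of k \<omega>] \<alpha>_pos[of 0] by linarith

lemma rate_le_total: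
  assumes "k \<le> Suc n" shows "rate k \<omega> \<le> total n \<omega>"
proof -
  have "(\<Sum>i = 1..<k. \<alpha> (k - i) * real (X i \<omega>)) \<le> (\<Sum>i = 1..<k. 1 * real (X i \<omega>))"
    by (intro sum_mono mult_right_mono \<alpha>_le_1) auto
  also have "\<dots> \<le> (\<Sum>i = 1..n. real (X i \<omega>))"
    unfolding mult_1 using assms by (intro sum_mono2) auto
  finally show ?thesis using \<alpha>_le_1[of 0] by (simp add: hawkes_rate_def total_def)
qed

lemma total_ge_1: "1 \<le> total n \<omega>"
  by (simp add: total_def sum_nonneg)

lemma total_mono: "m \<le> n \<Longrightarrow> total m \<omega> \<le> total n \<omega>"
  unfolding total_def by (intro add_left_mono sum_mono2) auto

lemma X_le_total: "1 \<le> k \<Longrightarrow> k \<le> n \<Longrightarrow> real (X k \<omega>) \<le> total n \<omega>"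
  using sum_mono2[of "{1..n}" "{k}" "\<lambda>k. real (X k \<omega>)"] by (simp add: total_def)

lemma total_measurable_past: "n < k \<Longrightarrow> total n \<in> borel_measurable (past k)"
  unfolding total_def[abs_def]
  by (intro borel_measurable_add borel_measurable_sum borel_measurable_const X_measurable_past) auto

text \<open>The conditional law is given through conditional probabilities of events, so the basic
  identity concerns the event X_k = m, tested against a variable known from the past. Positivity of
  the rate turns \<open>poisson_pmf\<close> into the explicit weight.\<close>

lemma expectation_indicator_past:
  assumes k: "k \<ge> 1" and Z: "Z \<in> borel_measurable (past k)" "integrable M Z"
  shows "integrable M (\<lambda>\<omega>. Z \<omega> * pois (rate k \<omega>) m)"
    and "expectation (\<lambda>\<omega>. Z \<omega> * indicator {m} (X k \<omega>)) = expectation (\<lambda>\<omega>. Z \<omega> * pois (rate k \<omega>) m)"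
proof -
  interpret S: finite_measure_subalgebra M "past k"
    by unfold_locales (rule subalgebra_past)
  have I[measurable]: "(\<lambda>\<omega>. indicator {m} (X k \<omega>) :: real) \<in> borel_measurable M"
    using measurable_compose[OF X_measurable[OF k], of "indicator {m} :: nat \<Rightarrow> real" borel] by simp
  have [measurable]: "Z \<in> borel_measurable M" "rate k \<in> borel_measurable M"
    using Z(1) rate_measurable_past[of k k] measurable_past_M by auto
  have int: "integrable M (\<lambda>\<omega>. Z \<omega> * indicator {m} (X k \<omega>))"
  by (rule Bochner_Integration.integrable_bound[OF Z(2)], measurable) (auto simp: indicator_def)
  note R = S.real_cond_exp_intg[OF int Z(1) I]
  have "AE \<omega> in M. real_cond_exp M (past k) (\<lambda>\<omega>. indicator {m} (X k \<omega>)) \<omega>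
      = measure_pmf.prob (poisson_pmf (rate k \<omega>)) {m}"
    using process k by (simp add: discrete_hawkes_def)
  then have ae: "AE \<omega> in M. Z \<omega> * real_cond_exp M (past k) (\<lambda>\<omega>. indicator {m} (X k \<omega>)) \<omega> = Z \<omega> * pois (rate k \<omega>) m"
    by eventually_elim (simp add: measure_pmf_single rate_pos pois_def)
  have [measurable]: "(\<lambda>\<omega>. pois (rate k \<omega>) m) \<in> borel_measurable M"
    unfolding pois_def by measurable
  have [measurable]: "real_cond_exp M (past k) (\<lambda>\<omega>. indicator {m} (X k \<omega>)) \<in> borel_measurable M"
    by (rule borel_measurable_cond_exp2)
  show "integrable M (\<lambda>\<omega>. Z \<omega> * pois (rate k \<omega>) m)"
    using R(1) by (subst (asm) integrable_cong_AE[OF _ _ ae]) auto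
  show "expectation (\<lambda>\<omega>. Z \<omega> * indicator {m} (X k \<omega>)) = expectation (\<lambda>\<omega>. Z \<omega> * pois (rate k \<omega>) m)"
    using R(2) by (subst (asm) integral_cong_AE[OF _ _ ae]) auto
qed

text \<open>Decomposing over the values of \<open>X k\<close> requires an exchange of sum and
  expectation. It is carried out for nonnegative terms with no integrability assumed of
  \<open>h (X k)\<close>, so that it can serve to prove moments finite.\<close>

lemma nn_expectation_past:
  assumes k: "k \<ge> 1" and Z: "Z \<in> borel_measurable (past k)" "integrable M Z" "\<And>\<omega>. 0 \<le> Z \<omega>"
    and h: "\<And>m. 0 \<le> h m"
  shows "(\<integral>\<^sup>+\<omega>. ennreal (Z \<omega> * h (X k \<omega>)) \<partial>M) = (\<integral>\<^sup>+\<omega>. (\<Sum>m. ennreal (Z \<omega> * (h m * pois (rate k \<omega>) m))) \<partial>M)"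
proof -
  have I[measurable]: "(\<lambda>\<omega>. indicator {m} (X k \<omega>) :: real) \<in> borel_measurable M" for m
    using measurable_compose[OF X_measurable[OF k], of "indicator {m} :: nat \<Rightarrow> real" borel] by simp
  have [measurable]: "Z \<in> borel_measurable M" "rate k \<in> borel_measurable M"
    using Z(1) rate_measurable_past[of k k] measurable_past_M by auto
  have [measurable]: "(\<lambda>\<omega>. pois (rate k \<omega>) m) \<in> borel_measurable M" for m
    unfolding pois_def by measurable
  have p0: "0 \<le> pois (rate k \<omega>) m" for \<omega> m
    by (rule pois_nonneg[OF less_imp_le[OF rate_pos]])
  have "ennreal (Z \<omega> * h (X k \<omega>)) = (\<Sum>m. ennreal (h m * (Z \<omega> * indicator {m} (X k \<omega>))))" for \<omega>
  proof -
    have "(\<lambda>m. ennreal (h m * (Z \<omega> * indicator {m} (X k \<omega>)))) sums ennreal (h (X k \<omega>) * (Z \<omega> * indicator {X k \<omega>} (X k \<omega>)))"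
      using sums_finite[of "{X k \<omega>}" "\<lambda>m. ennreal (h m * (Z \<omega> * indicator {m} (X k \<omega>)))"] by auto
    from sums_unique[OF this] show ?thesis by (simp add: mult.commute)
  qed
  then have "(\<integral>\<^sup>+\<omega>. ennreal (Z \<omega> * h (X k \<omega>)) \<partial>M) = (\<Sum>m. \<integral>\<^sup>+\<omega>. ennreal (h m * (Z \<omega> * indicator {m} (X k \<omega>))) \<partial>M)"
    by (simp only:) (rule nn_integral_suminf, measurable)
  also have "\<dots> = (\<Sum>m. \<integral>\<^sup>+\<omega>. ennreal (h m * (Z \<omega> * pois (rate k \<omega>) m)) \<partial>M)"
  proof (rule suminf_cong)
    fix m
    have int: "integrable M (\<lambda>\<omega>. Z \<omega> * indicator {m} (X k \<omega>))"
  by (rule Bochner_Integration.integrable_bound[OF Z(2)], measurable) (auto simp: indicator_def)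
    note E = expectation_indicator_past[OF k Z(1,2), of m]
    have "(\<integral>\<^sup>+\<omega>. ennreal (h m * (Z \<omega> * indicator {m} (X k \<omega>))) \<partial>M) = ennreal (expectation (\<lambda>\<omega>. h m * (Z \<omega> * indicator {m} (X k \<omega>))))"
      using int h Z(3) by (intro nn_integral_eq_integral integrable_mult_right) auto
    also have "\<dots> = ennreal (expectation (\<lambda>\<omega>. h m * (Z \<omega> * pois (rate k \<omega>) m)))"
      using E(2) by simp
    also have "\<dots> = (\<integral>\<^sup>+\<omega>. ennreal (h m * (Z \<omega> * pois (rate k \<omega>) m)) \<partial>M)"
      using E(1) h Z(3) p0 by (intro nn_integral_eq_integral[symmetric] integrable_mult_right) auto
    finally show "(\<integral>\<^sup>+\<omega>. ennreal (h m * (Z \<omega> * indicator {m} (X k \<omega>))) \<partial>M)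
      = (\<integral>\<^sup>+\<omega>. ennreal (h m * (Z \<omega> * pois (rate k \<omega>) m)) \<partial>M)" .
  qed
  also have "\<dots> = (\<integral>\<^sup>+\<omega>. (\<Sum>m. ennreal (h m * (Z \<omega> * pois (rate k \<omega>) m))) \<partial>M)"
    by (rule nn_integral_suminf[symmetric]) measurable
  finally show ?thesis by (simp add: ac_simps)
qed

text \<open>Induction on n for all exponents at once. Since \<open>total (Suc n)\<close> is at most
  \<open>total n\<close> times 1 + X_{n+1}, and the conditional moment of order d is at most a
  multiple of \<open>total n ^ d\<close>, exponent d at time n + 1 is paid for by exponent 2 d at
  time n.\<close>

lemma integrable_total_power: "integrable M (\<lambda>\<omega>. total n \<omega> ^ d)"
proof (induction n arbitrary: d)
  case 0
  show ?case by (simp add: total_def)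
next
  case (Suc n)
  obtain c where c: "c \<ge> 0" "\<And>r. r \<ge> 0 \<Longrightarrow> \<exists>S. (\<lambda>m. (1 + real m) ^ d * pois r m) sums S \<and> S \<le> c * (1 + r) ^ d"
    using pois_moment_bound[of d] by blast
  note [measurable] = measurable_past_M[OF total_measurable_past[OF lessI]]
  have t0: "0 \<le> total n \<omega>" for n \<omega> using total_ge_1[of n \<omega>] by simp
  have "(\<integral>\<^sup>+\<omega>. ennreal (total (Suc n) \<omega> ^ d) \<partial>M) \<le> (\<integral>\<^sup>+\<omega>. ennreal (total n \<omega> ^ d * (1 + real (X (Suc n) \<omega>)) ^ d) \<partial>M)"
  proof (intro nn_integral_mono ennreal_leI)
    fix \<omega>
    have "total (Suc n) \<omega> = total n \<omega> + 1 * real (X (Suc n) \<omega>)" by (simp add: total_def)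
    also have "\<dots> \<le> total n \<omega> + total n \<omega> * real (X (Suc n) \<omega>)"
      using total_ge_1[of n \<omega>] by (intro add_left_mono mult_right_mono) auto
    finally have "total (Suc n) \<omega> \<le> total n \<omega> * (1 + real (X (Suc n) \<omega>))" by (simp add: algebra_simps)
    then show "total (Suc n) \<omega> ^ d \<le> total n \<omega> ^ d * (1 + real (X (Suc n) \<omega>)) ^ d"
      using t0 by (simp flip: power_mult_distrib add: power_mono)
  qed
  also have "\<dots> = (\<integral>\<^sup>+\<omega>. (\<Sum>m. ennreal (total n \<omega> ^ d * ((1 + real m) ^ d * pois (rate (Suc n) \<omega>) m))) \<partial>M)"
    using t0 by (intro nn_expectation_past Suc.IH borel_measurable_power total_measurable_past) auto
  also have "\<dots> \<le> (\<integral>\<^sup>+\<omega>. ennreal ((c * 2 ^ d) * total n \<omega> ^ (d + d)) \<partial>M)"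
  proof (rule nn_integral_mono)
    fix \<omega>
    have r0: "0 \<le> rate (Suc n) \<omega>" using rate_pos by (rule less_imp_le)
    obtain S where S: "(\<lambda>m. (1 + real m) ^ d * pois (rate (Suc n) \<omega>) m) sums S" "S \<le> c * (1 + rate (Suc n) \<omega>) ^ d"
      using c(2)[OF r0] by blast
    have "(\<Sum>m. ennreal (total n \<omega> ^ d * ((1 + real m) ^ d * pois (rate (Suc n) \<omega>) m))) = ennreal (total n \<omega> ^ d * S)"
      by (rule suminf_ennreal_eq[OF _ sums_mult[OF S(1)]]) (simp add: t0 pois_nonneg[OF r0])
    also have "\<dots> \<le> ennreal ((c * 2 ^ d) * total n \<omega> ^ (d + d))"
    proof (rule ennreal_leI)
      have "(1 + rate (Suc n) \<omega>) ^ d \<le> (2 * total n \<omega>) ^ d"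
        using rate_le_total[of "Suc n" n \<omega>] total_ge_1[of n \<omega>] r0 by (intro power_mono) auto
      then have "S \<le> c * (2 * total n \<omega>) ^ d" using S(2) c(1) by (meson mult_left_mono order_trans)
      then have "total n \<omega> ^ d * S \<le> total n \<omega> ^ d * (c * (2 * total n \<omega>) ^ d)"
        using t0 by (intro mult_left_mono) auto
      then show "total n \<omega> ^ d * S \<le> (c * 2 ^ d) * total n \<omega> ^ (d + d)"
        by (simp add: power_mult_distrib power_add ac_simps)
    qed
    finally show "(\<Sum>m. ennreal (total n \<omega> ^ d * ((1 + real m) ^ d * pois (rate (Suc n) \<omega>) m))) \<le> ennreal ((c * 2 ^ d) * total n \<omega> ^ (d + d))" .
  qed
  also have "\<dots> < \<infinity>"
    using integrableD(2)[OF integrable_mult_right[OF Suc.IH[of "d + d"], of "c * 2 ^ d"]] c(1) t0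
    by (simp add: abs_mult less_top[symmetric])
  finally show ?case
    using t0 by (intro integrableI_nonneg) auto
qed

text \<open>Random variables dominated by a power of some \<open>total n\<close> form an algebra of integrable functions.\<close>

definition poly_growth :: "('a \<Rightarrow> real) \<Rightarrow> bool" where
  "poly_growth Z \<longleftrightarrow> Z \<in> borel_measurable M \<and> (\<exists>C n d. \<forall>\<omega>. \<bar>Z \<omega>\<bar> \<le> C * total n \<omega> ^ d)"

lemma poly_growthI:
  "Z \<in> borel_measurable M \<Longrightarrow> (\<And>\<omega>. \<bar>Z \<omega>\<bar> \<le> C * total n \<omega> ^ d) \<Longrightarrow> poly_growth Z"
  unfolding poly_growth_def by blast

lemma poly_growthE:
  assumes "poly_growth Z"
  obtains C n d where "C \<ge> 0" "\<And>\<omega> m e. n \<le> m \<Longrightarrow> d \<le> e \<Longrightarrow> \<bar>Z \<omega>\<bar> \<le> C * total m \<omega> ^ e" "Z \<in> borel_measurable M"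
proof -
  from assms obtain C n d where C: "\<And>\<omega>. \<bar>Z \<omega>\<bar> \<le> C * total n \<omega> ^ d" and Z: "Z \<in> borel_measurable M"
    unfolding poly_growth_def by blast
  show ?thesis
  proof (rule that[of "\<bar>C\<bar>" n d])
    fix \<omega> m e assume "n \<le> m" "d \<le> e"
    have "\<bar>Z \<omega>\<bar> \<le> C * total n \<omega> ^ d" by (rule C)
    also have "\<dots> \<le> \<bar>C\<bar> * total n \<omega> ^ d"
      using total_ge_1[of n \<omega>] by (intro mult_right_mono) auto
    also have "\<dots> \<le> \<bar>C\<bar> * total m \<omega> ^ d"
      using total_ge_1[of n \<omega>] total_mono[OF \<open>n \<le> m\<close>] by (intro mult_left_mono power_mono) auto
    also have "\<dots> \<le> \<bar>C\<bar> * total m \<omega> ^ e"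
      using total_ge_1[of m \<omega>] \<open>d \<le> e\<close> by (intro mult_left_mono power_increasing) auto
    finally show "\<bar>Z \<omega>\<bar> \<le> \<bar>C\<bar> * total m \<omega> ^ e" .
  qed (use Z in auto)
qed

lemma poly_growth_measurable: "poly_growth Z \<Longrightarrow> Z \<in> borel_measurable M"
  by (simp add: poly_growth_def)

lemma poly_growth_integrable: 
  assumes "poly_growth Z" shows "integrable M Z"
  using assms
proof (rule poly_growthE)
  fix C n d assume C: "C \<ge> 0" "\<And>\<omega> m e. n \<le> m \<Longrightarrow> d \<le> e \<Longrightarrow> \<bar>Z \<omega>\<bar> \<le> C * total m \<omega> ^ e" "Z \<in> borel_measurable M"
  show ?thesis
    by (rule Bochner_Integration.integrable_bound[OF integrable_mult_right[OF integrable_total_power[of n d], of C] C(3)])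
       (use C(2)[of n d] in \<open>auto intro: order_trans[OF _ abs_ge_self]\<close>)
qed

lemma poly_growth_const: "poly_growth (\<lambda>_. c)"
  by (rule poly_growthI[of _ "\<bar>c\<bar>" 0 0]) auto

lemma poly_growth_X: "k \<ge> 1 \<Longrightarrow> poly_growth (\<lambda>\<omega>. real (X k \<omega>))"
  using X_le_total[of k k]
  by (intro poly_growthI[of _ 1 k 1] measurable_past_M[OF X_measurable_past[of k "Suc k"]]) auto

lemma poly_growth_dominated:
  assumes "poly_growth Z" "Y \<in> borel_measurable M" "\<And>\<omega>. \<bar>Y \<omega>\<bar> \<le> \<bar>Z \<omega>\<bar>"
  shows "poly_growth Y"
  using assms unfolding poly_growth_def by (blast intro: order_trans)

lemma poly_growth_abs:
  assumes "poly_growth Z" shows "poly_growth (\<lambda>\<omega>. \<bar>Z \<omega>\<bar>)"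
proof (rule poly_growth_dominated[OF assms])
  show "(\<lambda>\<omega>. \<bar>Z \<omega>\<bar>) \<in> borel_measurable M"
    using poly_growth_measurable[OF assms] by measurable
qed simp

lemma poly_growth_add:
  assumes "poly_growth Y" "poly_growth Z" shows "poly_growth (\<lambda>\<omega>. Y \<omega> + Z \<omega>)"
proof -
  obtain C n d where Y: "C \<ge> 0" "\<And>\<omega> m e. n \<le> m \<Longrightarrow> d \<le> e \<Longrightarrow> \<bar>Y \<omega>\<bar> \<le> C * total m \<omega> ^ e" "Y \<in> borel_measurable M"
    by (rule poly_growthE[OF assms(1)]) (rule that)
  obtain C' n' d' where Z: "C' \<ge> 0" "\<And>\<omega> m e. n' \<le> m \<Longrightarrow> d' \<le> e \<Longrightarrow> \<bar>Z \<omega>\<bar> \<le> C' * total m \<omega> ^ e" "Z \<in> borel_measurable M"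
    by (rule poly_growthE[OF assms(2)]) (rule that)
  show ?thesis
  proof (rule poly_growthI[of _ "C + C'" "max n n'" "max d d'"])
    fix \<omega>
    show "\<bar>Y \<omega> + Z \<omega>\<bar> \<le> (C + C') * total (max n n') \<omega> ^ max d d'"
      using Y(2)[of "max n n'" "max d d'" \<omega>] Z(2)[of "max n n'" "max d d'" \<omega>] abs_triangle_ineq[of "Y \<omega>" "Z \<omega>"]
      unfolding distrib_right by linarith
  qed (use Y Z in auto)
qed

lemma poly_growth_mult:
  assumes "poly_growth Y" "poly_growth Z" shows "poly_growth (\<lambda>\<omega>. Y \<omega> * Z \<omega>)"
proof -
  obtain C n d where Y: "C \<ge> 0" "\<And>\<omega> m e. n \<le> m \<Longrightarrow> d \<le> e \<Longrightarrow> \<bar>Y \<omega>\<bar> \<le> C * total m \<omega> ^ e" "Y \<in> borel_measurable M"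
    by (rule poly_growthE[OF assms(1)]) (rule that)
  obtain C' n' d' where Z: "C' \<ge> 0" "\<And>\<omega> m e. n' \<le> m \<Longrightarrow> d' \<le> e \<Longrightarrow> \<bar>Z \<omega>\<bar> \<le> C' * total m \<omega> ^ e" "Z \<in> borel_measurable M"
    by (rule poly_growthE[OF assms(2)]) (rule that)
  show ?thesis
  proof (rule poly_growthI[of _ "C * C'" "max n n'" "d + d'"])
    fix \<omega>
    have "\<bar>Y \<omega>\<bar> * \<bar>Z \<omega>\<bar> \<le> (C * total (max n n') \<omega> ^ d) * (C' * total (max n n') \<omega> ^ d')"
      using Y(1) total_ge_1[of "max n n'" \<omega>] by (intro mult_mono Y(2) Z(2)) auto
    then show "\<bar>Y \<omega> * Z \<omega>\<bar> \<le> (C * C') * total (max n n') \<omega> ^ (d + d')"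
      by (simp add: abs_mult power_add ac_simps)
  qed (use Y Z in auto)
qed

lemma poly_growth_diff:
  assumes "poly_growth Y" "poly_growth Z" shows "poly_growth (\<lambda>\<omega>. Y \<omega> - Z \<omega>)"
  using poly_growth_add[OF assms(1) poly_growth_mult[OF poly_growth_const[of "-1"] assms(2)]] by simp

lemma poly_growth_sum:
  "(\<And>i. i \<in> A \<Longrightarrow> poly_growth (Z i)) \<Longrightarrow> poly_growth (\<lambda>\<omega>. \<Sum>i\<in>A. Z i \<omega>)"
  by (induction A rule: infinite_finite_induct) (auto intro: poly_growth_const poly_growth_add)

lemma poly_growth_power: "poly_growth Z \<Longrightarrow> poly_growth (\<lambda>\<omega>. Z \<omega> ^ p)"
  by (induction p) (auto intro: poly_growth_const poly_growth_mult)

lemma poly_growth_rate: "poly_growth (rate k)"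
  unfolding hawkes_rate_def[abs_def]
  by (intro poly_growth_add poly_growth_const poly_growth_sum poly_growth_mult poly_growth_X) auto

lemma poly_growth_incr: "k \<ge> 1 \<Longrightarrow> poly_growth (incr k)"
  unfolding incr_def[abs_def] by (intro poly_growth_diff poly_growth_rate poly_growth_X)

lemma poly_growth_mart: "poly_growth (mart k)"
  unfolding mart_def[abs_def] by (intro poly_growth_sum poly_growth_incr) auto

lemma poly_growth_lipschitz:
  assumes L: "L-lipschitz_on UNIV f" and Z: "poly_growth Z"
  shows "poly_growth (\<lambda>\<omega>. f (Z \<omega>))"
proof (rule poly_growth_dominated)
  show "poly_growth (\<lambda>\<omega>. \<bar>f 0\<bar> + L * \<bar>Z \<omega>\<bar>)"
    by (intro poly_growth_add poly_growth_mult poly_growth_const poly_growth_abs Z)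
  show "\<bar>f (Z \<omega>)\<bar> \<le> \<bar>\<bar>f 0\<bar> + L * \<bar>Z \<omega>\<bar>\<bar>" for \<omega>
    using lipschitz_abs_le[OF L, of "Z \<omega>" 0] by simp
  show "(\<lambda>\<omega>. f (Z \<omega>)) \<in> borel_measurable M"
    using poly_growth_measurable[OF Z] lipschitz_borel[OF L] by measurable
qed

lemmas poly_growth_intros = poly_growth_const poly_growth_add poly_growth_mult poly_growth_diff poly_growth_power
  poly_growth_sum poly_growth_abs poly_growth_rate poly_growth_incr poly_growth_mart poly_growth_X

text \<open>With integrability secured by \<open>poly_growth\<close>, a signed weight
  \<open>Z\<close> splits into positive and negative parts, and the nonnegative identity applies to
  each. The function \<open>q\<close> is the conditional mean of \<open>h (X k)\<close>, presented
  as a Poisson series.\<close>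

lemma expectation_past:
  assumes k: "k \<ge> 1" and Z: "Z \<in> borel_measurable (past k)" "poly_growth Z"
    and h: "\<And>m. 0 \<le> h m" "poly_growth (\<lambda>\<omega>. h (X k \<omega>))"
    and q: "\<And>\<omega>. (\<lambda>m. h m * pois (rate k \<omega>) m) sums q \<omega>" "poly_growth q"
  shows "expectation (\<lambda>\<omega>. Z \<omega> * h (X k \<omega>)) = expectation (\<lambda>\<omega>. Z \<omega> * q \<omega>)"
proof -
  have p0: "0 \<le> pois (rate k \<omega>) m" for \<omega> m
    by (rule pois_nonneg[OF less_imp_le[OF rate_pos]])
  have q0: "0 \<le> q \<omega>" for \<omega>
    by (rule sums_le[OF _ sums_zero q(1)]) (simp add: h p0)
  have *: "expectation (\<lambda>\<omega>. Y \<omega> * h (X k \<omega>)) = expectation (\<lambda>\<omega>. Y \<omega> * q \<omega>)"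
    if Y: "Y \<in> borel_measurable (past k)" "poly_growth Y" "\<And>\<omega>. 0 \<le> Y \<omega>" for Y
  proof -
    have "ennreal (expectation (\<lambda>\<omega>. Y \<omega> * h (X k \<omega>))) = (\<integral>\<^sup>+\<omega>. ennreal (Y \<omega> * h (X k \<omega>)) \<partial>M)"
      using Y h by (intro nn_integral_eq_integral[symmetric] poly_growth_integrable poly_growth_mult) auto
    also have "\<dots> = (\<integral>\<^sup>+\<omega>. (\<Sum>m. ennreal (Y \<omega> * (h m * pois (rate k \<omega>) m))) \<partial>M)"
      by (intro nn_expectation_past k Y poly_growth_integrable h)
    also have "\<dots> = (\<integral>\<^sup>+\<omega>. ennreal (Y \<omega> * q \<omega>) \<partial>M)"
      by (intro nn_integral_cong suminf_ennreal_eq sums_mult q) (simp add: Y h p0)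
    also have "\<dots> = ennreal (expectation (\<lambda>\<omega>. Y \<omega> * q \<omega>))"
      using Y q q0 by (intro nn_integral_eq_integral poly_growth_integrable poly_growth_mult) auto
    finally show ?thesis
      using Y(3) h(1) q0 by (subst (asm) ennreal_inj) (auto intro!: integral_nonneg_AE)
  qed
  let ?P = "\<lambda>\<omega>. max (Z \<omega>) 0" and ?N = "\<lambda>\<omega>. max (- Z \<omega>) 0"
  have ZM: "Z \<in> borel_measurable M" by (rule poly_growth_measurable[OF Z(2)])
  have pg: "poly_growth ?P" "poly_growth ?N"
    using ZM by (auto intro!: poly_growth_dominated[OF Z(2)])
  have e: "Z \<omega> * y = ?P \<omega> * y - ?N \<omega> * y" for \<omega> y by (auto simp: max_def)
  have "expectation (\<lambda>\<omega>. Z \<omega> * h (X k \<omega>)) = expectation (\<lambda>\<omega>. ?P \<omega> * h (X k \<omega>)) - expectation (\<lambda>\<omega>. ?N \<omega> * h (X k \<omega>))"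
    unfolding e by (intro Bochner_Integration.integral_diff poly_growth_integrable poly_growth_mult pg h)
  also have "\<dots> = expectation (\<lambda>\<omega>. ?P \<omega> * q \<omega>) - expectation (\<lambda>\<omega>. ?N \<omega> * q \<omega>)"
    using Z(1) pg by (simp add: *)
  also have "\<dots> = expectation (\<lambda>\<omega>. Z \<omega> * q \<omega>)"
    unfolding e by (intro Bochner_Integration.integral_diff[symmetric] poly_growth_integrable poly_growth_mult pg q)
  finally show ?thesis .
qed

end

section \<open>Convolution sums along diagonals\<close>

lemma weighted_cauchy_schwarz:
  fixes w y :: "'b \<Rightarrow> real"
  assumes "finite A" "\<And>i. i \<in> A \<Longrightarrow> 0 \<le> w i"
  shows "(\<Sum>i\<in>A. w i * y i)\<^sup>2 \<le> (\<Sum>i\<in>A. w i) * (\<Sum>i\<in>A. w i * (y i)\<^sup>2)"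
proof -
  have "(\<Sum>i\<in>A. w i * y i) = (\<Sum>i\<in>A. sqrt (w i) * (sqrt (w i) * y i))"
    using assms(2) by (intro sum.cong) (auto simp flip: mult.assoc)
  then have "(\<Sum>i\<in>A. w i * y i)\<^sup>2 \<le> (\<Sum>i\<in>A. (sqrt (w i))\<^sup>2) * (\<Sum>i\<in>A. (sqrt (w i) * y i)\<^sup>2)"
    by (simp add: Cauchy_Schwarz_ineq_sum)
  also have "\<dots> = (\<Sum>i\<in>A. w i) * (\<Sum>i\<in>A. w i * (y i)\<^sup>2)"
    using assms(2) by (simp add: power_mult_distrib)
  finally show ?thesis .
qed

text \<open>The substitution j = k - s - l places the entry \<open>y k l\<close> on the diagonal k -
  l = s + j with weight \<open>\<alpha> j\<close>. Exchanging the sums leaves one diagonal sum for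
  each j.\<close>

lemma convolution_shift_bound:
  fixes y :: "nat \<Rightarrow> nat \<Rightarrow> real" and \<alpha> :: "nat \<Rightarrow> real"
  assumes \<alpha>: "\<And>j. 0 \<le> \<alpha> j" "(\<Sum>j = 1..n. \<alpha> j) \<le> a" and Y: "0 \<le> Y"
    and y: "\<And>j. j \<ge> 1 \<Longrightarrow> (\<Sum>k = s + j + 1..n. y k (k - (s + j))) \<le> Y"
  shows "(\<Sum>k = s + 1..n. \<Sum>l = 1..<k - s. \<alpha> (k - s - l) * y k l) \<le> a * Y"
proof -
  have inner: "(\<Sum>l = 1..<k - s. \<alpha> (k - s - l) * y k l)
      = (\<Sum>j\<in>{1..n}. if s + j < k then \<alpha> j * y k (k - (s + j)) else 0)" if k: "k \<in> {s + 1..n}" for k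
  proof -
    have "(\<Sum>l = 1..<k - s. \<alpha> (k - s - l) * y k l) = (\<Sum>j = 1..<k - s. \<alpha> j * y k (k - (s + j)))"
      by (rule sum.reindex_bij_witness[of _ "\<lambda>j. k - s - j" "\<lambda>l. k - s - l"]) auto
    also have "\<dots> = (\<Sum>j\<in>{1..n} \<inter> {j. s + j < k}. \<alpha> j * y k (k - (s + j)))"
      using k by (intro sum.cong) auto
    also have "\<dots> = (\<Sum>j\<in>{1..n}. if s + j < k then \<alpha> j * y k (k - (s + j)) else 0)"
      by (simp add: sum.inter_restrict)
    finally show ?thesis .
  qed
  have "(\<Sum>k = s + 1..n. \<Sum>l = 1..<k - s. \<alpha> (k - s - l) * y k l)
      = (\<Sum>k = s + 1..n. \<Sum>j\<in>{1..n}. if s + j < k then \<alpha> j * y k (k - (s + j)) else 0)"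
    by (intro sum.cong refl inner)
  also have "\<dots> = (\<Sum>j\<in>{1..n}. \<Sum>k = s + 1..n. if s + j < k then \<alpha> j * y k (k - (s + j)) else 0)"
    by (rule sum.swap)
  also have "\<dots> = (\<Sum>j\<in>{1..n}. \<alpha> j * (\<Sum>k = s + j + 1..n. y k (k - (s + j))))"
  proof (rule sum.cong[OF refl])
    fix j
    have "(\<Sum>k = s + 1..n. if s + j < k then \<alpha> j * y k (k - (s + j)) else 0)
        = (\<Sum>k\<in>{s + 1..n} \<inter> {k. s + j < k}. \<alpha> j * y k (k - (s + j)))"
      by (simp add: sum.inter_restrict)
    also have "{s + 1..n} \<inter> {k. s + j < k} = {s + j + 1..n}" by auto
    finally show "(\<Sum>k = s + 1..n. if s + j < k then \<alpha> j * y k (k - (s + j)) else 0)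
        = \<alpha> j * (\<Sum>k = s + j + 1..n. y k (k - (s + j)))" by (simp add: sum_distrib_left)
  qed
  also have "\<dots> \<le> (\<Sum>j\<in>{1..n}. \<alpha> j * Y)"
    by (intro sum_mono mult_left_mono y \<alpha>(1)) auto
  also have "\<dots> \<le> a * Y"
    unfolding sum_distrib_right[symmetric] by (rule mult_right_mono[OF \<alpha>(2) Y])
  finally show ?thesis .
qed

text \<open>The diagonals \<open>i = k - s\<close> are the sums that the renewal inequality leaves stable:
  the diagonal \<open>s\<close> is controlled by the diagonals \<open>s + j\<close> with \<open>j \<ge> 1\<close>.\<close>

lemma renewal_diagonal_bound:
  fixes x c :: "nat \<Rightarrow> nat \<Rightarrow> real" and \<alpha> :: "nat \<Rightarrow> real"
  assumes \<alpha>: "\<And>j. 0 \<le> \<alpha> j" "(\<Sum>j = 1..n. \<alpha> j) \<le> a" and a: "a < 1"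
    and x: "\<And>k i. 1 \<le> i \<Longrightarrow> i \<le> k \<Longrightarrow> k \<le> n \<Longrightarrow> x k i \<le> (\<Sum>l = 1..<i. \<alpha> (i - l) * x k l) + c k i"
    and C: "0 \<le> C" "\<And>s. (\<Sum>k = s + 1..n. c k (k - s)) \<le> C"
  shows "(\<Sum>k = s + 1..n. x k (k - s)) \<le> C / (1 - a)"
\<comment> \<open>Downward induction in s: the diagonals s + j are shorter, and those with s >= n
  are empty. The bound is the solution x of x = a x + C, so it reproduces itself.\<close>
proof (induction "n - s" arbitrary: s rule: less_induct)
  case less
  show ?case
  proof (cases "s < n")
    case False
    then show ?thesis using C a by simp
  next
    case True
    have "(\<Sum>k = s + 1..n. x k (k - s)) \<le> (\<Sum>k = s + 1..n. (\<Sum>l = 1..<k - s. \<alpha> (k - s - l) * x k l) + c k (k - s))"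
      by (intro sum_mono x) auto
    also have "\<dots> = (\<Sum>k = s + 1..n. \<Sum>l = 1..<k - s. \<alpha> (k - s - l) * x k l) + (\<Sum>k = s + 1..n. c k (k - s))"
      by (rule sum.distrib)
    also have "\<dots> \<le> a * (C / (1 - a)) + C"
    proof (intro add_mono C(2) convolution_shift_bound \<alpha>)
      show "0 \<le> C / (1 - a)" using C a by simp
      show "(\<Sum>k = s + j + 1..n. x k (k - (s + j))) \<le> C / (1 - a)" if "j \<ge> 1" for j
        using less[of "s + j"] that True by simp
    qed
    also have "\<dots> = C / (1 - a)" using a by (simp add: field_simps)
    finally show ?thesis .
  qed
qed

context hawkes
begin

section \<open>Constants of the kernel and the centred rate\<close>

definition \<alpha>_norm :: real where "\<alpha>_norm = (\<Sum>k. \<alpha> (Suc k))"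
definition var :: real where "var = \<alpha> 0 / (1 - \<alpha>_norm)"
text \<open>Kernel mass at lags i and beyond. At time i only lags below i reach back to an existing
  X, so this is the mass missing from \<open>rate i\<close>.\<close>

definition tail :: "nat \<Rightarrow> real" where "tail i = (\<Sum>j. \<alpha> (i + j))"
definition \<mu> :: real where "\<mu> = (\<Sum>k. real k * \<alpha> k)"
text \<open>Fixed point of K = 1 + q K, where q is the sum of all \<open>\<alpha> k\<close>; in this
  form the recursion for second moments of the rate closes.\<close>

definition K :: real where "K = 1 / (1 - (\<Sum>k. \<alpha> k))"

lemma \<alpha>_nonneg: "0 \<le> \<alpha> k" using \<alpha>_pos[of k] by simp

lemma \<alpha>_norm_eq: "\<alpha> 0 + \<alpha>_norm = (\<Sum>k. \<alpha> k)"
  unfolding \<alpha>_norm_def using suminf_split_head[OF \<alpha>_summable] by simp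

lemma \<alpha>_norm_bounds: "0 \<le> \<alpha>_norm" "\<alpha>_norm < 1" "\<alpha> 0 < 1 - \<alpha>_norm"
proof -
  have "summable (\<lambda>k. \<alpha> (Suc k))" using \<alpha>_summable by (subst summable_Suc_iff)
  then show "0 \<le> \<alpha>_norm" unfolding \<alpha>_norm_def by (rule suminf_nonneg) (rule \<alpha>_nonneg)
  show "\<alpha>_norm < 1" "\<alpha> 0 < 1 - \<alpha>_norm" using \<alpha>_norm_eq \<alpha>_less_1 \<alpha>_pos[of 0] by linarith+
qed

lemma sum_\<alpha>_le: "(\<Sum>j = 1..n. \<alpha> j) \<le> \<alpha>_norm"
proof -
  have "(\<Sum>j = 1..n. \<alpha> j) = (\<Sum>j<n. \<alpha> (Suc j))"
    by (rule sum.reindex_bij_witness[of _ Suc "\<lambda>j. j - 1"]) auto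
  also have "\<dots> \<le> \<alpha>_norm" unfolding \<alpha>_norm_def
    using \<alpha>_summable by (intro sum_le_suminf) (auto simp: summable_Suc_iff \<alpha>_nonneg)
  finally show ?thesis .
qed

lemma sum_\<alpha>_reverse: "(\<Sum>l = 1..<i. \<alpha> (i - l) * g (i - l)) = (\<Sum>j = 1..<i. \<alpha> j * g j)"
  by (rule sum.reindex_bij_witness[of _ "\<lambda>j. i - j" "\<lambda>l. i - l"]) auto

lemma sum_\<alpha>_past_le: "(\<Sum>l = 1..<i. \<alpha> (i - l)) \<le> \<alpha>_norm"
proof -
  have "(\<Sum>l = 1..<i. \<alpha> (i - l)) = (\<Sum>j = 1..<i. \<alpha> j)"
    using sum_\<alpha>_reverse[where g = "\<lambda>_. 1" and i = i] by simp
  also have "\<dots> \<le> (\<Sum>j = 1..i. \<alpha> j)" by (intro sum_mono2) (auto simp: \<alpha>_nonneg)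
  also have "\<dots> \<le> \<alpha>_norm" by (rule sum_\<alpha>_le)
  finally show ?thesis .
qed

lemma sum_\<alpha>_moment_le: "(\<Sum>l = 1..<i. \<alpha> (i - l) * real (i - l)) \<le> \<mu>"
proof -
  have "(\<Sum>l = 1..<i. \<alpha> (i - l) * real (i - l)) = (\<Sum>j = 1..<i. real j * \<alpha> j)"
    unfolding sum_\<alpha>_reverse by (simp add: mult.commute)
  also have "\<dots> \<le> \<mu>" unfolding \<mu>_def by (intro sum_le_suminf \<alpha>_moment) (auto simp: \<alpha>_nonneg)
  finally show ?thesis .
qed

lemma \<mu>_nonneg: "0 \<le> \<mu>"
  unfolding \<mu>_def by (intro suminf_nonneg \<alpha>_moment) (simp add: \<alpha>_nonneg)

lemma var_pos: "0 < var" and var_le_1: "var \<le> 1" and \<alpha>_0_eq: "\<alpha> 0 = var * (1 - \<alpha>_norm)"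
  using \<alpha>_norm_bounds \<alpha>_pos[of 0] by (auto simp: var_def)

lemma K_ge_1: "1 \<le> K" and K_eq: "1 + (\<Sum>k. \<alpha> k) * K = K"
proof -
  have "0 \<le> (\<Sum>k. \<alpha> k)" by (intro suminf_nonneg \<alpha>_summable \<alpha>_nonneg)
  then show "1 \<le> K" "1 + (\<Sum>k. \<alpha> k) * K = K" using \<alpha>_less_1 by (auto simp: K_def field_simps)
qed

lemma tail_nonneg: "0 \<le> tail i"
  unfolding tail_def
  by (intro suminf_nonneg \<alpha>_nonneg summable_ignore_initial_segment[OF \<alpha>_summable, of i, unfolded add.commute[of _ i]])

lemma tail_eq: "1 \<le> i \<Longrightarrow> tail i = \<alpha>_norm - (\<Sum>j = 1..<i. \<alpha> j)"
proof -
  assume i: "1 \<le> i"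
  have "(\<Sum>k. \<alpha> k) = (\<Sum>n. \<alpha> (n + i)) + sum \<alpha> {..<i}"
    by (rule suminf_split_initial_segment[OF \<alpha>_summable])
  moreover have "sum \<alpha> {..<i} = \<alpha> 0 + (\<Sum>j = 1..<i. \<alpha> j)"
    using i by (simp add: lessThan_atLeast0 sum.atLeast_Suc_lessThan)
  ultimately show ?thesis using \<alpha>_norm_eq by (simp add: tail_def add.commute)
qed

text \<open>Exchanging the summations counts \<open>\<alpha> j\<close> once for every i <= j, hence
  at most j times, so the first moment of the kernel bounds the total missing mass.\<close>

lemma sum_tail_le: "(\<Sum>i = 1..n. tail i) \<le> \<mu>"
proof -
  have s: "(\<lambda>j. if i \<le> j then \<alpha> j else 0) sums tail i" for i
  proof -
    have "(\<lambda>j. \<alpha> (j + i)) sums tail i"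
      using summable_ignore_initial_segment[OF \<alpha>_summable, of i]
      by (simp add: tail_def summable_sums add.commute)
    then have "(\<lambda>j. if i \<le> j + i then \<alpha> (j + i) else 0) sums tail i" by simp
    then show ?thesis by (subst (asm) sums_iff_shift) simp
  qed
  have "(\<lambda>j. \<Sum>i = 1..n. if i \<le> j then \<alpha> j else 0) sums (\<Sum>i = 1..n. tail i)"
    by (rule sums_sum) (rule s)
  moreover have "(\<lambda>k. real k * \<alpha> k) sums \<mu>" unfolding \<mu>_def by (rule summable_sums[OF \<alpha>_moment])
  moreover have "(\<Sum>i = 1..n. if i \<le> j then \<alpha> j else 0) \<le> real j * \<alpha> j" for j
  proof -
    have "(\<Sum>i = 1..n. if i \<le> j then \<alpha> j else 0) = (\<Sum>i\<in>{1..n} \<inter> {i. i \<le> j}. \<alpha> j)"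
      by (subst sum.inter_restrict) auto
    also have "\<dots> \<le> (\<Sum>i\<in>{1..j}. \<alpha> j)"
      by (intro sum_mono2) (auto simp: \<alpha>_nonneg)
    finally show ?thesis by simp
  qed
  ultimately show ?thesis by (rule sums_le[rotated 1])
qed

text \<open>The constant \<open>var\<close> is the stationary mean, characterised by
  \<open>\<alpha> 0 = var * (1 - \<alpha>_norm)\<close>. Writing each X as (rate - var) + incr + var
  cancels the baseline except for the kernel mass that reaches before time 1.\<close>

lemma rate_centered:
  assumes "1 \<le> i"
  shows "rate i \<omega> - var = (\<Sum>l = 1..<i. \<alpha> (i - l) * (rate l \<omega> - var))
    + (\<Sum>l = 1..<i. \<alpha> (i - l) * incr l \<omega>) - var * tail i"
proof -
  have "(\<Sum>l = 1..<i. \<alpha> (i - l) * (rate l \<omega> - var)) + (\<Sum>l = 1..<i. \<alpha> (i - l) * incr l \<omega>)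
      = (\<Sum>l = 1..<i. \<alpha> (i - l) * real (X l \<omega>)) - var * (\<Sum>l = 1..<i. \<alpha> (i - l))"
    unfolding incr_def by (simp add: sum_distrib_left algebra_simps flip: sum.distrib sum_subtractf)
  moreover have "(\<Sum>l = 1..<i. \<alpha> (i - l)) = (\<Sum>j = 1..<i. \<alpha> j)"
    using sum_\<alpha>_reverse[where g = "\<lambda>_. 1" and i = i] by simp
  ultimately show ?thesis
    using \<alpha>_0_eq by (simp add: tail_eq[OF assms] hawkes_rate_def[of \<alpha> X i \<omega>] algebra_simps)
qed

section \<open>Conditional moments of the increments and bounds uniform in time\<close>

lemmas ev_diff = Bochner_Integration.integral_diff[OF poly_growth_integrable poly_growth_integrable]
lemmas ev_add = Bochner_Integration.integral_add[OF poly_growth_integrable poly_growth_integrable]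
lemmas ev_mono = integral_mono[OF poly_growth_integrable poly_growth_integrable]

lemma ev_sum: "(\<And>i. i \<in> A \<Longrightarrow> poly_growth (Z i)) \<Longrightarrow>
    expectation (\<lambda>\<omega>. \<Sum>i\<in>A. Z i \<omega>) = (\<Sum>i\<in>A. expectation (Z i))"
  by (intro Bochner_Integration.integral_sum poly_growth_integrable)

lemma ev_abs: "poly_growth Z \<Longrightarrow> \<bar>expectation Z\<bar> \<le> expectation (\<lambda>\<omega>. \<bar>Z \<omega>\<bar>)"
  by (rule integral_abs_bound)

context
  fixes k :: nat and Z :: "'a \<Rightarrow> real"
  assumes k: "k \<ge> 1" and Z: "Z \<in> borel_measurable (past k)" and pZ: "poly_growth Z"
begin

lemma expectation_X_powers:
  shows "expectation (\<lambda>\<omega>. Z \<omega> * real (X k \<omega>)) = expectation (\<lambda>\<omega>. Z \<omega> * rate k \<omega>)"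
    and "expectation (\<lambda>\<omega>. Z \<omega> * real (X k \<omega>) ^ 2) = expectation (\<lambda>\<omega>. Z \<omega> * (rate k \<omega> ^ 2 + rate k \<omega>))"
    and "expectation (\<lambda>\<omega>. Z \<omega> * real (X k \<omega>) ^ 3) = expectation (\<lambda>\<omega>. Z \<omega> * (rate k \<omega> ^ 3 + 3 * rate k \<omega> ^ 2 + rate k \<omega>))"
    and "expectation (\<lambda>\<omega>. Z \<omega> * real (X k \<omega>) ^ 4)
      = expectation (\<lambda>\<omega>. Z \<omega> * (rate k \<omega> ^ 4 + 6 * rate k \<omega> ^ 3 + 7 * rate k \<omega> ^ 2 + rate k \<omega>))"
  by (rule expectation_past[OF k Z pZ, where h = "\<lambda>m. real m"]
      expectation_past[OF k Z pZ, where h = "\<lambda>m. real m ^ 2"]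
      expectation_past[OF k Z pZ, where h = "\<lambda>m. real m ^ 3"]
      expectation_past[OF k Z pZ, where h = "\<lambda>m. real m ^ 4"];
      (intro pois_moments poly_growth_intros k)?; simp)+

end

lemma past_mult_rate_power:
  assumes "Z \<in> borel_measurable (past k)" "poly_growth Z"
  shows "(\<lambda>\<omega>. Z \<omega> * rate k \<omega> ^ p) \<in> borel_measurable (past k)" "poly_growth (\<lambda>\<omega>. Z \<omega> * rate k \<omega> ^ p)"
  using assms by (auto intro!: borel_measurable_times borel_measurable_power rate_measurable_past poly_growth_intros)

text \<open>A Poisson law of mean r has central moments 0, r, r and r + 3 r^2. The binomial
  expansion mixes powers of \<open>rate\<close> and \<open>X\<close>; as \<open>Z\<close> times a
  power of \<open>rate\<close> is still determined by the past, the raw moments apply term by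
  term.\<close>

lemma expectation_incr_powers:
  assumes k: "k \<ge> 1" and Z: "Z \<in> borel_measurable (past k)" "poly_growth Z"
  shows "expectation (\<lambda>\<omega>. Z \<omega> * incr k \<omega>) = 0"
    and "expectation (\<lambda>\<omega>. Z \<omega> * incr k \<omega> ^ 2) = expectation (\<lambda>\<omega>. Z \<omega> * rate k \<omega>)"
    and "expectation (\<lambda>\<omega>. Z \<omega> * incr k \<omega> ^ 3) = expectation (\<lambda>\<omega>. Z \<omega> * rate k \<omega>)"
    and "expectation (\<lambda>\<omega>. Z \<omega> * incr k \<omega> ^ 4) = expectation (\<lambda>\<omega>. Z \<omega> * rate k \<omega>) + 3 * expectation (\<lambda>\<omega>. Z \<omega> * rate k \<omega> ^ 2)"
proof -
  define R where "R p = expectation (\<lambda>\<omega>. Z \<omega> * rate k \<omega> ^ p)" for p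
  define Q where "Q p j = expectation (\<lambda>\<omega>. (Z \<omega> * rate k \<omega> ^ p) * real (X k \<omega>) ^ j)" for p j
  have iR: "integrable M (\<lambda>\<omega>. Z \<omega> * rate k \<omega> ^ p)" for p
    by (intro poly_growth_integrable poly_growth_intros Z)
  have iQ: "integrable M (\<lambda>\<omega>. Z \<omega> * rate k \<omega> ^ p * real (X k \<omega>) ^ j)" for p j
    by (intro poly_growth_integrable poly_growth_intros Z k)
  have Q0: "Q p 0 = R p" for p by (simp add: Q_def R_def)
  have Q1: "Q p 1 = R (p + 1)" for p
    using expectation_X_powers(1)[OF k past_mult_rate_power[OF Z, of p]]
    by (simp add: Q_def R_def ac_simps)
  have Q2: "Q p 2 = R (p + 2) + R (p + 1)" for p
  proof -
    have "Q p 2 = expectation (\<lambda>\<omega>. Z \<omega> * rate k \<omega> ^ (p + 2) + Z \<omega> * rate k \<omega> ^ (p + 1))"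
      unfolding Q_def expectation_X_powers(2)[OF k past_mult_rate_power[OF Z, of p]]
      by (simp add: algebra_simps power_add eval_nat_numeral)
    also have "\<dots> = R (p + 2) + R (p + 1)"
      unfolding R_def by (intro Bochner_Integration.integral_add iR)
    finally show ?thesis .
  qed
  have Q3: "Q p 3 = R (p + 3) + 3 * R (p + 2) + R (p + 1)" for p
  proof -
    have "Q p 3 = expectation (\<lambda>\<omega>. Z \<omega> * rate k \<omega> ^ (p + 3) + 3 * (Z \<omega> * rate k \<omega> ^ (p + 2)) + Z \<omega> * rate k \<omega> ^ (p + 1))"
      unfolding Q_def expectation_X_powers(3)[OF k past_mult_rate_power[OF Z, of p]]
      by (simp add: algebra_simps power_add eval_nat_numeral)
    also have "\<dots> = R (p + 3) + 3 * R (p + 2) + R (p + 1)"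
      unfolding R_def
      by (simp only: Bochner_Integration.integral_add Bochner_Integration.integrable_add integrable_mult_right iR integral_mult_right_zero)
    finally show ?thesis .
  qed
  have Q4: "Q p 4 = R (p + 4) + 6 * R (p + 3) + 7 * R (p + 2) + R (p + 1)" for p
  proof -
    have "Q p 4 = expectation (\<lambda>\<omega>. Z \<omega> * rate k \<omega> ^ (p + 4) + 6 * (Z \<omega> * rate k \<omega> ^ (p + 3)) + 7 * (Z \<omega> * rate k \<omega> ^ (p + 2)) + Z \<omega> * rate k \<omega> ^ (p + 1))"
      unfolding Q_def expectation_X_powers(4)[OF k past_mult_rate_power[OF Z, of p]]
      by (simp add: algebra_simps power_add eval_nat_numeral)
    also have "\<dots> = R (p + 4) + 6 * R (p + 3) + 7 * R (p + 2) + R (p + 1)"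
      unfolding R_def
      by (simp only: Bochner_Integration.integral_add Bochner_Integration.integrable_add integrable_mult_right iR integral_mult_right_zero)
    finally show ?thesis .
  qed
  note lin = Bochner_Integration.integral_add Bochner_Integration.integral_diff Bochner_Integration.integrable_add
    Bochner_Integration.integrable_diff integrable_mult_right iQ integral_mult_right_zero
  have "expectation (\<lambda>\<omega>. Z \<omega> * incr k \<omega>)
      = expectation (\<lambda>\<omega>. Z \<omega> * rate k \<omega> ^ 0 * real (X k \<omega>) ^ 1 - Z \<omega> * rate k \<omega> ^ 1 * real (X k \<omega>) ^ 0)"
    by (simp add: incr_def algebra_simps)
  also have "\<dots> = Q 0 1 - Q 1 0" unfolding Q_def by (simp only: lin)
  finally show "expectation (\<lambda>\<omega>. Z \<omega> * incr k \<omega>) = 0" using Q0[of 1] Q1[of 0] by simp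
  have "expectation (\<lambda>\<omega>. Z \<omega> * incr k \<omega> ^ 2)
      = expectation (\<lambda>\<omega>. Z \<omega> * rate k \<omega> ^ 0 * real (X k \<omega>) ^ 2 - 2 * (Z \<omega> * rate k \<omega> ^ 1 * real (X k \<omega>) ^ 1)
          + Z \<omega> * rate k \<omega> ^ 2 * real (X k \<omega>) ^ 0)"
    by (simp add: incr_def eval_nat_numeral algebra_simps)
  also have "\<dots> = Q 0 2 - 2 * Q 1 1 + Q 2 0" unfolding Q_def by (simp only: lin)
  also have "\<dots> = R 1" using Q0[of 2] Q1[of 1] Q2[of 0] by (simp add: eval_nat_numeral)
  finally show "expectation (\<lambda>\<omega>. Z \<omega> * incr k \<omega> ^ 2) = expectation (\<lambda>\<omega>. Z \<omega> * rate k \<omega>)" by (simp add: R_def)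
  have "expectation (\<lambda>\<omega>. Z \<omega> * incr k \<omega> ^ 3)
      = expectation (\<lambda>\<omega>. Z \<omega> * rate k \<omega> ^ 0 * real (X k \<omega>) ^ 3 - 3 * (Z \<omega> * rate k \<omega> ^ 1 * real (X k \<omega>) ^ 2)
          + 3 * (Z \<omega> * rate k \<omega> ^ 2 * real (X k \<omega>) ^ 1) - Z \<omega> * rate k \<omega> ^ 3 * real (X k \<omega>) ^ 0)"
    by (simp add: incr_def eval_nat_numeral algebra_simps)
  also have "\<dots> = Q 0 3 - 3 * Q 1 2 + 3 * Q 2 1 - Q 3 0" unfolding Q_def by (simp only: lin)
  also have "\<dots> = R 1" using Q0[of 3] Q1[of 2] Q2[of 1] Q3[of 0] by (simp add: eval_nat_numeral)
  finally show "expectation (\<lambda>\<omega>. Z \<omega> * incr k \<omega> ^ 3) = expectation (\<lambda>\<omega>. Z \<omega> * rate k \<omega>)" by (simp add: R_def)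
  have "expectation (\<lambda>\<omega>. Z \<omega> * incr k \<omega> ^ 4)
      = expectation (\<lambda>\<omega>. Z \<omega> * rate k \<omega> ^ 0 * real (X k \<omega>) ^ 4 - 4 * (Z \<omega> * rate k \<omega> ^ 1 * real (X k \<omega>) ^ 3)
          + 6 * (Z \<omega> * rate k \<omega> ^ 2 * real (X k \<omega>) ^ 2) - 4 * (Z \<omega> * rate k \<omega> ^ 3 * real (X k \<omega>) ^ 1)
          + Z \<omega> * rate k \<omega> ^ 4 * real (X k \<omega>) ^ 0)"
    by (simp add: incr_def eval_nat_numeral algebra_simps)
  also have "\<dots> = Q 0 4 - 4 * Q 1 3 + 6 * Q 2 2 - 4 * Q 3 1 + Q 4 0" unfolding Q_def by (simp only: lin)
  also have "\<dots> = R 1 + 3 * R 2" using Q0[of 4] Q1[of 3] Q2[of 2] Q3[of 1] Q4[of 0] by (simp add: eval_nat_numeral)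
  finally show "expectation (\<lambda>\<omega>. Z \<omega> * incr k \<omega> ^ 4) = expectation (\<lambda>\<omega>. Z \<omega> * rate k \<omega>) + 3 * expectation (\<lambda>\<omega>. Z \<omega> * rate k \<omega> ^ 2)"
    by (simp add: R_def)
qed

lemma expectation_rate_le_1: "expectation (rate k) \<le> 1"
proof (induction k rule: less_induct)
  case (less k)
  have X: "expectation (\<lambda>\<omega>. real (X i \<omega>)) \<le> 1" if "i \<in> {1..<k}" for i
    using expectation_X_powers(1)[of i "\<lambda>_. 1"] that less[of i] by (simp add: poly_growth_const)
  have "expectation (rate k) = \<alpha> 0 + (\<Sum>i = 1..<k. \<alpha> (k - i) * expectation (\<lambda>\<omega>. real (X i \<omega>)))"
  proof -
    have "expectation (rate k) = expectation (\<lambda>_. \<alpha> 0) + expectation (\<lambda>\<omega>. \<Sum>i = 1..<k. \<alpha> (k - i) * real (X i \<omega>))"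
      unfolding hawkes_rate_def[abs_def] by (intro ev_add poly_growth_intros) auto
    also have "expectation (\<lambda>\<omega>. \<Sum>i = 1..<k. \<alpha> (k - i) * real (X i \<omega>)) = (\<Sum>i = 1..<k. expectation (\<lambda>\<omega>. \<alpha> (k - i) * real (X i \<omega>)))"
      by (intro ev_sum poly_growth_intros) auto
    finally show ?thesis by (simp add: prob_space)
  qed
  also have "\<dots> \<le> \<alpha> 0 + (\<Sum>i = 1..<k. \<alpha> (k - i) * 1)"
    by (intro add_left_mono sum_mono mult_left_mono X \<alpha>_nonneg) auto
  also have "\<dots> \<le> 1" using sum_\<alpha>_past_le[of k] \<alpha>_norm_eq \<alpha>_less_1 by simp
  finally show ?case .
qed

text \<open>The rate is a weighted sum of total weight at most q < 1, so by Cauchy-Schwarz its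
  square is at most q times the weighted sum of squares, and E[X^2] = E[rate^2] + E[rate] <= K + 1.
  The recursion closes because q (q (K + 1)) <= q K + 1 = K.\<close>

lemma expectation_rate_sq_le: "expectation (\<lambda>\<omega>. rate k \<omega> ^ 2) \<le> K"
proof (induction k rule: less_induct)
  case (less k)
  let ?q = "\<Sum>k. \<alpha> k"
  have q0: "0 \<le> ?q" by (intro suminf_nonneg \<alpha>_summable \<alpha>_nonneg)
  have X: "expectation (\<lambda>\<omega>. real (X i \<omega>) ^ 2) \<le> K + 1" if i: "i \<in> {1..<k}" for i
  proof -
    have "expectation (\<lambda>\<omega>. real (X i \<omega>) ^ 2) = expectation (\<lambda>\<omega>. rate i \<omega> ^ 2 + rate i \<omega>)"
      using expectation_X_powers(2)[of i "\<lambda>_. 1"] i by (simp add: poly_growth_const)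
    also have "\<dots> = expectation (\<lambda>\<omega>. rate i \<omega> ^ 2) + expectation (rate i)"
      by (intro ev_add poly_growth_intros)
    finally show ?thesis using less[of i] i expectation_rate_le_1[of i] by simp
  qed
  have wsum: "\<alpha> 0 + (\<Sum>i = 1..<k. \<alpha> (k - i)) \<le> ?q" using sum_\<alpha>_past_le[of k] \<alpha>_norm_eq by simp
  have "rate k \<omega> ^ 2 \<le> ?q * (\<alpha> 0 + (\<Sum>i = 1..<k. \<alpha> (k - i) * real (X i \<omega>) ^ 2))" for \<omega>
  proof -
    \<comment> \<open>Index 0 carries the baseline, with weight \<open>\<alpha> 0\<close> and value
      1, so that the whole rate is one weighted sum.\<close>
    define w where "w i = (if i = 0 then \<alpha> 0 else \<alpha> (k - i))" for i
    define y where "y i = (if i = 0 then 1 else real (X i \<omega>))" for i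
    have split: "(\<Sum>i\<in>insert 0 {1..<k}. g i) = g 0 + (\<Sum>i = 1..<k. g i)" for g :: "nat \<Rightarrow> real"
      by (subst sum.insert) auto
    have "rate k \<omega> = (\<Sum>i\<in>insert 0 {1..<k}. w i * y i)"
      unfolding split hawkes_rate_def by (auto simp: w_def y_def intro!: sum.cong)
    then have "rate k \<omega> ^ 2 \<le> (\<Sum>i\<in>insert 0 {1..<k}. w i) * (\<Sum>i\<in>insert 0 {1..<k}. w i * (y i)\<^sup>2)"
      using weighted_cauchy_schwarz[of "insert 0 {1..<k}" w y] by (simp add: w_def \<alpha>_nonneg)
    also have "(\<Sum>i\<in>insert 0 {1..<k}. w i) = \<alpha> 0 + (\<Sum>i = 1..<k. \<alpha> (k - i))"
      unfolding split by (auto simp: w_def intro!: sum.cong)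
    also have "(\<Sum>i\<in>insert 0 {1..<k}. w i * (y i)\<^sup>2) = \<alpha> 0 + (\<Sum>i = 1..<k. \<alpha> (k - i) * real (X i \<omega>) ^ 2)"
      unfolding split by (auto simp: w_def y_def intro!: sum.cong)
    also have "(\<alpha> 0 + (\<Sum>i = 1..<k. \<alpha> (k - i))) * (\<alpha> 0 + (\<Sum>i = 1..<k. \<alpha> (k - i) * real (X i \<omega>) ^ 2))
       \<le> ?q * (\<alpha> 0 + (\<Sum>i = 1..<k. \<alpha> (k - i) * real (X i \<omega>) ^ 2))"
      by (intro mult_right_mono wsum add_nonneg_nonneg sum_nonneg mult_nonneg_nonneg \<alpha>_nonneg) auto
    finally show ?thesis .
  qed
  then have "expectation (\<lambda>\<omega>. rate k \<omega> ^ 2) \<le> expectation (\<lambda>\<omega>. ?q * (\<alpha> 0 + (\<Sum>i = 1..<k. \<alpha> (k - i) * real (X i \<omega>) ^ 2)))"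
    by (intro ev_mono poly_growth_intros) auto
  also have "\<dots> = ?q * (\<alpha> 0 + (\<Sum>i = 1..<k. \<alpha> (k - i) * expectation (\<lambda>\<omega>. real (X i \<omega>) ^ 2)))"
  proof -
    have "expectation (\<lambda>\<omega>. \<alpha> 0 + (\<Sum>i = 1..<k. \<alpha> (k - i) * real (X i \<omega>) ^ 2))
        = expectation (\<lambda>_. \<alpha> 0) + expectation (\<lambda>\<omega>. \<Sum>i = 1..<k. \<alpha> (k - i) * real (X i \<omega>) ^ 2)"
      by (intro ev_add poly_growth_intros) auto
    also have "expectation (\<lambda>\<omega>. \<Sum>i = 1..<k. \<alpha> (k - i) * real (X i \<omega>) ^ 2)
        = (\<Sum>i = 1..<k. expectation (\<lambda>\<omega>. \<alpha> (k - i) * real (X i \<omega>) ^ 2))"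
      by (intro ev_sum poly_growth_intros) auto
    finally show ?thesis by (simp add: prob_space)
  qed
  also have "\<dots> \<le> ?q * (\<alpha> 0 * (K + 1) + (\<Sum>i = 1..<k. \<alpha> (k - i) * (K + 1)))"
    using K_ge_1 \<alpha>_nonneg[of 0] mult_left_mono[of 1 "K + 1" "\<alpha> 0"]
    by (intro mult_left_mono add_mono sum_mono X \<alpha>_nonneg q0) auto
  also have "\<dots> = ?q * ((\<alpha> 0 + (\<Sum>i = 1..<k. \<alpha> (k - i))) * (K + 1))"
    by (simp only: distrib_right sum_distrib_right)
  also have "\<dots> \<le> ?q * (?q * (K + 1))"
    using wsum K_ge_1 q0 by (intro mult_left_mono mult_right_mono) auto
  also have "\<dots> \<le> ?q * K + 1"
  proof -
    have "?q * (K + 1) \<le> K" using K_eq \<alpha>_less_1 by (simp add: algebra_simps)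
    then have "?q * (?q * (K + 1)) \<le> ?q * K" using q0 by (rule mult_left_mono)
    then show ?thesis by simp
  qed
  also have "\<dots> = K" using K_eq by simp
  finally show ?case .
qed

lemma expectation_incr_sq_le: "k \<ge> 1 \<Longrightarrow> expectation (\<lambda>\<omega>. incr k \<omega> ^ 2) \<le> 1"
  using expectation_incr_powers(2)[of k "\<lambda>_. 1"] expectation_rate_le_1[of k] by (simp add: poly_growth_const)

lemma expectation_incr_4_le: "k \<ge> 1 \<Longrightarrow> expectation (\<lambda>\<omega>. incr k \<omega> ^ 4) \<le> 4 * K"
  using expectation_incr_powers(4)[of k "\<lambda>_. 1"] expectation_rate_le_1[of k] expectation_rate_sq_le[of k] K_ge_1
  by (simp add: poly_growth_const)

lemma expectation_rate_centered_sq_le: "expectation (\<lambda>\<omega>. (rate k \<omega> - var) ^ 2) \<le> 2 * K"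
proof -
  have "expectation (\<lambda>\<omega>. (rate k \<omega> - var) ^ 2) \<le> expectation (\<lambda>\<omega>. rate k \<omega> ^ 2 + 1)"
  proof (intro ev_mono poly_growth_intros)
    fix \<omega>
    have "0 \<le> var * rate k \<omega>" using var_pos rate_pos[of k \<omega>] by simp
    moreover have "var\<^sup>2 \<le> 1" using var_pos var_le_1 by (simp add: power_le_one)
    ultimately show "(rate k \<omega> - var) ^ 2 \<le> rate k \<omega> ^ 2 + 1" by (simp add: power2_diff mult.commute)
  qed
  also have "\<dots> = expectation (\<lambda>\<omega>. rate k \<omega> ^ 2) + expectation (\<lambda>_. 1)"
    by (intro ev_add poly_growth_intros)
  also have "\<dots> \<le> 2 * K" using expectation_rate_sq_le[of k] K_ge_1 by (simp add: prob_space)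
  finally show ?thesis .
qed

text \<open>The inequality 2ab <= a^2 + b^2 under the expectation. Compared with Cauchy-Schwarz it
  keeps later bounds linear in the second moments, without square roots.\<close>

lemma expectation_abs_mult_le:
  assumes "poly_growth Y" "poly_growth Z" "expectation (\<lambda>\<omega>. Y \<omega> ^ 2) \<le> A" "expectation (\<lambda>\<omega>. Z \<omega> ^ 2) \<le> B"
  shows "expectation (\<lambda>\<omega>. \<bar>Y \<omega>\<bar> * \<bar>Z \<omega>\<bar>) \<le> (A + B) / 2"
proof -
  have "expectation (\<lambda>\<omega>. \<bar>Y \<omega>\<bar> * \<bar>Z \<omega>\<bar>) \<le> expectation (\<lambda>\<omega>. (1/2) * (Y \<omega> ^ 2 + Z \<omega> ^ 2))"
  proof (intro ev_mono poly_growth_intros assms)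
    fix \<omega>
    show "\<bar>Y \<omega>\<bar> * \<bar>Z \<omega>\<bar> \<le> (1/2) * (Y \<omega> ^ 2 + Z \<omega> ^ 2)"
      using sum_squares_bound[of "\<bar>Y \<omega>\<bar>" "\<bar>Z \<omega>\<bar>"] by simp
  qed
  also have "\<dots> = (1/2) * (expectation (\<lambda>\<omega>. Y \<omega> ^ 2) + expectation (\<lambda>\<omega>. Z \<omega> ^ 2))"
    by (subst integral_mult_right_zero, subst ev_add) (intro poly_growth_intros assms refl)+
  finally show ?thesis using assms by simp
qed

text \<open>The third absolute moment is interpolated between the second and the fourth: with the
  factors \<open>incr k ^ 2\<close> and \<open>incr k\<close> the bound is (4K + 1)/2, and K >=
  1.\<close>

lemma expectation_incr_abs_3_le:
  assumes "k \<ge> 1" shows "expectation (\<lambda>\<omega>. incr k \<omega> ^ 2 * \<bar>incr k \<omega>\<bar>) \<le> 5 * K / 2"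
proof -
  have "expectation (\<lambda>\<omega>. (incr k \<omega> ^ 2) ^ 2) \<le> 4 * K"
    using expectation_incr_4_le[OF assms] by (simp flip: power_mult)
  from expectation_abs_mult_le[OF _ _ this expectation_incr_sq_le[OF assms]]
  show ?thesis using K_ge_1 assms by (simp add: poly_growth_intros)
qed

lemma mart_Suc: "mart (Suc n) \<omega> = mart n \<omega> + incr (Suc n) \<omega>"
  by (simp add: mart_def)

text \<open>Orthogonality of the increments after time m, where the conditional variance of each
  increment is its rate. The weight \<open>Z\<close> may depend on X_1, ..., X_m, which generate
  \<open>past (Suc m)\<close>; through it centred rates and earlier increments can later enter as
  factors.\<close>

lemma expectation_mart_diff:
  assumes Z: "Z \<in> borel_measurable (past (Suc m))" "poly_growth Z" and mn: "m \<le> n"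
  shows "expectation (\<lambda>\<omega>. Z \<omega> * (mart n \<omega> - mart m \<omega>)) = 0"
    and "expectation (\<lambda>\<omega>. Z \<omega> * (mart n \<omega> - mart m \<omega>) ^ 2) = (\<Sum>j = Suc m..n. expectation (\<lambda>\<omega>. Z \<omega> * rate j \<omega>))"
proof -
  have ZS: "Z \<in> borel_measurable (past (Suc k))" if "m \<le> k" for k
    using measurable_past_mono[OF Z(1)] that by simp
  note pg = poly_growth_intros Z(2)
  show "expectation (\<lambda>\<omega>. Z \<omega> * (mart n \<omega> - mart m \<omega>)) = 0"
    using mn
  proof (induction n rule: dec_induct)
    case (step k)
    have "expectation (\<lambda>\<omega>. Z \<omega> * (mart (Suc k) \<omega> - mart m \<omega>))
      = expectation (\<lambda>\<omega>. Z \<omega> * (mart k \<omega> - mart m \<omega>) + Z \<omega> * incr (Suc k) \<omega>)"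
      by (simp add: mart_Suc algebra_simps)
    also have "\<dots> = 0 + 0"
      using step.IH expectation_incr_powers(1)[OF _ ZS[OF step.hyps(1)] Z(2)]
      by (subst ev_add) (auto intro!: pg)
    finally show ?case by simp
  qed simp
  show "expectation (\<lambda>\<omega>. Z \<omega> * (mart n \<omega> - mart m \<omega>) ^ 2) = (\<Sum>j = Suc m..n. expectation (\<lambda>\<omega>. Z \<omega> * rate j \<omega>))"
    using mn
  proof (induction n rule: dec_induct)
    case (step k)
    \<comment> \<open>The cross term is a weight known from the past times the next increment, so
      its expectation vanishes.\<close>
    let ?W = "\<lambda>\<omega>. 2 * Z \<omega> * (mart k \<omega> - mart m \<omega>)"
    have W: "?W \<in> borel_measurable (past (Suc k))"
      using step.hyps by (intro borel_measurable_times borel_measurable_diff borel_measurable_const ZS mart_measurable_past) auto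
    have pW: "poly_growth ?W" by (intro pg)
    have "expectation (\<lambda>\<omega>. Z \<omega> * (mart (Suc k) \<omega> - mart m \<omega>) ^ 2)
      = expectation (\<lambda>\<omega>. Z \<omega> * (mart k \<omega> - mart m \<omega>) ^ 2 + (?W \<omega> * incr (Suc k) \<omega> + Z \<omega> * incr (Suc k) \<omega> ^ 2))"
      by (simp add: mart_Suc algebra_simps power2_eq_square)
    also have "\<dots> = expectation (\<lambda>\<omega>. Z \<omega> * (mart k \<omega> - mart m \<omega>) ^ 2)
        + (expectation (\<lambda>\<omega>. ?W \<omega> * incr (Suc k) \<omega>) + expectation (\<lambda>\<omega>. Z \<omega> * incr (Suc k) \<omega> ^ 2))"
      by (subst ev_add, (intro pg; simp)+, subst ev_add, (intro pg; simp)+, rule refl)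
    also have "\<dots> = (\<Sum>j = Suc m..k. expectation (\<lambda>\<omega>. Z \<omega> * rate j \<omega>)) + expectation (\<lambda>\<omega>. Z \<omega> * rate (Suc k) \<omega>)"
      using step.IH expectation_incr_powers(1)[OF _ W pW] expectation_incr_powers(2)[OF _ ZS[OF step.hyps(1)] Z(2)] by simp
    also have "\<dots> = (\<Sum>j = Suc m..Suc k. expectation (\<lambda>\<omega>. Z \<omega> * rate j \<omega>))"
      using step.hyps by simp
    finally show ?case .
  qed simp
qed

lemma expectation_mart_diff_sq_le:
  assumes "m \<le> n" shows "expectation (\<lambda>\<omega>. (mart n \<omega> - mart m \<omega>) ^ 2) \<le> real (n - m)"
proof -
  have "expectation (\<lambda>\<omega>. (mart n \<omega> - mart m \<omega>) ^ 2) = (\<Sum>j = Suc m..n. expectation (rate j))"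
    using expectation_mart_diff(2)[of "\<lambda>_. 1" m n] assms by (simp add: poly_growth_const)
  also have "\<dots> \<le> (\<Sum>j = Suc m..n. 1)" by (intro sum_mono expectation_rate_le_1)
  finally show ?thesis by (simp add: of_nat_diff assms)
qed

section \<open>Renewal inequalities and the exchange of one increment\<close>

text \<open>The martingale is taken at time i - 1 so that both factors are known before
  \<open>X i\<close>. With the absolute value, the renewal inequalities relate nonnegative
  numbers.\<close>

definition dev :: "(real \<Rightarrow> real) \<Rightarrow> nat \<Rightarrow> real" where
  "dev \<phi> i = \<bar>expectation (\<lambda>\<omega>. \<phi> (mart (i - 1) \<omega>) * (rate i \<omega> - var))\<bar>"

lemma lipschitz_mart_measurable_past:
  fixes \<phi> :: "real \<Rightarrow> real"
  assumes "L-lipschitz_on UNIV \<phi>" "m < k"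
  shows "(\<lambda>\<omega>. \<phi> (mart m \<omega>)) \<in> borel_measurable (past k)"
  using measurable_compose[OF mart_measurable_past[OF assms(2)] lipschitz_borel[OF assms(1)]] .

text \<open>Common core of the two renewal inequalities: the identity for the centred rate is
  multiplied by \<open>\<phi> (mart (i - 1) \<omega>)\<close> and averaged. The two versions differ
  only in \<open>p\<close> and \<open>q\<close>, the bounds obtained when the test function is moved
  back to time l - 1.\<close>

lemma dev_expand:
  assumes L: "L-lipschitz_on UNIV \<phi>" and B: "\<And>x. \<bar>\<phi> x\<bar> \<le> B" and i: "1 \<le> i"
    and p: "\<And>l. 1 \<le> l \<Longrightarrow> l < i \<Longrightarrow> \<bar>expectation (\<lambda>\<omega>. \<phi> (mart (i - 1) \<omega>) * (rate l \<omega> - var))\<bar> \<le> p l"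
    and q: "\<And>l. 1 \<le> l \<Longrightarrow> l < i \<Longrightarrow> \<bar>expectation (\<lambda>\<omega>. \<phi> (mart (i - 1) \<omega>) * incr l \<omega>)\<bar> \<le> q l"
  shows "dev \<phi> i \<le> (\<Sum>l = 1..<i. \<alpha> (i - l) * (p l + q l)) + B * tail i"
proof -
  let ?P = "\<lambda>\<omega>. \<phi> (mart (i - 1) \<omega>)"
  have P: "poly_growth ?P" by (rule poly_growth_lipschitz[OF L poly_growth_mart])
  note pg = poly_growth_intros P
  have "expectation (\<lambda>\<omega>. ?P \<omega> * (rate i \<omega> - var))
    = expectation (\<lambda>\<omega>. ((\<Sum>l = 1..<i. \<alpha> (i - l) * (?P \<omega> * (rate l \<omega> - var)))
        + (\<Sum>l = 1..<i. \<alpha> (i - l) * (?P \<omega> * incr l \<omega>))) - (var * tail i) * ?P \<omega>)"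
    unfolding rate_centered[OF i] by (simp add: algebra_simps sum_distrib_left)
  also have "\<dots> = (expectation (\<lambda>\<omega>. \<Sum>l = 1..<i. \<alpha> (i - l) * (?P \<omega> * (rate l \<omega> - var)))
        + expectation (\<lambda>\<omega>. \<Sum>l = 1..<i. \<alpha> (i - l) * (?P \<omega> * incr l \<omega>))) - expectation (\<lambda>\<omega>. (var * tail i) * ?P \<omega>)"
    by (subst ev_diff, (intro pg; simp)+, subst ev_add, (intro pg; simp)+, rule refl)
  also have "\<dots> = (\<Sum>l = 1..<i. \<alpha> (i - l) * (expectation (\<lambda>\<omega>. ?P \<omega> * (rate l \<omega> - var)) + expectation (\<lambda>\<omega>. ?P \<omega> * incr l \<omega>)))
        - var * tail i * expectation ?P"
    by (subst ev_sum, (intro pg; simp)+, subst ev_sum, (intro pg; simp)+, simp only: integral_mult_right_zero distrib_left sum.distrib)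
  finally have "dev \<phi> i = \<bar>(\<Sum>l = 1..<i. \<alpha> (i - l) * (expectation (\<lambda>\<omega>. ?P \<omega> * (rate l \<omega> - var)) + expectation (\<lambda>\<omega>. ?P \<omega> * incr l \<omega>)))
        - var * tail i * expectation ?P\<bar>" by (simp add: dev_def)
  also have "\<dots> \<le> \<bar>\<Sum>l = 1..<i. \<alpha> (i - l) * (expectation (\<lambda>\<omega>. ?P \<omega> * (rate l \<omega> - var)) + expectation (\<lambda>\<omega>. ?P \<omega> * incr l \<omega>))\<bar>
        + \<bar>var * tail i * expectation ?P\<bar>" by (rule abs_triangle_ineq4)
  also have "\<dots> \<le> (\<Sum>l = 1..<i. \<alpha> (i - l) * (p l + q l)) + B * tail i"
  proof (rule add_mono)
    show "\<bar>\<Sum>l = 1..<i. \<alpha> (i - l) * (expectation (\<lambda>\<omega>. ?P \<omega> * (rate l \<omega> - var)) + expectation (\<lambda>\<omega>. ?P \<omega> * incr l \<omega>))\<bar>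
      \<le> (\<Sum>l = 1..<i. \<alpha> (i - l) * (p l + q l))"
    proof (rule order_trans[OF sum_abs sum_mono])
      fix l assume "l \<in> {1..<i}"
      then have "\<bar>expectation (\<lambda>\<omega>. ?P \<omega> * (rate l \<omega> - var)) + expectation (\<lambda>\<omega>. ?P \<omega> * incr l \<omega>)\<bar> \<le> p l + q l"
        using p[of l] q[of l] by (auto intro: order_trans[OF abs_triangle_ineq add_mono])
      then show "\<bar>\<alpha> (i - l) * (expectation (\<lambda>\<omega>. ?P \<omega> * (rate l \<omega> - var)) + expectation (\<lambda>\<omega>. ?P \<omega> * incr l \<omega>))\<bar> \<le> \<alpha> (i - l) * (p l + q l)"
        by (simp add: abs_mult \<alpha>_nonneg mult_left_mono)
    qed
    have "\<bar>expectation ?P\<bar> \<le> expectation (\<lambda>\<omega>. \<bar>?P \<omega>\<bar>)" by (rule ev_abs[OF P])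
    also have "\<dots> \<le> expectation (\<lambda>_. B)" by (intro ev_mono pg B)
    finally have "\<bar>expectation ?P\<bar> \<le> B" by (simp add: prob_space)
    then have "(var * tail i) * \<bar>expectation ?P\<bar> \<le> (1 * tail i) * B"
      using var_pos var_le_1 tail_nonneg[of i] by (intro mult_mono mult_right_mono) auto
    then show "\<bar>var * tail i * expectation ?P\<bar> \<le> B * tail i"
      using var_pos tail_nonneg[of i] by (simp add: abs_mult mult.commute)
  qed
  finally show ?thesis .
qed

text \<open>Moving \<open>\<phi>\<close> back from time i - 1 to l - 1 costs at most a multiple of i
  - l, which the weights \<open>\<alpha> (i - l)\<close> turn into \<open>\<mu>\<close>; at time l -
  1 the increment averages to zero. A Lipschitz \<open>\<phi>\<close> suffices, which suits the
  third derivative: its Lipschitz constants are summable over k.\<close>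

lemma dev_first_order:
  assumes L: "L-lipschitz_on UNIV \<phi>" and B: "\<And>x. \<bar>\<phi> x\<bar> \<le> B" and i: "1 \<le> i"
  shows "dev \<phi> i \<le> (\<Sum>l = 1..<i. \<alpha> (i - l) * dev \<phi> l) + (4 * K * \<mu> * L + B * tail i)"
proof -
  have L0: "0 \<le> L" by (rule lipschitz_on_nonneg[OF L])
  let ?P = "\<lambda>m \<omega>. \<phi> (mart m \<omega>)"
  have P: "poly_growth (?P m)" for m by (rule poly_growth_lipschitz[OF L poly_growth_mart])
  note pg = poly_growth_intros P
  have shift: "\<bar>expectation (\<lambda>\<omega>. ?P (i - 1) \<omega> * Z \<omega>) - expectation (\<lambda>\<omega>. ?P (l - 1) \<omega> * Z \<omega>)\<bar> \<le> 2 * K * L * real (i - l)"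
    if l: "1 \<le> l" "l < i" and Z: "poly_growth Z" "expectation (\<lambda>\<omega>. Z \<omega> ^ 2) \<le> 2 * K" for l Z
  proof -
    have "\<bar>expectation (\<lambda>\<omega>. ?P (i - 1) \<omega> * Z \<omega>) - expectation (\<lambda>\<omega>. ?P (l - 1) \<omega> * Z \<omega>)\<bar>
      = \<bar>expectation (\<lambda>\<omega>. ?P (i - 1) \<omega> * Z \<omega> - ?P (l - 1) \<omega> * Z \<omega>)\<bar>"
      by (subst ev_diff) (intro pg Z refl)+
    also have "\<dots> \<le> expectation (\<lambda>\<omega>. \<bar>?P (i - 1) \<omega> * Z \<omega> - ?P (l - 1) \<omega> * Z \<omega>\<bar>)"
      by (intro ev_abs pg Z)
    also have "\<dots> \<le> expectation (\<lambda>\<omega>. L * (\<bar>mart (i - 1) \<omega> - mart (l - 1) \<omega>\<bar> * \<bar>Z \<omega>\<bar>))"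
    proof (intro ev_mono pg Z)
      fix \<omega>
      have "\<bar>?P (i - 1) \<omega> * Z \<omega> - ?P (l - 1) \<omega> * Z \<omega>\<bar> = \<bar>?P (i - 1) \<omega> - ?P (l - 1) \<omega>\<bar> * \<bar>Z \<omega>\<bar>"
        by (simp flip: abs_mult left_diff_distrib)
      also have "\<dots> \<le> (L * \<bar>mart (i - 1) \<omega> - mart (l - 1) \<omega>\<bar>) * \<bar>Z \<omega>\<bar>"
        by (intro mult_right_mono lipschitz_abs_le L) auto
      finally show "\<bar>?P (i - 1) \<omega> * Z \<omega> - ?P (l - 1) \<omega> * Z \<omega>\<bar> \<le> L * (\<bar>mart (i - 1) \<omega> - mart (l - 1) \<omega>\<bar> * \<bar>Z \<omega>\<bar>)"
        by (simp add: mult.assoc)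
    qed
    also have "\<dots> = L * expectation (\<lambda>\<omega>. \<bar>mart (i - 1) \<omega> - mart (l - 1) \<omega>\<bar> * \<bar>Z \<omega>\<bar>)" by simp
    also have "\<dots> \<le> L * ((real (i - 1 - (l - 1)) + 2 * K) / 2)"
      using l by (intro mult_left_mono L0 expectation_abs_mult_le pg Z expectation_mart_diff_sq_le) auto
    also have "\<dots> \<le> L * (2 * K * real (i - l))"
    proof (intro mult_left_mono L0)
      have aux: "r \<le> p \<Longrightarrow> K \<le> p \<Longrightarrow> (r + 2 * K) / 2 \<le> 2 * p" for r p :: real
        using K_ge_1 by simp
      have 1: "1 \<le> real (i - l)" using l by simp
      have "real (i - l) \<le> K * real (i - l)" "K \<le> K * real (i - l)"
        using K_ge_1 1 mult_right_mono[of 1 K "real (i - l)"] mult_left_mono[OF 1, of K] by auto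
      moreover have e: "i - 1 - (l - 1) = i - l" using l by simp
      ultimately show "(real (i - 1 - (l - 1)) + 2 * K) / 2 \<le> 2 * K * real (i - l)" unfolding e mult.assoc using aux by blast
    qed
    finally show ?thesis by (simp add: ac_simps)
  qed
  have "dev \<phi> i \<le> (\<Sum>l = 1..<i. \<alpha> (i - l) * ((dev \<phi> l + 2 * K * L * real (i - l)) + 2 * K * L * real (i - l))) + B * tail i"
  proof (rule dev_expand[OF L B i])
    fix l assume l: "1 \<le> l" "l < i"
    show "\<bar>expectation (\<lambda>\<omega>. ?P (i - 1) \<omega> * (rate l \<omega> - var))\<bar> \<le> dev \<phi> l + 2 * K * L * real (i - l)"
      using shift[OF l poly_growth_diff[OF poly_growth_rate poly_growth_const] expectation_rate_centered_sq_le[of l]]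
      unfolding dev_def by linarith
    have "expectation (\<lambda>\<omega>. ?P (l - 1) \<omega> * incr l \<omega>) = 0"
      using l by (intro expectation_incr_powers(1) pg lipschitz_mart_measurable_past[OF L]) auto
    then show "\<bar>expectation (\<lambda>\<omega>. ?P (i - 1) \<omega> * incr l \<omega>)\<bar> \<le> 2 * K * L * real (i - l)"
      using shift[OF l, of "incr l"] expectation_incr_sq_le[of l] K_ge_1 l by (auto simp: poly_growth_intros)
  qed
  also have "\<dots> = (\<Sum>l = 1..<i. \<alpha> (i - l) * dev \<phi> l) + (4 * K * L) * (\<Sum>l = 1..<i. \<alpha> (i - l) * real (i - l)) + B * tail i"
    by (simp add: sum.distrib sum_subtractf sum_distrib_left algebra_simps)
  also have "\<dots> \<le> (\<Sum>l = 1..<i. \<alpha> (i - l) * dev \<phi> l) + (4 * K * L) * \<mu> + B * tail i"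
    using K_ge_1 L0 by (intro add_right_mono add_left_mono mult_left_mono sum_\<alpha>_moment_le) auto
  finally show ?thesis by (simp add: ac_simps)
qed

lemma expectation_rate_mult_le:
  assumes "poly_growth Z" "expectation (\<lambda>\<omega>. Z \<omega> ^ 2) \<le> 2 * K"
  shows "expectation (\<lambda>\<omega>. \<bar>Z \<omega>\<bar> * rate j \<omega>) \<le> 2 * K"
proof -
  have "expectation (\<lambda>\<omega>. \<bar>Z \<omega>\<bar> * \<bar>rate j \<omega>\<bar>) \<le> (2 * K + K) / 2"
    by (intro expectation_abs_mult_le poly_growth_intros assms expectation_rate_sq_le)
  then show ?thesis using K_ge_1 rate_pos by (simp add: less_imp_le)
qed

text \<open>For the second derivative, Lipschitz errors of order 1/T_k would sum to a logarithm, so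
  one more order is expanded. The linear term vanishes against the centred rate, which is known
  before the martingale moves; against the increment it leaves E[phi' incr^2] = E[phi' rate], the
  new source. The remainder carries the Lipschitz constant of \<open>\<phi>'\<close>, and 9 = 2 + 7
  collects its two parts.\<close>

lemma dev_second_order:
  assumes D: "\<And>x. (\<phi> has_real_derivative \<phi>' x) (at x)"
    and L': "L-lipschitz_on UNIV \<phi>'" and B': "\<And>x. \<bar>\<phi>' x\<bar> \<le> B'"
    and B: "\<And>x. \<bar>\<phi> x\<bar> \<le> B" and i: "1 \<le> i"
  shows "dev \<phi> i \<le> (\<Sum>l = 1..<i. \<alpha> (i - l) * dev \<phi> l)
    + ((\<Sum>l = 1..<i. \<alpha> (i - l) * \<bar>expectation (\<lambda>\<omega>. \<phi>' (mart (l - 1) \<omega>) * rate l \<omega>)\<bar>) + 9 * K * \<mu> * L + B * tail i)"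
proof -
  have L: "B'-lipschitz_on UNIV \<phi>" by (rule derivative_bound_lipschitz[OF D B'])
  have L0: "0 \<le> L" by (rule lipschitz_on_nonneg[OF L'])
  let ?P = "\<lambda>m \<omega>. \<phi> (mart m \<omega>)" and ?P' = "\<lambda>m \<omega>. \<phi>' (mart m \<omega>)"
  have P: "poly_growth (?P m)" "poly_growth (?P' m)" for m
    by (rule poly_growth_lipschitz[OF L poly_growth_mart] poly_growth_lipschitz[OF L' poly_growth_mart])+
  note pg = poly_growth_intros P
  have expand: "\<bar>expectation (\<lambda>\<omega>. ?P (i - 1) \<omega> * Z \<omega>) - expectation (\<lambda>\<omega>. ?P (l - 1) \<omega> * Z \<omega>)
      - expectation (\<lambda>\<omega>. (?P' (l - 1) \<omega> * Z \<omega>) * (mart (i - 1) \<omega> - mart (l - 1) \<omega>))\<bar>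
      \<le> L * expectation (\<lambda>\<omega>. \<bar>Z \<omega>\<bar> * (mart (i - 1) \<omega> - mart (l - 1) \<omega>) ^ 2)"
    if l: "1 \<le> l" "l < i" and Z: "poly_growth Z" for l Z
  proof -
    let ?R = "\<lambda>\<omega>. ?P (i - 1) \<omega> * Z \<omega> - ?P (l - 1) \<omega> * Z \<omega> - (?P' (l - 1) \<omega> * Z \<omega>) * (mart (i - 1) \<omega> - mart (l - 1) \<omega>)"
    have e: "expectation (\<lambda>\<omega>. ?P (i - 1) \<omega> * Z \<omega>) - expectation (\<lambda>\<omega>. ?P (l - 1) \<omega> * Z \<omega>)
      - expectation (\<lambda>\<omega>. (?P' (l - 1) \<omega> * Z \<omega>) * (mart (i - 1) \<omega> - mart (l - 1) \<omega>)) = expectation ?R"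
      by (subst ev_diff, (intro pg Z; simp)+, subst ev_diff, (intro pg Z; simp)+, rule refl)
    have a: "\<bar>expectation ?R\<bar> \<le> expectation (\<lambda>\<omega>. \<bar>?R \<omega>\<bar>)" by (intro ev_abs pg Z)
    have b: "expectation (\<lambda>\<omega>. \<bar>?R \<omega>\<bar>) \<le> expectation (\<lambda>\<omega>. L * (\<bar>Z \<omega>\<bar> * (mart (i - 1) \<omega> - mart (l - 1) \<omega>) ^ 2))"
    proof (intro ev_mono pg Z)
      fix \<omega>
      let ?x = "mart (l - 1) \<omega>" and ?y = "mart (i - 1) \<omega>"
      have "?R \<omega> = (\<phi> ?y - \<phi> ?x - \<phi>' ?x * (?y - ?x)) * Z \<omega>" by (simp add: algebra_simps)
      then have "\<bar>?R \<omega>\<bar> = \<bar>\<phi> ?y - \<phi> ?x - \<phi>' ?x * (?y - ?x)\<bar> * \<bar>Z \<omega>\<bar>" by (simp add: abs_mult)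
      also have "\<dots> \<le> (L * (?y - ?x)\<^sup>2) * \<bar>Z \<omega>\<bar>"
        by (intro mult_right_mono first_order_expansion[OF D L']) auto
      finally show "\<bar>?R \<omega>\<bar> \<le> L * (\<bar>Z \<omega>\<bar> * (?y - ?x) ^ 2)" by (simp add: ac_simps)
    qed
    show ?thesis unfolding e using order_trans[OF a b] unfolding integral_mult_right_zero .
  qed
  have "dev \<phi> i \<le> (\<Sum>l = 1..<i. \<alpha> (i - l) * ((dev \<phi> l + 2 * K * L * real (i - l))
      + (\<bar>expectation (\<lambda>\<omega>. ?P' (l - 1) \<omega> * rate l \<omega>)\<bar> + 7 * K * L * real (i - l)))) + B * tail i"
  proof (rule dev_expand[OF L B i])
    fix l assume l: "1 \<le> l" "l < i"
    have pastm: "past (Suc (l - 1)) = past l" using l by simp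
    have le: "l - 1 \<le> i - 1" using l by simp
    have m: "?P' (l - 1) \<in> borel_measurable (past l)" "?P (l - 1) \<in> borel_measurable (past l)"
      using l by (auto intro!: lipschitz_mart_measurable_past[OF L'] lipschitz_mart_measurable_past[OF L])
    have card: "card {Suc (l - 1)..i - 1} = i - l" using l by simp
    show "\<bar>expectation (\<lambda>\<omega>. ?P (i - 1) \<omega> * (rate l \<omega> - var))\<bar> \<le> dev \<phi> l + 2 * K * L * real (i - l)"
    proof -
      let ?Z = "\<lambda>\<omega>. rate l \<omega> - var"
      have Zm: "?Z \<in> borel_measurable (past l)" by (intro borel_measurable_diff rate_measurable_past) auto
      have pZ: "poly_growth ?Z" by (intro pg)
      have 0: "expectation (\<lambda>\<omega>. (?P' (l - 1) \<omega> * ?Z \<omega>) * (mart (i - 1) \<omega> - mart (l - 1) \<omega>)) = 0"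
        by (intro expectation_mart_diff(1) le pg, unfold pastm, intro borel_measurable_times m Zm)
      have "expectation (\<lambda>\<omega>. \<bar>?Z \<omega>\<bar> * (mart (i - 1) \<omega> - mart (l - 1) \<omega>) ^ 2)
          = (\<Sum>j = Suc (l - 1)..i - 1. expectation (\<lambda>\<omega>. \<bar>?Z \<omega>\<bar> * rate j \<omega>))"
        by (intro expectation_mart_diff(2) le pg, unfold pastm, use Zm in measurable)
      also have "\<dots> \<le> (\<Sum>j = Suc (l - 1)..i - 1. 2 * K)"
        by (intro sum_mono expectation_rate_mult_le pg expectation_rate_centered_sq_le)
      also have "\<dots> = real (i - l) * (2 * K)" by (simp only: sum_constant card)
      finally have "L * expectation (\<lambda>\<omega>. \<bar>?Z \<omega>\<bar> * (mart (i - 1) \<omega> - mart (l - 1) \<omega>) ^ 2) \<le> L * (real (i - l) * (2 * K))"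
        by (rule mult_left_mono[OF _ L0])
      with expand[OF l pZ] have "\<bar>expectation (\<lambda>\<omega>. ?P (i - 1) \<omega> * ?Z \<omega>) - expectation (\<lambda>\<omega>. ?P (l - 1) \<omega> * ?Z \<omega>)\<bar> \<le> L * (real (i - l) * (2 * K))"
        unfolding 0 diff_0_right by (rule order_trans)
      then show ?thesis unfolding dev_def by (simp only: ac_simps) linarith
    qed
    show "\<bar>expectation (\<lambda>\<omega>. ?P (i - 1) \<omega> * incr l \<omega>)\<bar>
      \<le> \<bar>expectation (\<lambda>\<omega>. ?P' (l - 1) \<omega> * rate l \<omega>)\<bar> + 7 * K * L * real (i - l)"
    proof -
      let ?Z = "incr l"
      have pZ: "poly_growth ?Z" using l by (intro pg)
      note pg = pg l(1)
      have Zm: "?Z \<in> borel_measurable (past (Suc l))" using l by (intro incr_measurable_past) auto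
      have l': "l \<le> i - 1" using l by simp
      have split: "mart (l - 1) \<omega> = mart l \<omega> - ?Z \<omega>" for \<omega>
        using mart_Suc[of "l - 1" \<omega>] l by simp
      have 0: "expectation (\<lambda>\<omega>. ?P (l - 1) \<omega> * ?Z \<omega>) = 0"
        using l by (intro expectation_incr_powers(1) pg m)
      have "expectation (\<lambda>\<omega>. (?P' (l - 1) \<omega> * ?Z \<omega>) * (mart (i - 1) \<omega> - mart (l - 1) \<omega>))
          = expectation (\<lambda>\<omega>. (?P' (l - 1) \<omega> * ?Z \<omega>) * (mart (i - 1) \<omega> - mart l \<omega>) + ?P' (l - 1) \<omega> * ?Z \<omega> ^ 2)"
        unfolding split by (simp add: algebra_simps power2_eq_square)
      also have "\<dots> = expectation (\<lambda>\<omega>. (?P' (l - 1) \<omega> * ?Z \<omega>) * (mart (i - 1) \<omega> - mart l \<omega>)) + expectation (\<lambda>\<omega>. ?P' (l - 1) \<omega> * ?Z \<omega> ^ 2)"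
        by (intro ev_add pg pZ)
      also have "expectation (\<lambda>\<omega>. (?P' (l - 1) \<omega> * ?Z \<omega>) * (mart (i - 1) \<omega> - mart l \<omega>)) = 0"
        by (intro expectation_mart_diff(1) l' pg pZ borel_measurable_times Zm measurable_past_mono[OF m(1)]) simp
      also have "expectation (\<lambda>\<omega>. ?P' (l - 1) \<omega> * ?Z \<omega> ^ 2) = expectation (\<lambda>\<omega>. ?P' (l - 1) \<omega> * rate l \<omega>)"
        using l by (intro expectation_incr_powers(2) pg m)
      finally have 1: "expectation (\<lambda>\<omega>. (?P' (l - 1) \<omega> * ?Z \<omega>) * (mart (i - 1) \<omega> - mart (l - 1) \<omega>))
        = expectation (\<lambda>\<omega>. ?P' (l - 1) \<omega> * rate l \<omega>)" by simp
      have Z2: "expectation (\<lambda>\<omega>. ?Z \<omega> ^ 2) \<le> 2 * K" using expectation_incr_sq_le[OF l(1)] K_ge_1 by simp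
      \<comment> \<open>The factor \<open>incr l\<close> is itself the first increment of the
        difference, so that increment is split off. It contributes a third absolute moment; the rest
        is a conditional variance after time l.\<close>
      have "expectation (\<lambda>\<omega>. \<bar>?Z \<omega>\<bar> * (mart (i - 1) \<omega> - mart (l - 1) \<omega>) ^ 2)
        \<le> expectation (\<lambda>\<omega>. 2 * (?Z \<omega> ^ 2 * \<bar>?Z \<omega>\<bar>) + 2 * (\<bar>?Z \<omega>\<bar> * (mart (i - 1) \<omega> - mart l \<omega>) ^ 2))"
      proof (intro ev_mono pg pZ)
        fix \<omega>
        have "(mart (i - 1) \<omega> - mart (l - 1) \<omega>) ^ 2 \<le> 2 * ?Z \<omega> ^ 2 + 2 * (mart (i - 1) \<omega> - mart l \<omega>) ^ 2"
          unfolding split using sum_squares_bound[of "?Z \<omega>" "mart (i - 1) \<omega> - mart l \<omega>"]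
          by (simp add: power2_eq_square algebra_simps)
        from mult_left_mono[OF this abs_ge_zero[of "?Z \<omega>"]]
        show "\<bar>?Z \<omega>\<bar> * (mart (i - 1) \<omega> - mart (l - 1) \<omega>) ^ 2
          \<le> 2 * (?Z \<omega> ^ 2 * \<bar>?Z \<omega>\<bar>) + 2 * (\<bar>?Z \<omega>\<bar> * (mart (i - 1) \<omega> - mart l \<omega>) ^ 2)"
          by (simp add: algebra_simps)
      qed
      also have "\<dots> = 2 * expectation (\<lambda>\<omega>. ?Z \<omega> ^ 2 * \<bar>?Z \<omega>\<bar>) + 2 * expectation (\<lambda>\<omega>. \<bar>?Z \<omega>\<bar> * (mart (i - 1) \<omega> - mart l \<omega>) ^ 2)"
        by (subst ev_add) (intro pg pZ, simp)+
      also have "expectation (\<lambda>\<omega>. \<bar>?Z \<omega>\<bar> * (mart (i - 1) \<omega> - mart l \<omega>) ^ 2) = (\<Sum>j = Suc l..i - 1. expectation (\<lambda>\<omega>. \<bar>?Z \<omega>\<bar> * rate j \<omega>))"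
        by (intro expectation_mart_diff(2) l' pg pZ) (use Zm in measurable)
      also have "2 * expectation (\<lambda>\<omega>. ?Z \<omega> ^ 2 * \<bar>?Z \<omega>\<bar>) + 2 * (\<Sum>j = Suc l..i - 1. expectation (\<lambda>\<omega>. \<bar>?Z \<omega>\<bar> * rate j \<omega>))
        \<le> 2 * (5 * K / 2) + 2 * (\<Sum>j = Suc l..i - 1. 2 * K)"
        by (intro add_mono mult_left_mono sum_mono expectation_rate_mult_le expectation_incr_abs_3_le l pZ Z2) auto
      also have "\<dots> = 5 * K + 4 * K * (real (i - l) - 1)" using l by (simp add: of_nat_diff)
      also have "\<dots> \<le> 7 * K * real (i - l)"
      proof -
        have "1 \<le> real (i - l)" using l by simp
        from mult_left_mono[OF this, of K] have "K \<le> K * real (i - l)" using K_ge_1 by simp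
        moreover have "5 * K + 4 * K * (r - 1) = K + 4 * (K * r)" "7 * K * r = 7 * (K * r)" for r
          by (simp_all add: algebra_simps)
        moreover have "K \<le> p \<Longrightarrow> K + 4 * p \<le> 7 * p" for p using K_ge_1 by linarith
        ultimately show ?thesis by (simp only:)
      qed
      finally have "L * expectation (\<lambda>\<omega>. \<bar>?Z \<omega>\<bar> * (mart (i - 1) \<omega> - mart (l - 1) \<omega>) ^ 2) \<le> L * (7 * K * real (i - l))"
        by (rule mult_left_mono[OF _ L0])
      moreover have e: "7 * K * L * real (i - l) = L * (7 * K * real (i - l))" by simp
      ultimately show ?thesis using expand[OF l pZ] unfolding 0 1 e by linarith
    qed
  qed
  also have "\<dots> = (\<Sum>l = 1..<i. \<alpha> (i - l) * dev \<phi> l) + (\<Sum>l = 1..<i. \<alpha> (i - l) * \<bar>expectation (\<lambda>\<omega>. ?P' (l - 1) \<omega> * rate l \<omega>)\<bar>)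
      + (9 * K * L) * (\<Sum>l = 1..<i. \<alpha> (i - l) * real (i - l)) + B * tail i"
    by (simp add: sum.distrib sum_subtractf sum_distrib_left algebra_simps)
  also have "\<dots> \<le> (\<Sum>l = 1..<i. \<alpha> (i - l) * dev \<phi> l) + (\<Sum>l = 1..<i. \<alpha> (i - l) * \<bar>expectation (\<lambda>\<omega>. ?P' (l - 1) \<omega> * rate l \<omega>)\<bar>)
      + (9 * K * L) * \<mu> + B * tail i"
    using K_ge_1 L0 by (intro add_right_mono add_left_mono mult_left_mono sum_\<alpha>_moment_le) auto
  finally show ?thesis by (simp add: ac_simps)
qed

text \<open>Both expectations are expanded around \<open>mart (k - 1)\<close>. Second-order terms
  differ by rate minus var, and a third-order term survives on the Poisson side only. Each remainder
  is at most K * B4: 4K/6 <= K from the fourth moment of the increment, and var^2/2 <= K from the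
  Gaussian.\<close>

lemma lindeberg_step:
  assumes D1: "\<And>x. (f has_real_derivative f1 x) (at x)"
    and D2: "\<And>x. (f1 has_real_derivative f2 x) (at x)"
    and D3: "\<And>x. (f2 has_real_derivative f3 x) (at x)"
    and L: "B1-lipschitz_on UNIV f" and B2: "\<And>x. \<bar>f2 x\<bar> \<le> B2" and B3: "\<And>x. \<bar>f3 x\<bar> \<le> B3"
    and L3: "B4-lipschitz_on UNIV f3" and k: "1 \<le> k"
  shows "\<bar>expectation (\<lambda>\<omega>. f (mart k \<omega>)) - expectation (\<lambda>\<omega>. gauss_smooth var f (mart (k - 1) \<omega>))\<bar>
    \<le> dev f2 k / 2 + \<bar>expectation (\<lambda>\<omega>. f3 (mart (k - 1) \<omega>) * rate k \<omega>)\<bar> / 6 + 2 * K * B4"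
proof -
  have L2: "B3-lipschitz_on UNIV f2" by (rule derivative_bound_lipschitz[OF D3 B3])
  have L1: "B2-lipschitz_on UNIV f1" by (rule derivative_bound_lipschitz[OF D2 B2])
  have B40: "0 \<le> B4" by (rule lipschitz_on_nonneg[OF L3])
  let ?m = "mart (k - 1)" and ?Z = "incr k"
  have P: "poly_growth (\<lambda>\<omega>. f (mart m \<omega>))" "poly_growth (\<lambda>\<omega>. f1 (?m \<omega>))" "poly_growth (\<lambda>\<omega>. f2 (?m \<omega>))"
     "poly_growth (\<lambda>\<omega>. f3 (?m \<omega>))" "poly_growth (\<lambda>\<omega>. gauss_smooth var f (?m \<omega>))" for m
    by (rule poly_growth_lipschitz[OF L poly_growth_mart] poly_growth_lipschitz[OF L1 poly_growth_mart]
      poly_growth_lipschitz[OF L2 poly_growth_mart] poly_growth_lipschitz[OF L3 poly_growth_mart]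
      poly_growth_lipschitz[OF gauss_smooth_lipschitz[OF L] poly_growth_mart])+
  have pZ: "poly_growth ?Z" using k by (rule poly_growth_incr)
  note pg = poly_growth_intros P pZ k
  have km: "k - 1 < k" using k by simp
  note m = lipschitz_mart_measurable_past[OF L1 km] lipschitz_mart_measurable_past[OF L2 km] lipschitz_mart_measurable_past[OF L3 km]
  have mk: "mart k \<omega> = ?m \<omega> + ?Z \<omega>" for \<omega> using mart_Suc[of "k - 1" \<omega>] k by simp
  note lin = Bochner_Integration.integral_add Bochner_Integration.integral_diff Bochner_Integration.integrable_add
    Bochner_Integration.integrable_diff integrable_mult_right integral_mult_right_zero
  have i: "integrable M (\<lambda>\<omega>. f (mart k \<omega>))" "integrable M (\<lambda>\<omega>. f (?m \<omega>))" "integrable M (\<lambda>\<omega>. f1 (?m \<omega>) * ?Z \<omega>)"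
    "integrable M (\<lambda>\<omega>. f2 (?m \<omega>) * ?Z \<omega> ^ 2)" "integrable M (\<lambda>\<omega>. f3 (?m \<omega>) * ?Z \<omega> ^ 3)"
    "integrable M (\<lambda>\<omega>. gauss_smooth var f (?m \<omega>))" "integrable M (\<lambda>\<omega>. f2 (?m \<omega>))" "integrable M (\<lambda>\<omega>. f2 (?m \<omega>) * rate k \<omega>)"
    by (intro poly_growth_integrable pg)+
  let ?R = "\<lambda>\<omega>. f (mart k \<omega>) - f (?m \<omega>) - f1 (?m \<omega>) * ?Z \<omega> - (1/2) * (f2 (?m \<omega>) * ?Z \<omega> ^ 2) - (1/6) * (f3 (?m \<omega>) * ?Z \<omega> ^ 3)"
  let ?S = "\<lambda>\<omega>. gauss_smooth var f (?m \<omega>) - f (?m \<omega>) - (var / 2) * f2 (?m \<omega>)"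
  have ER: "expectation ?R = expectation (\<lambda>\<omega>. f (mart k \<omega>)) - expectation (\<lambda>\<omega>. f (?m \<omega>)) - 0
      - (1/2) * expectation (\<lambda>\<omega>. f2 (?m \<omega>) * rate k \<omega>) - (1/6) * expectation (\<lambda>\<omega>. f3 (?m \<omega>) * rate k \<omega>)"
    by (simp only: lin i expectation_incr_powers[OF k m(1) P(2)] expectation_incr_powers[OF k m(2) P(3)] expectation_incr_powers[OF k m(3) P(4)])
  have ES: "expectation ?S = expectation (\<lambda>\<omega>. gauss_smooth var f (?m \<omega>)) - expectation (\<lambda>\<omega>. f (?m \<omega>)) - (var / 2) * expectation (\<lambda>\<omega>. f2 (?m \<omega>))"
    by (simp only: lin i)
  have Ed: "expectation (\<lambda>\<omega>. f2 (?m \<omega>) * (rate k \<omega> - var)) = expectation (\<lambda>\<omega>. f2 (?m \<omega>) * rate k \<omega>) - var * expectation (\<lambda>\<omega>. f2 (?m \<omega>))"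
  proof -
    have "expectation (\<lambda>\<omega>. f2 (?m \<omega>) * (rate k \<omega> - var)) = expectation (\<lambda>\<omega>. f2 (?m \<omega>) * rate k \<omega> - var * f2 (?m \<omega>))"
      by (simp add: algebra_simps)
    then show ?thesis by (simp only: lin i)
  qed
  have R: "\<bar>expectation ?R\<bar> \<le> B4 * K"
  proof -
    have "\<bar>expectation ?R\<bar> \<le> expectation (\<lambda>\<omega>. \<bar>?R \<omega>\<bar>)" by (intro ev_abs pg)
    also have "\<dots> \<le> expectation (\<lambda>\<omega>. (B4 / 6) * ?Z \<omega> ^ 4)"
    proof (intro ev_mono pg)
      fix \<omega>
      show "\<bar>?R \<omega>\<bar> \<le> (B4 / 6) * ?Z \<omega> ^ 4"
        using third_order_expansion[OF D1 D2 D3 L3, of "?m \<omega>" "?Z \<omega>"] by (simp add: mk)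
    qed
    also have "\<dots> = (B4 / 6) * expectation (\<lambda>\<omega>. ?Z \<omega> ^ 4)" by simp
    also have "\<dots> \<le> (B4 / 6) * (4 * K)" using B40 by (intro mult_left_mono expectation_incr_4_le k) auto
    also have "\<dots> \<le> B4 * K" using B40 K_ge_1 by (simp add: mult_nonneg_nonneg)
    finally show ?thesis .
  qed
  have S: "\<bar>expectation ?S\<bar> \<le> B4 * K"
  proof -
    have "\<bar>expectation ?S\<bar> \<le> expectation (\<lambda>\<omega>. \<bar>?S \<omega>\<bar>)" by (intro ev_abs pg)
    also have "\<dots> \<le> expectation (\<lambda>_. B4 * var\<^sup>2 / 2)"
      using var_pos by (intro ev_mono pg gauss_smooth_heat[OF D1 D2 D3 L L3]) auto
    also have "\<dots> = B4 * (var\<^sup>2 / 2)" by (simp add: prob_space)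
    also have "\<dots> \<le> B4 * K"
    proof (rule mult_left_mono[OF _ B40])
      have "var\<^sup>2 \<le> 1" using var_pos var_le_1 by (simp add: power_le_one)
      then show "var\<^sup>2 / 2 \<le> K" using K_ge_1 by simp
    qed
    finally show ?thesis .
  qed
  have "expectation (\<lambda>\<omega>. f (mart k \<omega>)) - expectation (\<lambda>\<omega>. gauss_smooth var f (?m \<omega>))
    = expectation ?R - expectation ?S + (1/2) * expectation (\<lambda>\<omega>. f2 (?m \<omega>) * (rate k \<omega> - var)) + (1/6) * expectation (\<lambda>\<omega>. f3 (?m \<omega>) * rate k \<omega>)"
    unfolding ER ES Ed by (simp add: algebra_simps)
  moreover have "\<bar>a\<bar> \<le> B4 * K \<Longrightarrow> \<bar>b\<bar> \<le> B4 * K \<Longrightarrow> x = a - b + (1/2) * d + (1/6) * e \<Longrightarrow> \<bar>x\<bar> \<le> \<bar>d\<bar> / 2 + \<bar>e\<bar> / 6 + 2 * (B4 * K)"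
    for a b d e x :: real by linarith
  moreover have e: "2 * K * B4 = 2 * (B4 * K)" by simp
  ultimately show ?thesis using R S unfolding dev_def e by blast
qed

end

section \<open>Closing the estimate\<close>

text \<open>Telescoping: x^(-3/2) is at most a multiple of x^(-1/2) - (x + s)^(-1/2), divided by s.
  The assumption s <= e ensures sqrt(x + s) <= (3/2) sqrt x. The constant is 36 = 3 * 2 * 6, from
  sqrt 3 <= 2 and (q + p) q <= 6 p^2. The decay in e is what finally closes the estimate.\<close>

lemma sum_inverse_three_halves_le:
  fixes s e :: real
  assumes s: "0 < s" and e: "s \<le> e"
  shows "(\<Sum>m<n. 3 / ((e + real m * s) * sqrt ((e + real m * s) / 3))) \<le> 36 / (s * sqrt e)"
proof -
  have term_le: "3 / (x * sqrt (x / 3)) \<le> 36 / s * (1 / sqrt x - 1 / sqrt (x + s))" if x: "s \<le> x" for x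
  proof -
    define p where "p = sqrt x"
    define q where "q = sqrt (x + s)"
    have p: "0 < p" and q: "0 < q" using s x by (auto simp: p_def q_def)
    have pq: "q\<^sup>2 = p\<^sup>2 + s" and px: "x = p\<^sup>2" using s x by (auto simp: p_def q_def)
    have "p < q" using s x by (simp add: p_def q_def)
    have "q\<^sup>2 \<le> (3 / 2 * p)\<^sup>2" proof -
      have "q\<^sup>2 \<le> 9 / 4 * p\<^sup>2" using pq px x zero_le_power2[of p] by linarith
      also have "\<dots> = (3 / 2 * p)\<^sup>2" by (simp add: power_mult_distrib power_divide)
      finally show ?thesis .
    qed
    then have q32: "q \<le> 3 / 2 * p" by (rule power2_le_imp_le) (use p in simp)
    have "(q + p) * q \<le> (3 / 2 * p + p) * (3 / 2 * p)" using q32 p q by (intro mult_mono) auto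
    also have "\<dots> \<le> 6 * p\<^sup>2" by (simp add: power2_eq_square)
    finally have le: "(q + p) * q \<le> 6 * p\<^sup>2" .
    have s_eq: "s = (q - p) * (q + p)" using pq by (simp add: algebra_simps power2_eq_square)
    have "sqrt 3 \<le> 2" by (rule real_le_lsqrt) auto
    have "3 / (x * sqrt (x / 3)) = 3 * sqrt 3 / (p\<^sup>2 * p)"
      by (simp add: real_sqrt_divide px p_def[symmetric] p less_imp_le)
    also have "\<dots> \<le> 3 * 2 / (p\<^sup>2 * p)"
      using p \<open>sqrt 3 \<le> 2\<close> by (intro divide_right_mono mult_left_mono) auto
    also have "\<dots> = 36 / (6 * p\<^sup>2 * p)" by simp
    also have "\<dots> \<le> 36 / ((q + p) * q * p)"
      using le p q by (intro divide_left_mono mult_right_mono) auto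
    also have "\<dots> = 36 / s * (1 / p - 1 / q)"
    proof -
      have "36 / (c * q * p) = 36 / (d * c) * (d / (p * q))" if "c > 0" "d > 0" for c d
        using that p q by (simp add: field_simps)
      from this[of "q + p"] have "36 / ((q + p) * q * p) = 36 / (d * (q + p)) * (d / (p * q))" if "d > 0" for d
        using that p q by simp
      moreover have "1 / p - 1 / q = (q - p) / (p * q)" using p q by (simp add: field_simps)
      ultimately show ?thesis using \<open>p < q\<close> by (simp only: s_eq diff_gt_0_iff_gt)
    qed
    finally show ?thesis by (simp add: p_def q_def)
  qed
  have "(\<Sum>m<n. 3 / ((e + real m * s) * sqrt ((e + real m * s) / 3)))
    \<le> (\<Sum>m<n. 36 / s * (1 / sqrt (e + real m * s) - 1 / sqrt (e + real (Suc m) * s)))"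
  proof (rule sum_mono)
    fix m
    have "s \<le> e + real m * s" using s e by (simp add: add_increasing2)
    from term_le[OF this]
    show "3 / ((e + real m * s) * sqrt ((e + real m * s) / 3)) \<le> 36 / s * (1 / sqrt (e + real m * s) - 1 / sqrt (e + real (Suc m) * s))"
      by (simp add: algebra_simps)
  qed
  also have "\<dots> = 36 / s * (1 / sqrt e - 1 / sqrt (e + real n * s))"
    unfolding sum_distrib_left[symmetric]
    by (subst sum_lessThan_telescope'[where f = "\<lambda>m. 1 / sqrt (e + real m * s)"]) simp
  also have "\<dots> \<le> 36 / s * (1 / sqrt e)"
    using s e by (intro mult_left_mono) auto
  finally show ?thesis by simp
qed

section \<open>Distance of the martingale from its Gaussian counterpart\<close>

lemma gauss_smooth_cmult: "gauss_smooth t (\<lambda>x. c * f x) x = c * gauss_smooth t f x"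
  unfolding gauss_smooth_def by (simp add: mult.left_commute)

context hawkes
begin

text \<open>The Gaussian side is a smoothing evaluated at 0, so it makes sense for k = 0 and fits
  the semigroup. There is no normalisation: the aim is a bound uniform in k.\<close>

definition mart_dist :: "(real \<Rightarrow> real) \<Rightarrow> nat \<Rightarrow> real" where
  "mart_dist u k = \<bar>expectation (\<lambda>\<omega>. u (mart k \<omega>)) - gauss_smooth (real k * var) u 0\<bar>"

lemma mart_dist_nonneg: "0 \<le> mart_dist u k"
  by (simp add: mart_dist_def)

lemma sum_tail_diagonal_le: "(\<Sum>k = s + 1..n. tail (k - s)) \<le> \<mu>"
proof -
  have "(\<Sum>k = s + 1..n. tail (k - s)) = (\<Sum>i = 1..n - s. tail i)"
    by (rule sum.reindex_bij_witness[of _ "\<lambda>i. i + s" "\<lambda>k. k - s"]) auto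
  then show ?thesis using sum_tail_le by simp
qed

text \<open>Divided by its Lipschitz constant \<open>B4\<close>, \<open>f3\<close> is an admissible
  test function, so replacing \<open>mart (l - 1)\<close> by a Gaussian costs \<open>D * B4\<close>;
  the Gaussian value is then bounded at the larger scale. Passing from \<open>rate l\<close> to
  \<open>var\<close> costs \<open>dev f3 l\<close>.\<close>

lemma mart_third_derivative_le:
  assumes u: "1-lipschitz_on UNIV u" and t: "t > 0"
    and D1: "\<And>x. (gauss_smooth t u has_real_derivative f1 x) (at x)"
    and D2: "\<And>x. (f1 has_real_derivative f2 x) (at x)"
    and D3: "\<And>x. (f2 has_real_derivative f3 x) (at x)"
    and B2: "\<And>x. \<bar>f2 x\<bar> \<le> B2" and B3: "\<And>x. \<bar>f3 x\<bar> \<le> B3"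
    and L3: "B4-lipschitz_on UNIV f3" and B4: "B4 > 0"
    and D: "\<And>v. 1-lipschitz_on UNIV v \<Longrightarrow> mart_dist v (l - 1) \<le> D" and l: "1 \<le> l"
  shows "\<bar>expectation (\<lambda>\<omega>. f3 (mart (l - 1) \<omega>) * rate l \<omega>)\<bar> \<le> 3 * var / (t + real (l - 1) * var) + D * B4 + dev f3 l"
proof -
  let ?m = "mart (l - 1)" and ?s = "real (l - 1) * var"
  have P: "poly_growth (\<lambda>\<omega>. f3 (?m \<omega>))" by (rule poly_growth_lipschitz[OF L3 poly_growth_mart])
  note pg = poly_growth_intros P
  have s0: "0 \<le> ?s" using var_pos by simp
  define v where "v = (\<lambda>x. 1 / B4 * f3 x)"
  have v: "1-lipschitz_on UNIV v"
  proof (rule lipschitzI_abs)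
    fix x y
    have "\<bar>v y - v x\<bar> = \<bar>f3 y - f3 x\<bar> / B4"
      unfolding v_def using B4 by (simp flip: right_diff_distrib diff_divide_distrib)
    also have "\<dots> \<le> (B4 * \<bar>y - x\<bar>) / B4" using B4 by (intro divide_right_mono lipschitz_abs_le[OF L3]) auto
    finally show "\<bar>v y - v x\<bar> \<le> 1 * \<bar>y - x\<bar>" using B4 by simp
  qed simp
  have "\<bar>expectation (\<lambda>\<omega>. f3 (?m \<omega>)) - gauss_smooth ?s f3 0\<bar> = B4 * mart_dist v (l - 1)"
    unfolding mart_dist_def v_def gauss_smooth_cmult integral_mult_right_zero
    using B4 by (simp flip: right_diff_distrib diff_divide_distrib)
  also have "\<dots> \<le> B4 * D" using B4 D[OF v] by (intro mult_left_mono) auto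
  finally have 1: "\<bar>expectation (\<lambda>\<omega>. f3 (?m \<omega>))\<bar> \<le> 3 / (t + ?s) + B4 * D"
    using gauss_smooth_third_derivative_bound[OF u t s0 D1 D2 D3 B2 B3 L3, of 0] by linarith
  have D0: "0 \<le> D" by (rule order_trans[OF mart_dist_nonneg D[OF v]])
  have "expectation (\<lambda>\<omega>. f3 (?m \<omega>) * rate l \<omega>) = expectation (\<lambda>\<omega>. f3 (?m \<omega>) * (rate l \<omega> - var) + var * f3 (?m \<omega>))"
    by (simp add: algebra_simps)
  also have "\<dots> = expectation (\<lambda>\<omega>. f3 (?m \<omega>) * (rate l \<omega> - var)) + var * expectation (\<lambda>\<omega>. f3 (?m \<omega>))"
    by (subst ev_add, (intro pg; simp)+, simp)
  finally have "\<bar>expectation (\<lambda>\<omega>. f3 (?m \<omega>) * rate l \<omega>)\<bar> \<le> dev f3 l + \<bar>var * expectation (\<lambda>\<omega>. f3 (?m \<omega>))\<bar>"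
    unfolding dev_def by linarith
  also have "\<bar>var * expectation (\<lambda>\<omega>. f3 (?m \<omega>))\<bar> \<le> var * (3 / (t + ?s) + B4 * D)"
    using 1 var_pos by (simp add: abs_mult)
  also have "\<dots> = 3 * var / (t + ?s) + var * (B4 * D)" by (simp add: distrib_left)
  also have "\<dots> \<le> 3 * var / (t + ?s) + 1 * (B4 * D)"
    using var_le_1 B4 D0 by (intro add_left_mono mult_right_mono) auto
  finally show ?thesis by (simp add: mult.commute[of B4])
qed

text \<open>Here \<open>e\<close> is the residual smoothing variance, \<open>b\<close> bounds the
  sums of the Lipschitz constants \<open>B4\<close>, and \<open>Y\<close> bounds every diagonal sum
  of the terms |E[f3 rate]|. Removing the residual smoothing costs \<open>sqrt e\<close> on each of
  the two sides.\<close>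

lemma mart_dist_step:
  assumes u: "1-lipschitz_on UNIV u" and e: "1 \<le> e"
    and D: "\<And>v k. 1-lipschitz_on UNIV v \<Longrightarrow> k \<le> n \<Longrightarrow> mart_dist v k \<le> D"
    and b: "36 / (var * sqrt e) \<le> b"
    and Y: "Y = 3 + D * b + (4 * K * \<mu> * b + 3 * \<mu>) / (1 - \<alpha>_norm)"
  shows "mart_dist u n \<le> 2 * sqrt e + (\<alpha>_norm * Y + (9 * K * \<mu> * b + 2 * \<mu>)) / (1 - \<alpha>_norm) / 2 + Y / 6 + 2 * K * b"
proof -
  define T where "T k = e + real (n - k) * var" for k
  define B4 where "B4 k = 3 / (T k * sqrt (T k / 3))" for k
  have T1: "1 \<le> T k" for k using e var_pos by (simp add: T_def add_increasing2)
  have T0: "0 < T k" for k using T1[of k] by linarith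
  have B4_pos: "0 < B4 k" for k using T0 by (simp add: B4_def)
  have D0: "0 \<le> D" using order_trans[OF mart_dist_nonneg D[OF u, of 0]] by simp
  have b0: "0 \<le> b" using b e var_pos by (rule_tac order_trans[rotated]) auto
  note a = \<alpha>_norm_bounds
  have sumB4: "(\<Sum>k = s + 1..n. B4 k) \<le> b" for s
  proof -
    have "(\<Sum>k = s + 1..n. B4 k) \<le> (\<Sum>k = 1..n. B4 k)"
      by (intro sum_mono2) (auto intro: less_imp_le B4_pos)
    also have "\<dots> = (\<Sum>m<n. 3 / ((e + real m * var) * sqrt ((e + real m * var) / 3)))"
      by (rule sum.reindex_bij_witness[of _ "\<lambda>m. n - m" "\<lambda>k. n - k"]) (auto simp: B4_def T_def)
    also have "\<dots> \<le> 36 / (var * sqrt e)"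
      using var_le_1 e by (intro sum_inverse_three_halves_le var_pos) auto
    finally show ?thesis using b by simp
  qed
  \<comment> \<open>One predicate lets the derivatives be chosen for all k together. The bounds 2
    and 3 come from \<open>T k\<close> >= 1; in the estimates they multiply only
    \<open>tail\<close>, whose sums are bounded.\<close>
  define smooth where "smooth k f1 f2 f3 \<longleftrightarrow>
     (\<forall>x. (gauss_smooth (T k) u has_real_derivative f1 x) (at x)) \<and>
     (\<forall>x. (f1 has_real_derivative f2 x) (at x)) \<and>
     (\<forall>x. (f2 has_real_derivative f3 x) (at x)) \<and>
     (\<forall>x. \<bar>f2 x\<bar> \<le> 2) \<and> (\<forall>x. \<bar>f3 x\<bar> \<le> 3) \<and> (B4 k)-lipschitz_on UNIV f3" for k f1 f2 f3
  have "\<exists>f1 f2 f3. smooth k f1 f2 f3" for k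
  proof -
    obtain f1 f2 f3 where f:
      "\<And>x. (gauss_smooth (T k) u has_real_derivative f1 x) (at x)"
      "\<And>x. (f1 has_real_derivative f2 x) (at x)"
      "\<And>x. (f2 has_real_derivative f3 x) (at x)"
      "\<And>x. \<bar>f2 x\<bar> \<le> 1 / sqrt (T k / 3)" "\<And>x. \<bar>f3 x\<bar> \<le> 3 / T k" "(B4 k)-lipschitz_on UNIV f3"
      using gauss_smooth_three_derivatives[OF u T0, of k] unfolding B4_def by metis
    have "1 / 2 \<le> sqrt (T k / 3)"
      using T1[of k] by (intro real_le_rsqrt) (simp add: power2_eq_square)
    then have "1 / sqrt (T k / 3) \<le> 2"
      using T0[of k] by (simp add: field_simps)
    moreover have "3 / T k \<le> 3" using T1[of k] by (simp add: field_simps)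
    ultimately have "smooth k f1 f2 f3"
      unfolding smooth_def using f by (blast intro: order_trans)
    then show ?thesis by blast
  qed
  then obtain f1 f2 f3 where S: "\<And>k. smooth k (f1 k) (f2 k) (f3 k)" by metis
  have d1: "\<And>x. (gauss_smooth (T k) u has_real_derivative f1 k x) (at x)"
    and d2: "\<And>x. (f1 k has_real_derivative f2 k x) (at x)"
    and d3: "\<And>x. (f2 k has_real_derivative f3 k x) (at x)"
    and B2: "\<And>x. \<bar>f2 k x\<bar> \<le> 2" and B3: "\<And>x. \<bar>f3 k x\<bar> \<le> 3" and L3: "(B4 k)-lipschitz_on UNIV (f3 k)" for k
    using S[of k] unfolding smooth_def by blast+
  have L2: "3-lipschitz_on UNIV (f2 k)" for k by (rule derivative_bound_lipschitz[OF d3 B3])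
  define y where "y k l = \<bar>expectation (\<lambda>\<omega>. f3 k (mart (l - 1) \<omega>) * rate l \<omega>)\<bar>" for k l
  define C3 where "C3 = 4 * K * \<mu> * b + 3 * \<mu>"
  have C30: "0 \<le> C3" using K_ge_1 \<mu>_nonneg b0 by (simp add: C3_def)
  have dev3: "(\<Sum>k = s + 1..n. dev (f3 k) (k - s)) \<le> C3 / (1 - \<alpha>_norm)" for s
  proof (rule renewal_diagonal_bound[OF \<alpha>_nonneg sum_\<alpha>_le a(2) _ C30])
    fix k i :: nat assume "1 \<le> i"
    then show "dev (f3 k) i \<le> (\<Sum>l = 1..<i. \<alpha> (i - l) * dev (f3 k) l) + (4 * K * \<mu> * B4 k + 3 * tail i)"
      by (intro dev_first_order L3 B3)
  next
    fix s
    have "(\<Sum>k = s + 1..n. 4 * K * \<mu> * B4 k + 3 * tail (k - s)) = 4 * K * \<mu> * (\<Sum>k = s + 1..n. B4 k) + 3 * (\<Sum>k = s + 1..n. tail (k - s))"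
      by (simp add: sum.distrib sum_distrib_left)
    also have "\<dots> \<le> C3"
      unfolding C3_def using K_ge_1 \<mu>_nonneg by (intro add_mono mult_left_mono sumB4 sum_tail_diagonal_le) auto
    finally show "(\<Sum>k = s + 1..n. 4 * K * \<mu> * B4 k + 3 * tail (k - s)) \<le> C3" .
  qed
  have y_diag: "(\<Sum>k = s + 1..n. y k (k - s)) \<le> Y" for s
  proof -
    have "(\<Sum>k = s + 1..n. y k (k - s))
      \<le> (\<Sum>k = s + 1..n. 3 * var / (e + real (n - s - 1) * var) + D * B4 k + dev (f3 k) (k - s))"
    proof (rule sum_mono)
      fix k assume k: "k \<in> {s + 1..n}"
      \<comment> \<open>The variance not yet exchanged and the variance accumulated by the
        martingale add up to a number independent of k. So the n - s terms of the diagonal are equal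
        and sum to at most 3, where terms of size 1 / T k would sum to a logarithm.\<close>
      have "n - s - 1 = (n - k) + (k - s - 1)" using k by simp
      then have "T k + real (k - s - 1) * var = e + real (n - s - 1) * var"
        by (simp only: T_def of_nat_add distrib_right add.assoc)
      moreover have "y k (k - s) \<le> 3 * var / (T k + real (k - s - 1) * var) + D * B4 k + dev (f3 k) (k - s)"
        unfolding y_def
        by (rule mart_third_derivative_le[OF u T0 d1 d2 d3 B2 B3 L3 B4_pos D]) (use k in auto)
      ultimately show "y k (k - s) \<le> 3 * var / (e + real (n - s - 1) * var) + D * B4 k + dev (f3 k) (k - s)" by simp
    qed
    also have "\<dots> = real (n - s) * (3 * var / (e + real (n - s - 1) * var)) + D * (\<Sum>k = s + 1..n. B4 k) + (\<Sum>k = s + 1..n. dev (f3 k) (k - s))"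
    proof -
      have "(\<Sum>k = s + 1..n. c) = real (n - s) * c" for c :: real by simp
      then show ?thesis by (simp only: sum.distrib sum_distrib_left)
    qed
    also have "\<dots> \<le> 3 + D * b + C3 / (1 - \<alpha>_norm)"
    proof (intro add_mono mult_left_mono sumB4 dev3 D0)
      have pos: "0 < e + real (n - s - 1) * var" using e var_pos by (intro add_pos_nonneg) auto
      \<comment> \<open>An inequality and not an equality, because the subtraction truncates when s
        >= n.\<close>
      have "real (n - s) \<le> real (n - s - 1) + 1" by simp
      then have "real (n - s) * var \<le> (real (n - s - 1) + 1) * var" using var_pos by (intro mult_right_mono) auto
      also have "\<dots> \<le> e + real (n - s - 1) * var" using var_le_1 e by (simp add: distrib_right)
      finally show "real (n - s) * (3 * var / (e + real (n - s - 1) * var)) \<le> 3"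
        using pos by (simp add: field_simps)
    qed
    finally show ?thesis by (simp add: Y C3_def)
  qed
  \<comment> \<open>The diagonal s = n is empty, so its sum is 0.\<close>
  have Y0: "0 \<le> Y" using y_diag[of n] by simp
  define C2 where "C2 = \<alpha>_norm * Y + (9 * K * \<mu> * b + 2 * \<mu>)"
  have C20: "0 \<le> C2" using K_ge_1 \<mu>_nonneg b0 Y0 a by (simp add: C2_def)
  have dev2: "(\<Sum>k = s + 1..n. dev (f2 k) (k - s)) \<le> C2 / (1 - \<alpha>_norm)" for s
  proof (rule renewal_diagonal_bound[OF \<alpha>_nonneg sum_\<alpha>_le a(2) _ C20])
    fix k i :: nat assume "1 \<le> i"
    then show "dev (f2 k) i \<le> (\<Sum>l = 1..<i. \<alpha> (i - l) * dev (f2 k) l)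
        + ((\<Sum>l = 1..<i. \<alpha> (i - l) * y k l) + 9 * K * \<mu> * B4 k + 2 * tail i)"
      unfolding y_def by (intro dev_second_order[OF d3 L3 B3 B2])
  next
    fix s
    have "(\<Sum>k = s + 1..n. (\<Sum>l = 1..<k - s. \<alpha> (k - s - l) * y k l) + 9 * K * \<mu> * B4 k + 2 * tail (k - s))
      = (\<Sum>k = s + 1..n. \<Sum>l = 1..<k - s. \<alpha> (k - s - l) * y k l) + (9 * K * \<mu> * (\<Sum>k = s + 1..n. B4 k) + 2 * (\<Sum>k = s + 1..n. tail (k - s)))"
      by (simp add: sum.distrib sum_distrib_left)
    also have "\<dots> \<le> C2"
      unfolding C2_def using K_ge_1 \<mu>_nonneg
      by (intro add_mono mult_left_mono sumB4 sum_tail_diagonal_le convolution_shift_bound \<alpha>_nonneg sum_\<alpha>_le Y0 y_diag) auto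
    finally show "(\<Sum>k = s + 1..n. (\<Sum>l = 1..<k - s. \<alpha> (k - s - l) * y k l) + 9 * K * \<mu> * B4 k + 2 * tail (k - s)) \<le> C2" .
  qed
  \<comment> \<open>The interpolation: \<open>A n\<close> is the martingale smoothed by variance e,
    \<open>A 0\<close> a Gaussian expectation of variance e + n var, and passing from k - 1 to k
    trades one Gaussian step for one increment.\<close>
  define A where "A k = expectation (\<lambda>\<omega>. gauss_smooth (T k) u (mart k \<omega>))" for k
  have step: "\<bar>A k - A (k - 1)\<bar> \<le> dev (f2 k) k / 2 + y k k / 6 + 2 * K * B4 k" if k: "k \<in> {1..n}" for k
  proof -
    have "T (k - 1) = var + T k"
    proof -
      have "real (n - (k - 1)) = real (n - k) + 1" using k by (simp add: of_nat_diff)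
      then show ?thesis unfolding T_def by (simp add: algebra_simps)
    qed
    then have "gauss_smooth var (gauss_smooth (T k) u) = gauss_smooth (T (k - 1)) u"
      using gauss_smooth_semigroup[OF u less_imp_le[OF var_pos] less_imp_le[OF T0], of k] by simp
    then show ?thesis
      using lindeberg_step[OF d1 d2 d3 gauss_smooth_lipschitz[OF u] B2 B3 L3, of k k] k
      by (simp add: A_def y_def)
  qed
  have "\<bar>A n - A 0\<bar> \<le> (\<Sum>k = 1..n. dev (f2 k) k / 2 + y k k / 6 + 2 * K * B4 k)"
  proof -
    have "A m - A 0 = (\<Sum>k = 1..m. A k - A (k - 1))" for m by (induction m) simp_all
    from this[of n] show ?thesis by (simp only:) (rule order_trans[OF sum_abs sum_mono[OF step]])
  qed
  also have "\<dots> = (\<Sum>k = 0 + 1..n. dev (f2 k) (k - 0)) / 2 + (\<Sum>k = 0 + 1..n. y k (k - 0)) / 6 + 2 * K * (\<Sum>k = 0 + 1..n. B4 k)"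
    by (simp add: sum.distrib sum_distrib_left sum_divide_distrib)
  also have "\<dots> \<le> C2 / (1 - \<alpha>_norm) / 2 + Y / 6 + 2 * K * b"
    using K_ge_1 by (intro add_mono divide_right_mono mult_left_mono dev2 y_diag sumB4) auto
  finally have main: "\<bar>A n - A 0\<bar> \<le> C2 / (1 - \<alpha>_norm) / 2 + Y / 6 + 2 * K * b" .
  have "\<bar>A n - expectation (\<lambda>\<omega>. u (mart n \<omega>))\<bar> \<le> sqrt e"
  proof -
    have P: "poly_growth (\<lambda>\<omega>. gauss_smooth (T n) u (mart n \<omega>))" "poly_growth (\<lambda>\<omega>. u (mart n \<omega>))"
      by (intro poly_growth_lipschitz[OF gauss_smooth_lipschitz[OF u]] poly_growth_lipschitz[OF u] poly_growth_mart)+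
    have "\<bar>A n - expectation (\<lambda>\<omega>. u (mart n \<omega>))\<bar> = \<bar>expectation (\<lambda>\<omega>. gauss_smooth (T n) u (mart n \<omega>) - u (mart n \<omega>))\<bar>"
      unfolding A_def by (subst ev_diff) (intro P refl)+
    also have "\<dots> \<le> expectation (\<lambda>\<omega>. \<bar>gauss_smooth (T n) u (mart n \<omega>) - u (mart n \<omega>)\<bar>)"
      by (intro ev_abs poly_growth_diff P)
    also have "\<dots> \<le> expectation (\<lambda>_. sqrt e)"
    proof (intro ev_mono poly_growth_intros P)
      fix \<omega>
      show "\<bar>gauss_smooth (T n) u (mart n \<omega>) - u (mart n \<omega>)\<bar> \<le> sqrt e"
        using gauss_smooth_dist[OF u, of "T n"] e by (simp add: T_def)
    qed
    finally show ?thesis by (simp add: prob_space)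
  qed
  moreover have "\<bar>A 0 - gauss_smooth (real n * var) u 0\<bar> \<le> sqrt e"
  proof -
    have "A 0 = gauss_smooth (T 0) u 0" by (simp add: A_def mart_def prob_space)
    also have "\<dots> = gauss_smooth e (gauss_smooth (real n * var) u) 0"
      using e var_pos by (subst gauss_smooth_semigroup[OF u]) (auto simp: T_def)
    finally show ?thesis
      using gauss_smooth_dist[OF gauss_smooth_lipschitz[OF u], of e "real n * var" 0] e by simp
  qed
  ultimately show ?thesis using main unfolding mart_dist_def C2_def by linarith
qed

text \<open>Crude first-moment bounds on both sides. Only finiteness matters: for fixed n it makes
  the supremum of the closing argument finite.\<close>

lemma mart_dist_bounded:
  assumes u: "1-lipschitz_on UNIV u"
  shows "mart_dist u k \<le> 2 * (real k + 1)"
proof -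
  have P: "poly_growth (\<lambda>\<omega>. u (mart k \<omega>))" by (rule poly_growth_lipschitz[OF u poly_growth_mart])
  have "\<bar>expectation (\<lambda>\<omega>. u (mart k \<omega>)) - u 0\<bar> = \<bar>expectation (\<lambda>\<omega>. u (mart k \<omega>) - u 0)\<bar>"
    by (subst ev_diff) (auto intro!: P poly_growth_const simp: prob_space)
  also have "\<dots> \<le> expectation (\<lambda>\<omega>. \<bar>u (mart k \<omega>) - u 0\<bar>)"
    by (intro ev_abs poly_growth_intros P)
  also have "\<dots> \<le> expectation (\<lambda>\<omega>. \<bar>mart k \<omega>\<bar> * \<bar>1\<bar>)"
    using lipschitz_abs_le[OF u] by (intro ev_mono poly_growth_intros P) (metis abs_one diff_zero mult_1 mult.right_neutral)
  also have "\<dots> \<le> (real k + 1) / 2"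
    using expectation_mart_diff_sq_le[of 0 k]
    by (intro expectation_abs_mult_le poly_growth_intros) (auto simp: prob_space mart_def)
  finally have 1: "\<bar>expectation (\<lambda>\<omega>. u (mart k \<omega>)) - u 0\<bar> \<le> (real k + 1) / 2" .
  have "\<bar>gauss_smooth (real k * var) u 0 - u 0\<bar> \<le> 1 * sqrt (real k * var)"
    using var_pos by (intro gauss_smooth_dist u) auto
  also have "sqrt (real k * var) \<le> real k + 1"
  proof (rule real_le_lsqrt)
    have "real k * var \<le> real k * 1" using var_le_1 by (intro mult_left_mono) auto
    also have "\<dots> \<le> (real k + 1)\<^sup>2" by (simp add: power2_eq_square algebra_simps)
    finally show "real k * var \<le> (real k + 1)\<^sup>2" .
  qed simp
  finally have "\<bar>gauss_smooth (real k * var) u 0 - u 0\<bar> \<le> real k + 1" by simp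
  moreover have "\<bar>expectation (\<lambda>\<omega>. u (mart k \<omega>)) - u 0\<bar> \<le> real k + 1" using 1 by simp
  moreover have "mart_dist u k \<le> \<bar>expectation (\<lambda>\<omega>. u (mart k \<omega>)) - u 0\<bar> + \<bar>gauss_smooth (real k * var) u 0 - u 0\<bar>"
    unfolding mart_dist_def by (rule order_trans[OF _ abs_triangle_ineq4]) simp
  ultimately show ?thesis by simp
qed

lemma mart_dist_uniform:
  obtains C where "0 < C" "\<And>u n. 1-lipschitz_on UNIV u \<Longrightarrow> mart_dist u n \<le> C"
proof -
  define a where "a = 1 - \<alpha>_norm"
  have a: "0 < a" "a \<le> 1" using \<alpha>_norm_bounds by (auto simp: a_def)
  \<comment> \<open>With smoothing variance r^2 this gives 36 / (var * r) = a / 2, the value of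
    \<open>b\<close>. As \<open>Y\<close> enters with a total factor of at most 1 / a, the
    coefficient of \<open>D\<close> becomes 1/2.\<close>
  define r where "r = 72 / (var * a)"
  have va: "0 < var * a" "var * a \<le> 1" using var_pos var_le_1 a by (auto simp: mult_le_one)
  have r: "1 \<le> r" using va by (simp add: r_def field_simps)
  define b where "b = a / 2"
  define Y0 where "Y0 = 3 + (4 * K * \<mu> * b + 3 * \<mu>) / a"
  define C where "C = 2 * r + (9 * K * \<mu> * b + 2 * \<mu>) / a / 2 + 2 * K * b + Y0 / a"
  have b0: "0 \<le> b" using a by (simp add: b_def)
  have Y0: "0 \<le> Y0" using K_ge_1 \<mu>_nonneg b0 a by (simp add: Y0_def)
  have C: "0 < C"
    using K_ge_1 \<mu>_nonneg b0 a r Y0 unfolding C_def by (intro add_pos_nonneg) auto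
  have step: "mart_dist u n \<le> C + D / 2"
    if u: "1-lipschitz_on UNIV u" and D: "\<And>v k. 1-lipschitz_on UNIV v \<Longrightarrow> k \<le> n \<Longrightarrow> mart_dist v k \<le> D" for u n D
  proof -
    have D0: "0 \<le> D" using order_trans[OF mart_dist_nonneg D[OF u, of 0]] by simp
    let ?Y = "Y0 + D * b"
    have Y: "0 \<le> ?Y" using Y0 D0 b0 by simp
    have "mart_dist u n \<le> 2 * sqrt (r\<^sup>2) + (\<alpha>_norm * ?Y + (9 * K * \<mu> * b + 2 * \<mu>)) / (1 - \<alpha>_norm) / 2 + ?Y / 6 + 2 * K * b"
    proof (rule mart_dist_step[OF u _ D])
      show "1 \<le> r\<^sup>2" using r by simp
      have "36 / (var * r) = b" using var_pos a by (simp add: r_def b_def)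
      then show "36 / (var * sqrt (r\<^sup>2)) \<le> b" using r by simp
      show "?Y = 3 + D * b + (4 * K * \<mu> * b + 3 * \<mu>) / (1 - \<alpha>_norm)" by (simp add: Y0_def a_def)
    qed
    also have "\<dots> = 2 * r + (9 * K * \<mu> * b + 2 * \<mu>) / a / 2 + 2 * K * b + ((1 - a) * ?Y / a / 2 + ?Y / 6)"
      using r a by (simp add: a_def[symmetric] add_divide_distrib) (simp add: a_def)
    also have "(1 - a) * ?Y / a / 2 + ?Y / 6 \<le> ?Y / a"
    proof -
      have "(1 - a) * ?Y / a / 2 + ?Y / 6 = (?Y / a) * ((1 - a) / 2 + a / 6)" using a by (simp add: field_simps)
      also have "\<dots> \<le> (?Y / a) * 1" using Y a by (intro mult_left_mono) (auto simp: field_simps)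
      finally show ?thesis by simp
    qed
    also have "?Y / a = Y0 / a + D / 2" using a by (simp add: b_def field_simps)
    finally show ?thesis by (simp add: C_def)
  qed
  show thesis
  proof (rule that[of "2 * C"])
    fix u :: "real \<Rightarrow> real" and n assume u: "1-lipschitz_on UNIV u"
    \<comment> \<open>The supremum runs over all test functions and all times up to n, since the
      estimate for u calls on rescaled third derivatives at earlier times. \<open>C\<close> does not
      depend on n, hence neither does 2 C.\<close>
    define S where "S = {mart_dist v k | v k. 1-lipschitz_on UNIV v \<and> k \<le> n}"
    have uS: "mart_dist u n \<in> S" using u by (auto simp: S_def)
    have "bdd_above S"
    proof (rule bdd_aboveI[of _ "2 * (real n + 1)"])
      fix x assume "x \<in> S"
      then obtain v k where "x = mart_dist v k" "1-lipschitz_on UNIV v" "k \<le> n" by (auto simp: S_def)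
      then show "x \<le> 2 * (real n + 1)" using mart_dist_bounded[of v k] by simp
    qed
    then have up: "mart_dist v k \<le> Sup S" if "1-lipschitz_on UNIV v" "k \<le> n" for v k
      using that by (intro cSup_upper) (auto simp: S_def)
    have "Sup S \<le> C + Sup S / 2"
    proof (rule cSup_least)
      fix x assume "x \<in> S"
      then obtain v k where "x = mart_dist v k" "1-lipschitz_on UNIV v" "k \<le> n" by (auto simp: S_def)
      then show "x \<le> C + Sup S / 2" using step[of v k "Sup S"] up by simp
    qed (use uS in blast)
    then show "mart_dist u n \<le> 2 * C" using up[OF u, of n] by simp
  qed (use C in simp)
qed

section \<open>The intensity integral and the passage to the Wasserstein distance\<close>

lemma intensity_integral:
  "(LINT t:{0..real n}|lborel. hawkes_intensity \<alpha> X t \<omega>) = (\<Sum>k = 1..n. rate k \<omega>)"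
proof -
  let ?g = "\<lambda>t. \<Sum>k = 1..n. rate k \<omega> * indicator {real (k - 1)..<real k} t"
  have "(LINT t:{0..real n}|lborel. hawkes_intensity \<alpha> X t \<omega>) = (\<integral>t. ?g t \<partial>lborel)"
    unfolding set_lebesgue_integral_def
  proof (rule integral_cong_AE)
    show "(\<lambda>t. indicator {0..real n} t *\<^sub>R hawkes_intensity \<alpha> X t \<omega>) \<in> borel_measurable lborel"
      unfolding hawkes_intensity_def by measurable
    show "?g \<in> borel_measurable lborel" by measurable
    \<comment> \<open>The intervals are open on the right, so at t = n the intensity already takes
      the next rate; this single point is null.\<close>
    have "AE t in lborel. t \<noteq> real n" by (rule AE_lborel_singleton)
    then show "AE t in lborel. indicator {0..real n} t *\<^sub>R hawkes_intensity \<alpha> X t \<omega> = ?g t"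
    proof eventually_elim
      case (elim t)
      show ?case
      proof (cases "0 \<le> t \<and> t < real n")
        case True
        then have n: "n \<ge> 1" by (cases n) auto
        have "(\<Sum>k. rate (k + 2) \<omega> * indicator {real k + 1..<real k + 2} t)
          = (\<Sum>k<n - 1. rate (k + 2) \<omega> * indicator {real k + 1..<real k + 2} t)"
        proof (rule suminf_finite)
          fix k assume "k \<notin> {..<n - 1}"
          then have "n - 1 \<le> k" by simp
          then have "real n \<le> real k + 1" by linarith
          then show "rate (k + 2) \<omega> * indicator {real k + 1..<real k + 2} t = 0" using True by simp
        qed simp
        also have "\<dots> = (\<Sum>k = 2..n. rate k \<omega> * indicator {real (k - 1)..<real k} t)"
          by (rule sum.reindex_bij_witness[of _ "\<lambda>k. k - 2" "\<lambda>k. k + 2"]) (auto simp: of_nat_diff algebra_simps)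
        finally have "hawkes_intensity \<alpha> X t \<omega> = rate 1 \<omega> * indicator {real (1 - 1)..<real 1} t
            + (\<Sum>k = 2..n. rate k \<omega> * indicator {real (k - 1)..<real k} t)"
          by (simp add: hawkes_intensity_def hawkes_rate_def[of \<alpha> X "Suc 0"])
        also have "\<dots> = ?g t"
          unfolding sum.atLeast_Suc_atMost[OF n] by (simp only: Suc_1)
        finally show ?thesis using True by simp
      next
        case False
        have "rate k \<omega> * indicator {real (k - 1)..<real k} t = 0" if "k \<in> {1..n}" for k
          using False that by (auto simp: indicator_def)
        then have "?g t = 0" by (intro sum.neutral) blast
        moreover have "t \<notin> {0..real n}" using False elim by auto
        ultimately show ?thesis by simp
      qed
    qed
  qed
  also have "\<dots> = (\<Sum>k = 1..n. \<integral>t. rate k \<omega> * indicator {real (k - 1)..<real k} t \<partial>lborel)"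
    by (rule Bochner_Integration.integral_sum) (auto intro!: integrable_mult_right)
  also have "\<dots> = (\<Sum>k = 1..n. rate k \<omega>)"
    by (intro sum.cong) (auto simp: of_nat_diff)
  finally show ?thesis .
qed

lemma hawkes_F_eq: "hawkes_F \<alpha> X n \<omega> = mart n \<omega> / sqrt (real n)"
  by (simp add: hawkes_F_def intensity_integral hawkes_count_def mart_def incr_def sum_subtractf)

lemma wasserstein_hawkes_F_le:
  assumes C: "\<And>u n. 1-lipschitz_on UNIV u \<Longrightarrow> mart_dist u n \<le> C" and n: "n \<ge> 1"
  shows "wasserstein_dist (distr M borel (hawkes_F \<alpha> X n)) (density lborel (normal_density 0 (sqrt var)))
    \<le> ennreal (C / sqrt (real n))"
proof -
  let ?F = "hawkes_F \<alpha> X n" and ?N = "density lborel (normal_density 0 (sqrt var))" and ?r = "sqrt (real n)"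
  have r: "0 < ?r" using n by simp
  have pF: "poly_growth ?F"
    using poly_growth_mult[OF poly_growth_mart[of n] poly_growth_const[of "1 / ?r"]]
    by (simp add: hawkes_F_eq[abs_def])
  note [measurable] = poly_growth_measurable[OF pF]
  have id: "1-lipschitz_on UNIV (\<lambda>x::real. x)" by (intro lipschitzI_abs) auto
  \<comment> \<open>Finite first moments of both laws select the supremum branch in the definition
    of the distance.\<close>
  have 1: "integrable (distr M borel ?F) (\<lambda>x. x)"
    using poly_growth_integrable[OF pF] by (subst integrable_distr_eq) auto
  have 2: "integrable ?N (\<lambda>x. x)"
    using integrable_normal_lipschitz[OF id, of "sqrt var" 0 1] var_pos by simp
  have "\<bar>(\<integral>x. u x \<partial>distr M borel ?F) - (\<integral>x. u x \<partial>?N)\<bar> \<le> C / ?r" if u: "1-lipschitz_on UNIV u" for u :: "real \<Rightarrow> real"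
  proof -
    note [measurable] = lipschitz_borel[OF u]
    \<comment> \<open>Rescaled to the unnormalised martingale, the test function stays 1-Lipschitz.
      Both expectations acquire the factor \<open>?r\<close>, which turns the constant bound into
      one of order 1 / sqrt n.\<close>
    define v where "v y = ?r * u (y / ?r)" for y
    have v: "1-lipschitz_on UNIV v"
    proof (rule lipschitzI_abs)
      fix x y
      have "\<bar>v y - v x\<bar> = ?r * \<bar>u (y / ?r) - u (x / ?r)\<bar>"
        unfolding v_def using r by (simp flip: right_diff_distrib add: abs_mult)
      also have "\<dots> \<le> ?r * (1 * \<bar>y / ?r - x / ?r\<bar>)" using r by (intro mult_left_mono lipschitz_abs_le u) auto
      also have "\<dots> = \<bar>?r * (y / ?r - x / ?r)\<bar>" using r by (simp add: abs_mult)
      also have "\<dots> = \<bar>y - x\<bar>" using r by (simp add: right_diff_distrib)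
      finally show "\<bar>v y - v x\<bar> \<le> 1 * \<bar>y - x\<bar>" by simp
    qed simp
    have E: "expectation (\<lambda>\<omega>. v (mart n \<omega>)) = ?r * (\<integral>x. u x \<partial>distr M borel ?F)"
      by (subst integral_distr) (auto simp: v_def hawkes_F_eq)
    have G: "gauss_smooth (real n * var) v 0 = ?r * (\<integral>x. u x \<partial>?N)"
    proof -
      have "gauss_smooth (real n * var) v 0 = ?r * gauss_smooth var u 0"
        unfolding gauss_smooth_def v_def using r by (simp add: real_sqrt_mult mult.left_commute)
      also have "gauss_smooth var u 0 = (\<integral>x. u x \<partial>?N)"
        using var_pos by (simp add: gauss_smooth_normal)
      finally show ?thesis .
    qed
    have "?r * \<bar>(\<integral>x. u x \<partial>distr M borel ?F) - (\<integral>x. u x \<partial>?N)\<bar> \<le> C"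
      using C[OF v, of n] r unfolding mart_dist_def E G by (simp flip: right_diff_distrib add: abs_mult)
    then show ?thesis using r by (simp add: field_simps)
  qed
  then show ?thesis
    unfolding wasserstein_dist_def using 1 2 by (auto intro!: SUP_least ennreal_leI)
qed

end

theorem theorem6p6:
  fixes M :: "'a measure" and \<alpha> :: "nat \<Rightarrow> real" and X :: "nat \<Rightarrow> 'a \<Rightarrow> nat"
  assumes "\<And>k. \<alpha> k > 0"
    and "summable \<alpha>" and "(\<Sum>k. \<alpha> k) < 1"
    and "summable (\<lambda>k. real k * \<alpha> k)"
    and "discrete_hawkes M \<alpha> X"
  defines "\<sigma> \<equiv> sqrt (\<alpha> 0 / (1 - (\<Sum>k. \<alpha> (Suc k))))"
  shows "\<exists>C>0. \<forall>n\<ge>1.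
           wasserstein_dist (distr M borel (hawkes_F \<alpha> X n)) (density lborel (normal_density 0 \<sigma>))
             \<le> ennreal (C / sqrt (real n))"
proof -
  interpret prob_space M using assms(5) by (simp add: discrete_hawkes_def)
  interpret hawkes M \<alpha> X by unfold_locales (use assms(1-5) in auto)
  have \<sigma>: "\<sigma> = sqrt var" by (simp add: \<sigma>_def var_def \<alpha>_norm_def)
  obtain C where C: "0 < C" "\<And>u n. 1-lipschitz_on UNIV u \<Longrightarrow> mart_dist u n \<le> C"
    by (rule mart_dist_uniform) (rule that)
  show ?thesis
    unfolding \<sigma> using C by (intro exI[of _ C]) (auto intro: wasserstein_hawkes_F_le)
qed

end
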